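(* Let $M$ be a $d\times d$ dilation matrix and let $\phi$ be an $r\times1$ vector of compactly supported distributions satisfying $\widehat\phi(M^T\xi)=\widehat a(\xi)\widehat\phi(\xi)$ with $\widehat\phi(0)\ne0$ and a finitely supported matrix-valued filter $a\in(l_0(\mathbb Z^d))^{r\times r}$. Suppose that $a$ has order $m$ sum rules with respect to $M$ with a matching filter $\upsilon\in(l_0(\mathbb Z^d))^{1\times r}$ such that $\widehat\upsilon(0)\widehat\phi(0)=1$. If $r\ge2$, then for any positive integer $n$ there exists a strongly invertible $r\times r$ matrix $\widehat U$ of $2\pi\mathbb Z^d$-periodic trigonometric polynomials such that the following hold: (1) Define $\widehat{\mathring\upsilon}(\xi)=(\widehat{\mathring\upsilon_1}(\xi),\dots,\widehat{\mathring\upsilon_r}(\xi)):=\widehat\upsilon(\xi)\widehat U(\xi)^{-1}$ and $\widehat{\mathring\phi}(\xi)=(\widehat{\mathring\phi_1}(\xi),\dots,\widehat{\mathring\phi_r}(\xi))^T:=\widehat U(\xi)\widehat\phi(\xi)$. Then, as $\xi\to0$, $$\widehat{\mathring\phi_1}(\xi)=1+O(\|\xi\|^n),\quad \widehat{\mathring\phi_\ell}(\xi)=O(\|\xi\|^n),\quad \ell=2,\dots,r,$$ $$\widehat{\mathring\upsilon_1}(\xi)=1+O(\|\xi\|^m),\quad \widehat{\mathring\upsilon_\ell}(\xi)=O(\|\xi\|^m),\quad \ell=2,\dots,r.$$ (2) Define $\mathring a\in(l_0(\mathbb Z^d))^{r\times r}$ by $\widehat{\mathring a}(\xi):=\widehat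 U(M^T\xi)\widehat a(\xi)\widehat U(\xi)^{-1}$. Then $\mathring a$ takes the standard $(m,n)$-normal form, i.e. $$\widehat{\mathring a}(\xi)=\begin{bmatrix}\widehat{\mathring a_{1,1}}(\xi)&\widehat{\mathring a_{1,2}}(\xi)\\ \widehat{\mathring a_{2,1}}(\xi)&\widehat{\mathring a_{2,2}}(\xi)\end{bmatrix},$$ where $\widehat{\mathring a_{1,1}},\widehat{\mathring a_{1,2}},\widehat{\mathring a_{2,1}},\widehat{\mathring a_{2,2}}$ are $1\times1$, $1\times(r-1)$, $(r-1)\times1$, $(r-1)\times(r-1)$ matrices of $2\pi\mathbb Z^d$-periodic trigonometric polynomials such that, as $\xi\to0$, $\widehat{\mathring a_{1,1}}(\xi)=1+O(\|\xi\|^n)$; $\widehat{\mathring a_{1,1}}(\xi+2\pi\omega)=O(\|\xi\|^m)$ for all $\omega\in\Omega_M\setminus\{0\}$; $\widehat{\mathring a_{1,2}}(\xi+2\pi\omega)=O(\|\xi\|^m)$ for all $\omega\in\Omega_M$; $\widehat{\mathring a_{2,1}}(\xi)=O(\|\xi\|^n)$. Moreover, $\widehat{\mathring\phi}(M^T\xi)=\widehat{\mathring a}(\xi)\widehat{\mathring\phi}(\xi)$ and $\mathring a$ has order $m$ sum rules with respect to $M$ with the matching filter $\mathring\upsilon\in(l_0(\mathbb Z^d))^{1\times r}$ of item (1). (3) Write $\|\widehat\phi(\xi)\|^2:=\overline{\widehat\phi(\xi)}^T\widehat\phi(\xi)$. If in addition $$\widehat\upsilon(\xi)=\|\widehat\phi(\xi)\|^{-2}\,\overline{\widehat\phi(\xi)}^T+O(\|\xi\|^m),\quad\xi\to0,\qquad(\ast)$$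 then $\widehat U$ (still strongly invertible and satisfying (1) and (2)) can be chosen to satisfy also the "almost orthogonality" condition $$\overline{\widehat U(\xi)}^{-T}\widehat U(\xi)^{-1}=\mathrm{Diag}\big(\|\widehat\phi(\xi)\|^2,\|\widehat{u_2}(\xi)\|^2,\dots,\|\widehat{u_r}(\xi)\|^2\big)+O(\|\xi\|^{\tilde n}),\quad\xi\to0,\qquad(\ast\ast)$$ where $\widehat{u_j}$ is the $j$-th column of $\widehat U^{-1}$ for $j=2,\dots,r$ and $\tilde n:=\max(m,n)$. Conversely, if there exists a strongly invertible matrix $\widehat U$ of $2\pi\mathbb Z^d$-periodic trigonometric polynomials such that items (1), (2) and $(\ast\ast)$ hold with $n\ge m$, then $(\ast)$ must hold.
   Context: $m$ is a positive integer. A dilation matrix is a $d\times d$ integer matrix all of whose eigenvalues exceed one in modulus. $(l_0(\mathbb Z^d))^{r\times s}$ is the space of finitely supported $u:\mathbb Z^d\to\mathbb C^{r\times s}$, with $\widehat u(\xi):=\sum_{k\in\mathbb Z^d}u(k)e^{-ik\cdot\xi}$. The Fourier transform is $\widehat f(\xi)=\int_{\mathbb R^d}f(x)e^{-ix\cdot\xi}dx$, extended to tempered distributions and applied entrywise (for a compactly supported distribution it is a smooth function). $f(\xi)=g(\xi)+O(\|\xi\|^m)$ as $\xi\to0$ means $\partial^\mu f(0)=\partial^\mu g(0)$ for all multi-indices $\mu$ with $|\mu|<m$ (entrywise). $\boldsymbol\delta(0):=1$, $\boldsymbol\delta(x):=0$ for $x\neq0$. $\Omega_M:=(M^{-T}\mathbb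 Z^d)\cap[0,1)^d$. Sum rules: $a\in(l_0(\mathbb Z^d))^{r\times r}$ has order $m$ sum rules with respect to $M$ with a matching filter $\upsilon\in(l_0(\mathbb Z^d))^{1\times r}$ if $\widehat\upsilon(0)\ne0$ and $\widehat\upsilon(M^T\xi)\widehat a(\xi+2\pi\omega)=\boldsymbol\delta(\omega)\widehat\upsilon(\xi)+O(\|\xi\|^m)$ as $\xi\to0$ for all $\omega\in\Omega_M$. An $r\times r$ matrix $\widehat U$ of $2\pi\mathbb Z^d$-periodic trigonometric polynomials is strongly invertible if $\widehat U^{-1}$ is also a matrix of $2\pi\mathbb Z^d$-periodic trigonometric polynomials. $\|\cdot\|$ of a vector is the $l_2$ norm. *)

theory Defs
  imports "HOL-Analysis.Analysis"
begin

section \<open>Iterated partial derivatives and jets at the origin\<close>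

definition partial_deriv :: "'d::finite \<Rightarrow> (real^'d \<Rightarrow> complex) \<Rightarrow> real^'d \<Rightarrow> complex" where
  "partial_deriv i f x = vector_derivative (\<lambda>t. f (x + t *\<^sub>R axis i 1)) (at 0)"

text \<open>The list \<open>[i1, \<dots>, ik]\<close> of coordinate directions stands for the multi-index in which \<open>i\<close>
  has the multiplicity it has in the list; the order of the multi-index is the length of the list.
  Every multi-index arises in this way, and where mixed partial derivatives commute (as they do
  for functions that are smooth near the point) lists for the same multi-index give the same
  derivative.\<close>

fun partial_derivs :: "'d::finite list \<Rightarrow> (real^'d \<Rightarrow> complex) \<Rightarrow> real^'d \<Rightarrow> complex" where
  "partial_derivs [] f = f"
| "partial_derivs (i # is) f = partial_deriv i (partial_derivs is f)"

definition smooth_fun :: "(real^'d::finite \<Rightarrow> complex) \<Rightarrow> bool" where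
  "smooth_fun f \<longleftrightarrow> (\<forall>is. partial_derivs is f differentiable_on UNIV)"

text \<open>\<open>eq_upto m f g\<close> is \<open>f(\<xi>) = g(\<xi>) + O(\<parallel>\<xi>\<parallel>^m)\<close> as \<open>\<xi> \<rightarrow> 0\<close>.\<close>

definition eq_upto :: "nat \<Rightarrow> (real^'d::finite \<Rightarrow> complex) \<Rightarrow> (real^'d \<Rightarrow> complex) \<Rightarrow> bool" where
  "eq_upto m f g \<longleftrightarrow> (\<forall>is. length is < m \<longrightarrow> partial_derivs is f 0 = partial_derivs is g 0)"

section \<open>Compactly supported distributions and their Fourier transform\<close>

text \<open>The compactly supported distributions on \<open>\<real>^d\<close> are the complex linear functionals on the
  smooth functions that are continuous for uniform convergence of all derivatives on compact
  sets, which is expressed by the usual seminorm estimate. The values of the functional at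
  functions that are not smooth are irrelevant. A compactly supported integrable function \<open>f\<close>
  is the functional that sends \<open>g\<close> to the integral of \<open>f * g\<close>.\<close>

definition compactly_supported_distribution ::
    "((real^'d::finite \<Rightarrow> complex) \<Rightarrow> complex) \<Rightarrow> bool" where
  "compactly_supported_distribution T \<longleftrightarrow>
     (\<forall>f g. smooth_fun f \<longrightarrow> smooth_fun g \<longrightarrow> T (\<lambda>x. f x + g x) = T f + T g) \<and>
     (\<forall>c f. smooth_fun f \<longrightarrow> T (\<lambda>x. c * f x) = c * T f) \<and>
     (\<exists>K N C. compact K \<and>
        (\<forall>f B. smooth_fun f \<longrightarrow> 0 \<le> B \<longrightarrow>
           (\<forall>is. \<forall>x\<in>K. length is \<le> N \<longrightarrow> cmod (partial_derivs is f x) \<le> B) \<longrightarrow>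
           cmod (T f) \<le> C * B))"

text \<open>The Fourier transform (in the sense of tempered distributions) of a compactly supported
  distribution is the smooth function obtained by pairing the distribution with the exponentials;
  for an integrable function this is the integral of \<open>f(x) exp(-i x\<cdot>\<xi>)\<close>.\<close>

definition distr_fourier ::
    "((real^'d::finite \<Rightarrow> complex) \<Rightarrow> complex) \<Rightarrow> real^'d \<Rightarrow> complex" where
  "distr_fourier T \<xi> = T (\<lambda>x. exp (- \<i> * complex_of_real (x \<bullet> \<xi>)))"

definition distr_vec_fourier ::
    "('r::finite \<Rightarrow> (real^'d::finite \<Rightarrow> complex) \<Rightarrow> complex) \<Rightarrow> real^'d \<Rightarrow> complex^'r" where
  "distr_vec_fourier \<phi> \<xi> = (\<chi> j. distr_fourier (\<phi> j) \<xi>)"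

section \<open>Finitely supported filters\<close>

definition finitely_supported :: "(int^'d::finite \<Rightarrow> 'b::zero) \<Rightarrow> bool" where
  "finitely_supported u \<longleftrightarrow> finite {k. u k \<noteq> 0}"

definition real_vec :: "int^'d::finite \<Rightarrow> real^'d" where
  "real_vec k = (\<chi> i. real_of_int (k $ i))"

definition filter_fourier :: "(int^'d::finite \<Rightarrow> complex) \<Rightarrow> real^'d \<Rightarrow> complex" where
  "filter_fourier u \<xi> =
     (\<Sum>k | u k \<noteq> 0. u k * exp (- \<i> * complex_of_real (real_vec k \<bullet> \<xi>)))"

text \<open>Filters with values in \<open>1 \<times> r\<close> matrices are filters with values in row vectors.\<close>

definition row_filter_fourier ::
    "(int^'d::finite \<Rightarrow> complex^'r::finite) \<Rightarrow> real^'d \<Rightarrow> complex^'r" where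
  "row_filter_fourier u \<xi> = (\<chi> j. filter_fourier (\<lambda>k. u k $ j) \<xi>)"

definition matrix_filter_fourier ::
    "(int^'d::finite \<Rightarrow> complex^'s::finite^'r::finite) \<Rightarrow> real^'d \<Rightarrow> complex^'s^'r" where
  "matrix_filter_fourier u \<xi> = (\<chi> i j. filter_fourier (\<lambda>k. u k $ i $ j) \<xi>)"

text \<open>Matrices of \<open>2\<pi>\<int>^d\<close>-periodic trigonometric polynomials.\<close>

definition trig_poly_matrix :: "(real^'d::finite \<Rightarrow> complex^'s::finite^'r::finite) \<Rightarrow> bool" where
  "trig_poly_matrix F \<longleftrightarrow> (\<exists>u. finitely_supported u \<and> F = matrix_filter_fourier u)"

definition strongly_invertible :: "(real^'d::finite \<Rightarrow> complex^'r::finite^'r) \<Rightarrow> bool" where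
  "strongly_invertible U \<longleftrightarrow>
     trig_poly_matrix U \<and> (\<forall>\<xi>. invertible (U \<xi>)) \<and> trig_poly_matrix (\<lambda>\<xi>. matrix_inv (U \<xi>))"

section \<open>Dilation matrices and sum rules\<close>

definition dilation_matrix :: "int^'d::finite^'d \<Rightarrow> bool" where
  "dilation_matrix M \<longleftrightarrow>
     (\<forall>(c::complex) v. v \<noteq> 0 \<longrightarrow> map_matrix complex_of_int M *v v = c *s v \<longrightarrow> 1 < cmod c)"

definition transpose_real :: "int^'d::finite^'d \<Rightarrow> real^'d^'d" where
  "transpose_real M = transpose (map_matrix real_of_int M)"

definition Omega :: "int^'d::finite^'d \<Rightarrow> (real^'d) set" where
  "Omega M = {\<omega>. (\<exists>k. \<omega> = matrix_inv (transpose_real M) *v real_vec k) \<and>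
                   (\<forall>i. 0 \<le> \<omega> $ i \<and> \<omega> $ i < 1)}"

definition sum_rules ::
    "nat \<Rightarrow> int^'d::finite^'d \<Rightarrow> (int^'d \<Rightarrow> complex^'r::finite^'r) \<Rightarrow> (int^'d \<Rightarrow> complex^'r) \<Rightarrow> bool"
  where
  "sum_rules m M a \<upsilon> \<longleftrightarrow>
     row_filter_fourier \<upsilon> 0 \<noteq> 0 \<and>
     (\<forall>\<omega>\<in>Omega M. \<forall>j.
        eq_upto m
          (\<lambda>\<xi>. (row_filter_fourier \<upsilon> (transpose_real M *v \<xi>)
                   v* matrix_filter_fourier a (\<xi> + (2 * pi) *\<^sub>R \<omega>)) $ j)
          (\<lambda>\<xi>. (if \<omega> = 0 then 1 else 0) * row_filter_fourier \<upsilon> \<xi> $ j))"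

section \<open>Normal form\<close>

text \<open>Throughout, \<open>e :: 'r\<close> is the index in the role of \<open>1\<close> and the indices different from \<open>e\<close>
  are in the role of \<open>2, \<dots>, r\<close>. The blocks \<open>(1,1)\<close>, \<open>(1,2)\<close>, \<open>(2,1)\<close>, \<open>(2,2)\<close> of an \<open>r \<times> r\<close> matrix
  consist of the entries \<open>(e,e)\<close>, \<open>(e,j)\<close>, \<open>(i,e)\<close>, \<open>(i,j)\<close> with \<open>i, j \<noteq> e\<close>.\<close>

definition normal_form ::
    "nat \<Rightarrow> nat \<Rightarrow> int^'d::finite^'d \<Rightarrow> 'r::finite \<Rightarrow> (int^'d \<Rightarrow> complex^'r^'r) \<Rightarrow> bool" where
  "normal_form m n M e a \<longleftrightarrow>
     eq_upto n (\<lambda>\<xi>. matrix_filter_fourier a \<xi> $ e $ e) (\<lambda>\<xi>. 1) \<and>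
     (\<forall>\<omega>\<in>Omega M - {0}.
        eq_upto m (\<lambda>\<xi>. matrix_filter_fourier a (\<xi> + (2 * pi) *\<^sub>R \<omega>) $ e $ e) (\<lambda>\<xi>. 0)) \<and>
     (\<forall>\<omega>\<in>Omega M. \<forall>j. j \<noteq> e \<longrightarrow>
        eq_upto m (\<lambda>\<xi>. matrix_filter_fourier a (\<xi> + (2 * pi) *\<^sub>R \<omega>) $ e $ j) (\<lambda>\<xi>. 0)) \<and>
     (\<forall>i. i \<noteq> e \<longrightarrow> eq_upto n (\<lambda>\<xi>. matrix_filter_fourier a \<xi> $ i $ e) (\<lambda>\<xi>. 0))"

text \<open>In the following, \<open>\<phi>h\<close> is the Fourier transform of the vector of distributions. With
  \<open>\<upsilon>h\<close> and \<open>ah\<close> denoting the transforms of the filters \<open>\<upsilon>\<close> and \<open>a\<close>, the new vector, the new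
  matching filter and the new filter have the transforms \<open>U(\<xi>) \<phi>h(\<xi>)\<close>, \<open>\<upsilon>h(\<xi>) U(\<xi>)^{-1}\<close> and
  \<open>U(M^T \<xi>) ah(\<xi>) U(\<xi>)^{-1}\<close>. The filters are determined by their transforms, so that the
  existential quantifier in \<open>normalized_filter\<close> only names them.\<close>

definition normalized_pair ::
    "nat \<Rightarrow> nat \<Rightarrow> 'r::finite \<Rightarrow> (real^'d::finite \<Rightarrow> complex^'r) \<Rightarrow> (int^'d \<Rightarrow> complex^'r) \<Rightarrow>
     (real^'d \<Rightarrow> complex^'r^'r) \<Rightarrow> bool" where
  "normalized_pair m n e \<phi>h \<upsilon> U \<longleftrightarrow>
     eq_upto n (\<lambda>\<xi>. (U \<xi> *v \<phi>h \<xi>) $ e) (\<lambda>\<xi>. 1) \<and>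
     (\<forall>l. l \<noteq> e \<longrightarrow> eq_upto n (\<lambda>\<xi>. (U \<xi> *v \<phi>h \<xi>) $ l) (\<lambda>\<xi>. 0)) \<and>
     eq_upto m (\<lambda>\<xi>. (row_filter_fourier \<upsilon> \<xi> v* matrix_inv (U \<xi>)) $ e) (\<lambda>\<xi>. 1) \<and>
     (\<forall>l. l \<noteq> e \<longrightarrow>
        eq_upto m (\<lambda>\<xi>. (row_filter_fourier \<upsilon> \<xi> v* matrix_inv (U \<xi>)) $ l) (\<lambda>\<xi>. 0))"

definition normalized_filter ::
    "nat \<Rightarrow> nat \<Rightarrow> int^'d::finite^'d \<Rightarrow> 'r::finite \<Rightarrow> (real^'d \<Rightarrow> complex^'r) \<Rightarrow>
     (int^'d \<Rightarrow> complex^'r^'r) \<Rightarrow> (int^'d \<Rightarrow> complex^'r) \<Rightarrow> (real^'d \<Rightarrow> complex^'r^'r) \<Rightarrow> bool" where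
  "normalized_filter m n M e \<phi>h a \<upsilon> U \<longleftrightarrow>
     (\<exists>a' \<upsilon>'. finitely_supported a' \<and> finitely_supported \<upsilon>' \<and>
        (\<forall>\<xi>. matrix_filter_fourier a' \<xi> =
               U (transpose_real M *v \<xi>) ** matrix_filter_fourier a \<xi> ** matrix_inv (U \<xi>)) \<and>
        (\<forall>\<xi>. row_filter_fourier \<upsilon>' \<xi> = row_filter_fourier \<upsilon> \<xi> v* matrix_inv (U \<xi>)) \<and>
        normal_form m n M e a' \<and>
        (\<forall>\<xi>. U (transpose_real M *v \<xi>) *v \<phi>h (transpose_real M *v \<xi>) =
               matrix_filter_fourier a' \<xi> *v (U \<xi> *v \<phi>h \<xi>)) \<and>
        sum_rules m M a' \<upsilon>')"

definition row_condition ::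
    "nat \<Rightarrow> (real^'d::finite \<Rightarrow> complex^'r::finite) \<Rightarrow> (int^'d \<Rightarrow> complex^'r) \<Rightarrow> bool" where
  "row_condition m \<phi>h \<upsilon> \<longleftrightarrow>
     (\<forall>j. eq_upto m (\<lambda>\<xi>. row_filter_fourier \<upsilon> \<xi> $ j)
            (\<lambda>\<xi>. inverse (complex_of_real ((norm (\<phi>h \<xi>))\<^sup>2)) * cnj (\<phi>h \<xi> $ j)))"

definition almost_orthogonal ::
    "nat \<Rightarrow> 'r::finite \<Rightarrow> (real^'d::finite \<Rightarrow> complex^'r) \<Rightarrow> (real^'d \<Rightarrow> complex^'r^'r) \<Rightarrow> bool" where
  "almost_orthogonal N e \<phi>h U \<longleftrightarrow>
     (\<forall>i j. eq_upto N
        (\<lambda>\<xi>. (transpose (matrix_inv (map_matrix cnj (U \<xi>))) ** matrix_inv (U \<xi>)) $ i $ j)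
        (\<lambda>\<xi>. if i \<noteq> j then 0
              else if i = e then complex_of_real ((norm (\<phi>h \<xi>))\<^sup>2)
              else complex_of_real ((norm (column i (matrix_inv (U \<xi>))))\<^sup>2)))"

end

theory Submission
  imports Defs "HOL-Computational_Algebra.Fundamental_Theorem_Algebra"
begin

text \<open>All conditions on \<open>U\<close> concern jets at the origin, and every jet of a smooth function is the
  jet of a trigonometric polynomial. The sum rules and the refinement equation make the jet of
  \<open>\<upsilon>h \<phi>h\<close> invariant under \<open>M^T\<close>, hence constant: the powers of \<open>M^{-1}\<close> tend to \<open>0\<close>. Dividing by
  \<open>\<upsilon>h \<phi>h\<close>, or replacing \<open>\<upsilon>h\<close> by the right-hand side of \<open>(\<ast>)\<close>, gives a smooth row \<open>y\<close> that agrees with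
  \<open>\<upsilon>h\<close> to order \<open>m\<close> and satisfies \<open>y \<phi>h = 1\<close> near the origin.
  Finitely many transvections \<open>I + c w^T\<close> with \<open>w^T c = 0\<close>, whose inverses \<open>I - c w^T\<close> are again
  polynomial, move \<open>\<phi>h\<close> to the first unit column and \<open>y\<close> to the first unit row, to any
  prescribed order; this needs \<open>r \<ge> 2\<close> in order to make the first entry of \<open>\<phi>h\<close> equal to \<open>1\<close>.
  The Gram-Schmidt process without normalization consists of transvections as well; applied to
  the columns of \<open>U^{-1}\<close> other than the first, which are orthogonal to \<open>\<phi>h\<close> when \<open>y\<close> is a
  multiple of the conjugate of \<open>\<phi>h\<close>, it yields the almost orthogonality.\<close>

text \<open>The pairing of \<open>\<upsilon>h\<close> with \<open>\<phi>h\<close> is known to be 1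
  only to order \<open>m\<close>, whereas a matrix that moves a row and a column to unit vectors to
  some order preserves their pairing to that order. Hence the substitute row \<open>y\<close>: its
  pairing is 1 on a neighbourhood, so the single order \<open>max m n\<close> can be used
  throughout, and \<open>\<upsilon>h\<close> keeps order \<open>m\<close> through its agreement with
  \<open>y\<close>. Strong invertibility forbids scaling an entry by a general trigonometric
  polynomial. This is why an entry is made 1 by adding a multiple of another one, and why squared
  column norms remain on the diagonal in \<open>(\<ast>\<ast>)\<close>. Item (2) follows from item
  (1) for every \<open>U\<close>, so \<open>U\<close> is constructed without regard to the filter
  and the dilation. Quotients such as the right-hand side of \<open>(\<ast>)\<close> are smooth only
  near the origin, so jets are computed with germs. As \<open>partial_derivs\<close> iterates in the
  order of a list, symmetry of second derivatives has to enter; it does so in Euler's identity,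
  which produces trigonometric polynomials with a given leading jet.\<close>

text \<open>\<open>vector_derivative\<close> is a choice operator, so its value is informative only
  where a derivative exists. Through this bridge the differentiation rules are read off from those
  of the Frechet derivative.\<close>

lemma has_derivative_partial_deriv:
  fixes f :: "real^'d::finite \<Rightarrow> complex"
  assumes "(f has_derivative f') (at x)"
  shows "partial_deriv i f x = f' (axis i 1)"
proof -
  have "((\<lambda>t. x + t *\<^sub>R axis i 1) has_derivative (\<lambda>t. t *\<^sub>R axis i 1)) (at (0::real))"
    by (auto intro!: derivative_eq_intros)
  moreover have "(f has_derivative f') (at (x + 0 *\<^sub>R axis i 1))"
    using assms by simp
  ultimately have "((\<lambda>t. f (x + t *\<^sub>R axis i 1)) has_derivative (\<lambda>t. f' (t *\<^sub>R axis i 1))) (at 0)"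
    by (rule has_derivative_compose)
  then have "((\<lambda>t. f (x + t *\<^sub>R axis i 1)) has_vector_derivative f' (axis i 1)) (at 0)"
    unfolding has_vector_derivative_def
    using linear_scale[OF has_derivative_linear[OF assms]] by simp
  then show ?thesis
    unfolding partial_deriv_def by (rule vector_derivative_at)
qed

lemma has_derivative_frechet:
  "f differentiable (at x) \<Longrightarrow> (f has_derivative frechet_derivative f (at x)) (at x)"
  by (simp add: frechet_derivative_works)

lemma has_derivative_partial_derivs_sum:
  fixes f :: "real^'d::finite \<Rightarrow> complex"
  assumes "f differentiable (at x)"
  shows "(f has_derivative (\<lambda>h. \<Sum>j\<in>UNIV. (h $ j) *\<^sub>R partial_deriv j f x)) (at x)"
proof -
  let ?D = "frechet_derivative f (at x)"
  have D: "(f has_derivative ?D) (at x)" using assms by (rule has_derivative_frechet)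
  have l: "linear ?D" using D by (rule has_derivative_linear)
  have "?D h = (\<Sum>j\<in>UNIV. (h $ j) *\<^sub>R partial_deriv j f x)" for h
  proof -
    have "?D h = ?D (\<Sum>j\<in>UNIV. (h $ j) *\<^sub>R axis j 1)"
      by (simp add: basis_expansion scalar_mult_eq_scaleR[symmetric])
    also have "\<dots> = (\<Sum>j\<in>UNIV. (h $ j) *\<^sub>R ?D (axis j 1))"
      by (simp add: linear_sum[OF l] linear_scale[OF l])
    finally show ?thesis by (simp add: has_derivative_partial_deriv[OF D])
  qed
  then have "?D = (\<lambda>h. \<Sum>j\<in>UNIV. (h $ j) *\<^sub>R partial_deriv j f x)" by blast
  then show ?thesis using D by simp
qed

lemma partial_deriv_cong_open:
  assumes "open S" "x \<in> S" "\<And>y. y \<in> S \<Longrightarrow> f y = g y"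
  shows "partial_deriv i f x = partial_deriv i g x"
proof -
  have "continuous_on UNIV (\<lambda>t::real. x + t *\<^sub>R axis i 1)"
    by (intro continuous_intros)
  then have "open ((\<lambda>t::real. x + t *\<^sub>R axis i 1) -` S)"
    using \<open>open S\<close> by (rule open_vimage[rotated])
  then have "eventually (\<lambda>t. t \<in> ((\<lambda>t::real. x + t *\<^sub>R axis i 1) -` S)) (nhds 0)"
    using \<open>x \<in> S\<close> by (intro eventually_nhds_in_open) auto
  then have "eventually (\<lambda>t. f (x + t *\<^sub>R axis i 1) = g (x + t *\<^sub>R axis i 1)) (nhds 0)"
    by eventually_elim (auto intro: assms)
  then show ?thesis
    unfolding partial_deriv_def using assms by (intro vector_derivative_cong_eq) auto
qed

lemma differentiable_cong_open:
  assumes "open S" "x \<in> S" "\<And>y. y \<in> S \<Longrightarrow> f y = g y" "f differentiable (at x)"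
  shows "g differentiable (at x)"
proof -
  from assms(4) obtain D where "(f has_derivative D) (at x)" unfolding differentiable_def by blast
  then have "(g has_derivative D) (at x)"
    using assms by (auto intro: has_derivative_transform_within_open)
  then show ?thesis unfolding differentiable_def by blast
qed

lemma partial_derivs_cong_open:
  assumes "open S" "\<And>y. y \<in> S \<Longrightarrow> f y = g y" "x \<in> S"
  shows "partial_derivs is f x = partial_derivs is g x"
  using assms(3)
proof (induction "is" arbitrary: x)
  case (Cons i "is")
  have "partial_deriv i (partial_derivs is f) x = partial_deriv i (partial_derivs is g) x"
    using \<open>open S\<close> Cons.prems Cons.IH by (rule partial_deriv_cong_open)
  then show ?case by simp
qed (use assms in auto)

text \<open>\<open>partial_derivs\<close> applies the head of its list last. Splitting off the last
  element exposes the derivative applied to \<open>f\<close> itself, which allows inductions on the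
  order that replace \<open>f\<close> by \<open>partial_deriv i f\<close>.\<close>

lemma partial_derivs_snoc:
  fixes f :: "real^'d::finite \<Rightarrow> complex"
  shows "partial_derivs (is @ [i]) f = partial_derivs is (partial_deriv i f)"
  by (induction "is") auto

section \<open>Differentiability up to a given order on an open set\<close>

text \<open>\<open>k\<close> bounds the order of the derivatives that are required to be
  differentiable, so order \<open>0\<close> already means differentiable. Finite orders make
  induction possible; smoothness on \<open>S\<close> is the statement for all
  \<open>k\<close>.\<close>

definition diff_upto :: "nat \<Rightarrow> (real^'d::finite) set \<Rightarrow> (real^'d \<Rightarrow> complex) \<Rightarrow> bool" where
  "diff_upto k S f \<longleftrightarrow> (\<forall>is. length is \<le> k \<longrightarrow> (\<forall>x\<in>S. partial_derivs is f differentiable (at x)))"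

lemma diff_upto_0: "diff_upto 0 S f \<longleftrightarrow> (\<forall>x\<in>S. f differentiable (at x))"
  by (auto simp: diff_upto_def)

lemma diff_upto_Suc:
  fixes f :: "real^'d::finite \<Rightarrow> complex"
  shows "diff_upto (Suc k) S f \<longleftrightarrow>
     (\<forall>x\<in>S. f differentiable (at x)) \<and> (\<forall>i. diff_upto k S (partial_deriv i f))" (is "?L \<longleftrightarrow> ?R")
proof
  assume L: ?L
  have "f differentiable (at x)" if "x \<in> S" for x
    using L that unfolding diff_upto_def by (metis le0 list.size(3) partial_derivs.simps(1))
  moreover have "diff_upto k S (partial_deriv i f)" for i
    unfolding diff_upto_def
  proof (intro allI impI ballI)
    fix "is" :: "'d list" and x assume "length is \<le> k" "x \<in> S"
    then show "partial_derivs is (partial_deriv i f) differentiable (at x)"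
      using L[unfolded diff_upto_def, rule_format, of "is @ [i]" x] by (simp add: partial_derivs_snoc)
  qed
  ultimately show ?R by blast
next
  assume R: ?R
  show ?L
    unfolding diff_upto_def
  proof (intro allI impI ballI)
    fix "is" :: "'d list" and x assume a: "length is \<le> Suc k" "x \<in> S"
    show "partial_derivs is f differentiable (at x)"
    proof (cases "is" rule: rev_cases)
      case Nil then show ?thesis using R a by simp
    next
      case (snoc js j)
      then show ?thesis using R a by (auto simp: partial_derivs_snoc diff_upto_def)
    qed
  qed
qed

lemma diff_upto_le: "diff_upto k S f \<Longrightarrow> j \<le> k \<Longrightarrow> diff_upto j S f"
  by (auto simp: diff_upto_def)

lemma diff_upto_differentiable: "diff_upto k S f \<Longrightarrow> x \<in> S \<Longrightarrow> f differentiable (at x)"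
  using diff_upto_0 diff_upto_le by blast

lemma diff_upto_cong:
  fixes f g :: "real^'d::finite \<Rightarrow> complex"
  assumes "open S" "\<And>x. x \<in> S \<Longrightarrow> f x = g x" "diff_upto k S f"
  shows "diff_upto k S g"
  unfolding diff_upto_def
proof (intro allI impI ballI)
  fix "is" :: "'d list" and x assume a: "length is \<le> k" "x \<in> S"
  show "partial_derivs is g differentiable (at x)"
  proof (rule differentiable_cong_open[OF \<open>open S\<close> \<open>x \<in> S\<close>])
    show "partial_derivs is f y = partial_derivs is g y" if "y \<in> S" for y
      using assms(1,2) that by (rule partial_derivs_cong_open)
    show "partial_derivs is f differentiable (at x)"
      using a assms(3) by (auto simp: diff_upto_def)
  qed
qed

lemma partial_deriv_const: "partial_deriv i (\<lambda>x. c) = (\<lambda>x. 0)"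
  by (simp add: partial_deriv_def fun_eq_iff)

lemma partial_deriv_add:
  assumes "f differentiable (at x)" "g differentiable (at x)"
  shows "partial_deriv i (\<lambda>x. f x + g x) x = partial_deriv i f x + partial_deriv i g x"
  using has_derivative_partial_deriv[OF has_derivative_add[OF assms[THEN has_derivative_frechet]]]
    assms[THEN has_derivative_frechet, THEN has_derivative_partial_deriv] by simp

lemma partial_deriv_mult:
  assumes "f differentiable (at x)" "g differentiable (at x)"
  shows "partial_deriv i (\<lambda>x. f x * g x) x = partial_deriv i f x * g x + f x * partial_deriv i g x"
  using has_derivative_partial_deriv[OF has_derivative_mult[OF assms[THEN has_derivative_frechet]]]
    assms[THEN has_derivative_frechet, THEN has_derivative_partial_deriv] by simp

lemma partial_deriv_inverse:
  assumes "f differentiable (at x)" "f x \<noteq> 0"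
  shows "partial_deriv i (\<lambda>x. inverse (f x)) x = - (partial_deriv i f x * (inverse (f x) * inverse (f x)))"
  using has_derivative_partial_deriv[OF Deriv.has_derivative_inverse[OF assms(2) has_derivative_frechet[OF assms(1)]]]
    has_derivative_partial_deriv[OF has_derivative_frechet[OF assms(1)]] by simp

lemma partial_deriv_cnj:
  assumes "f differentiable (at x)"
  shows "partial_deriv i (\<lambda>x. cnj (f x)) x = cnj (partial_deriv i f x)"
  using has_derivative_partial_deriv[OF has_derivative_cnj[OF has_derivative_frechet[OF assms]]]
    has_derivative_partial_deriv[OF has_derivative_frechet[OF assms]] by simp

lemma partial_deriv_compose_matrix:
  fixes A :: "real^'d::finite^'d"
  assumes "f differentiable (at (A *v x))"
  shows "partial_deriv i (\<lambda>x. f (A *v x)) x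
           = (\<Sum>j\<in>UNIV. of_real (A $ j $ i) * partial_deriv j f (A *v x))"
proof -
  have "((\<lambda>x. A *v x) has_derivative (\<lambda>h. A *v h)) (at x)"
    by (intro linear_imp_has_derivative matrix_vector_mul_linear)
  then have "((\<lambda>x. f (A *v x)) has_derivative
       (\<lambda>h. \<Sum>j\<in>UNIV. ((A *v h) $ j) *\<^sub>R partial_deriv j f (A *v x))) (at x)"
    by (rule has_derivative_compose) (rule has_derivative_partial_derivs_sum[OF assms])
  from has_derivative_partial_deriv[OF this, of i] show ?thesis
    by (simp add: matrix_vector_mult_basis column_def scaleR_conv_of_real)
qed

lemma diff_upto_const: "diff_upto k S (\<lambda>x. c)"
  by (induction k arbitrary: c) (simp_all add: diff_upto_0 diff_upto_Suc partial_deriv_const)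

lemma diff_upto_add:
  assumes "open S" "diff_upto k S f" "diff_upto k S g"
  shows "diff_upto k S (\<lambda>x. f x + g x)"
  using assms(2,3)
proof (induction k arbitrary: f g)
  case (Suc k)
  have "diff_upto k S (partial_deriv i (\<lambda>x. f x + g x))" for i
    by (rule diff_upto_cong[OF \<open>open S\<close>, of "\<lambda>x. partial_deriv i f x + partial_deriv i g x"])
      (use Suc in \<open>auto simp: diff_upto_Suc partial_deriv_add\<close>)
  then show ?case using Suc.prems by (auto simp: diff_upto_Suc)
qed (auto simp: diff_upto_0)

lemma diff_upto_mult:
  assumes "open S" "diff_upto k S f" "diff_upto k S g"
  shows "diff_upto k S (\<lambda>x. f x * g x)"
  using assms(2,3)
proof (induction k arbitrary: f g)
  case (Suc k)
  have "diff_upto k S f" "diff_upto k S g" using Suc.prems by (auto elim: diff_upto_le)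
  then have D: "diff_upto k S (\<lambda>x. partial_deriv i f x * g x + f x * partial_deriv i g x)" for i
    using Suc.prems by (intro diff_upto_add[OF \<open>open S\<close>] Suc.IH) (auto simp: diff_upto_Suc)
  have "diff_upto k S (partial_deriv i (\<lambda>x. f x * g x))" for i
    by (rule diff_upto_cong[OF \<open>open S\<close> _ D])
      (use Suc.prems in \<open>auto simp: diff_upto_Suc partial_deriv_mult\<close>)
  then show ?case using Suc.prems by (auto simp: diff_upto_Suc)
qed (auto simp: diff_upto_0)

text \<open>The derivative of \<open>inverse f\<close> is, up to sign,
  \<open>partial_deriv i f\<close> times two copies of \<open>inverse f\<close>, so the induction on
  \<open>k\<close> runs with \<open>f\<close> fixed.\<close>

lemma diff_upto_inverse:
  assumes "open S" "diff_upto k S f" "\<And>x. x \<in> S \<Longrightarrow> f x \<noteq> 0"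
  shows "diff_upto k S (\<lambda>x. inverse (f x))"
  using assms(2)
proof (induction k)
  case 0
  then show ?case using assms(3) by (auto simp: diff_upto_0 intro!: differentiable_inverse)
next
  case (Suc k)
  have "diff_upto k S f" using Suc.prems by (auto elim: diff_upto_le)
  then have I: "diff_upto k S (\<lambda>x. inverse (f x))" by (rule Suc.IH)
  have "diff_upto k S (partial_deriv i (\<lambda>x. inverse (f x)))" for i
  proof (rule diff_upto_cong[OF \<open>open S\<close>])
    show "diff_upto k S (\<lambda>x. (-1) * (partial_deriv i f x * (inverse (f x) * inverse (f x))))"
      by (intro diff_upto_mult diff_upto_const I \<open>open S\<close>) (use Suc.prems in \<open>auto simp: diff_upto_Suc\<close>)
  qed (use Suc.prems assms(3) in \<open>auto simp: diff_upto_Suc partial_deriv_inverse\<close>)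
  then show ?case using Suc.prems assms(3)
    by (auto simp: diff_upto_Suc intro!: differentiable_inverse)
qed

lemma differentiable_cnj:
  "f differentiable (at x) \<Longrightarrow> (\<lambda>x. cnj (f x)) differentiable (at x)"
  using has_derivative_cnj unfolding differentiable_def by blast

lemma diff_upto_cnj:
  assumes "open S" "diff_upto k S f"
  shows "diff_upto k S (\<lambda>x. cnj (f x))"
  using assms(2)
proof (induction k arbitrary: f)
  case (Suc k)
  have "diff_upto k S (partial_deriv i (\<lambda>x. cnj (f x)))" for i
    by (rule diff_upto_cong[OF \<open>open S\<close>, of "\<lambda>x. cnj (partial_deriv i f x)"])
      (use Suc in \<open>auto simp: diff_upto_Suc partial_deriv_cnj\<close>)
  then show ?case using Suc.prems by (auto simp: diff_upto_Suc differentiable_cnj)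
qed (auto simp: diff_upto_0 differentiable_cnj)

lemma diff_upto_sum:
  assumes "open S" "\<And>j. j \<in> J \<Longrightarrow> diff_upto k S (f j)"
  shows "diff_upto k S (\<lambda>x. \<Sum>j\<in>J. f j x)"
  using assms(2)
  by (induction J rule: infinite_finite_induct) (auto intro: diff_upto_const diff_upto_add[OF \<open>open S\<close>])

lemma differentiable_compose_matrix:
  fixes A :: "real^'d::finite^'d"
  assumes "f differentiable (at (A *v x))"
  shows "(\<lambda>x. f (A *v x)) differentiable (at x)"
  using assms has_derivative_compose[OF linear_imp_has_derivative[OF matrix_vector_mul_linear]]
  unfolding differentiable_def by blast

lemma diff_upto_compose_matrix:
  fixes A :: "real^'d::finite^'d"
  assumes "open S" "diff_upto k S f"
  shows "diff_upto k ((\<lambda>x. A *v x) -` S) (\<lambda>x. f (A *v x))"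
proof -
  let ?T = "(\<lambda>x. A *v x) -` S"
  have T: "open ?T"
    using \<open>open S\<close> by (intro open_vimage) (auto intro: linear_continuous_on matrix_vector_mul_bounded_linear)
  show ?thesis
    using assms(2)
  proof (induction k arbitrary: f)
    case (Suc k)
    have "diff_upto k ?T (partial_deriv i (\<lambda>x. f (A *v x)))" for i
    proof (rule diff_upto_cong[OF T])
      show "diff_upto k ?T (\<lambda>x. \<Sum>j\<in>UNIV. of_real (A $ j $ i) * partial_deriv j f (A *v x))"
        by (intro diff_upto_sum diff_upto_mult diff_upto_const T Suc.IH)
          (use Suc.prems in \<open>auto simp: diff_upto_Suc\<close>)
    qed (use Suc.prems in \<open>auto simp: diff_upto_Suc partial_deriv_compose_matrix\<close>)
    then show ?case using Suc.prems by (auto simp: diff_upto_Suc differentiable_compose_matrix)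
  qed (auto simp: diff_upto_0 differentiable_compose_matrix)
qed


section \<open>Symmetry of second derivatives\<close>

text \<open>The mean value theorem along \<open>u\<close>, applied to the difference between
  \<open>F\<close> shifted by \<open>t v\<close> and \<open>F\<close>, turns the second difference
  into \<open>t\<close> times an increment of \<open>G\<close>. Differentiability of
  \<open>G\<close> at the point \<open>x\<close> evaluates this increment as \<open>t * D v\<close>
  with an error that is small relative to \<open>t\<close>.\<close>

lemma second_difference_estimate:
  fixes F :: "'a::real_normed_vector \<Rightarrow> real"
  assumes "open S" "x \<in> S" "0 < \<epsilon>"
    and dF: "\<And>y. y \<in> S \<Longrightarrow> ((\<lambda>t. F (y + t *\<^sub>R u)) has_real_derivative G y) (at 0)"
    and dG: "(G has_derivative D) (at x)"
  shows "\<exists>\<delta>>0. \<forall>t. 0 < t \<longrightarrow> t < \<delta> \<longrightarrow>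
    \<bar>F (x + t *\<^sub>R u + t *\<^sub>R v) - F (x + t *\<^sub>R u) - F (x + t *\<^sub>R v) + F x - t\<^sup>2 * D v\<bar> \<le> \<epsilon> * t\<^sup>2"
proof -
  \<comment> \<open>All points used lie within \<open>t * L\<close> of \<open>x\<close>; the summand
    1 keeps \<open>L\<close> positive. Two values of \<open>G\<close> are compared with
    \<open>G x\<close>, each at a cost of at most \<open>\<epsilon>' * (t * L)\<close>, whence the
    factor 2 in \<open>\<epsilon>'\<close>.\<close>
  define L where "L = norm u + norm v + 1"
  have L: "0 < L" by (simp add: L_def add_nonneg_pos)
  define \<epsilon>' where "\<epsilon>' = \<epsilon> / (2 * L)"
  have e': "0 < \<epsilon>'" using \<open>0 < \<epsilon>\<close> L by (simp add: \<epsilon>'_def)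
  obtain d1 where d1: "0 < d1" "\<And>y. norm (y - x) < d1 \<Longrightarrow> \<bar>G y - G x - D (y - x)\<bar> \<le> \<epsilon>' * norm (y - x)"
    using dG e' unfolding has_derivative_at_alt by (auto simp: )
  obtain d2 where d2: "0 < d2" "ball x d2 \<subseteq> S"
    using \<open>open S\<close> \<open>x \<in> S\<close> open_contains_ball by blast
  have lin: "linear D" using dG by (rule has_derivative_linear)
  define \<delta> where "\<delta> = min d1 d2 / L"
  have \<delta>: "0 < \<delta>" using d1(1) d2(1) L by (simp add: \<delta>_def)
  moreover have "\<bar>F (x + t *\<^sub>R u + t *\<^sub>R v) - F (x + t *\<^sub>R u) - F (x + t *\<^sub>R v) + F x - t\<^sup>2 * D v\<bar> \<le> \<epsilon> * t\<^sup>2"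
    if t: "0 < t" "t < \<delta>" for t
  proof -
    have tL: "t * L < min d1 d2" using t L by (simp add: \<delta>_def pos_less_divide_eq)
    have near: "norm (s *\<^sub>R u + r *\<^sub>R v) \<le> t * L" if "0 \<le> s" "s \<le> t" "0 \<le> r" "r \<le> t" for s r
    proof -
      have "norm (s *\<^sub>R u + r *\<^sub>R v) \<le> s * norm u + r * norm v"
        using that norm_triangle_ineq[of "s *\<^sub>R u" "r *\<^sub>R v"] by simp
      also have "\<dots> \<le> t * norm u + t * norm v" using that by (intro add_mono mult_right_mono) auto
      also have "\<dots> \<le> t * L" using t by (simp add: L_def algebra_simps)
      finally show ?thesis .
    qed
    have inS: "x + (s *\<^sub>R u + r *\<^sub>R v) \<in> S" if "0 \<le> s" "s \<le> t" "0 \<le> r" "r \<le> t" for s r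
    proof -
      have "dist x (x + (s *\<^sub>R u + r *\<^sub>R v)) < d2"
        unfolding dist_norm using near[OF that] tL
        by (metis add_diff_cancel_left' le_less_trans min_less_iff_conj norm_minus_commute)
      then show ?thesis using d2(2) by auto
    qed
    define g where "g s = F (x + s *\<^sub>R u + t *\<^sub>R v) - F (x + s *\<^sub>R u)" for s
    have shift: "((\<lambda>s. F (z + s *\<^sub>R u)) has_real_derivative G (z + s *\<^sub>R u)) (at s)"
      if "z + s *\<^sub>R u \<in> S" for z s
    proof -
      have "((\<lambda>r. F (z + s *\<^sub>R u + r *\<^sub>R u)) has_real_derivative G (z + s *\<^sub>R u)) (at (s - s))"
        using dF[OF that] by simp
      then show ?thesis
        using DERIV_shift[of "\<lambda>r. F (z + r *\<^sub>R u)" "G (z + s *\<^sub>R u)" 0 s]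
        by (simp add: algebra_simps)
    qed
    have dg: "(g has_real_derivative G (x + s *\<^sub>R u + t *\<^sub>R v) - G (x + s *\<^sub>R u)) (at s)"
      if "0 \<le> s" "s \<le> t" for s
    proof -
      have "x + t *\<^sub>R v + s *\<^sub>R u \<in> S" "x + s *\<^sub>R u \<in> S"
        using inS[of s t] inS[of s 0] that t by (auto simp: algebra_simps)
      from shift[OF this(1)] shift[OF this(2)] show ?thesis
        unfolding g_def by (auto intro!: derivative_eq_intros simp: algebra_simps)
    qed
    obtain s where s: "0 < s" "s < t"
      "g t - g 0 = (t - 0) * (G (x + s *\<^sub>R u + t *\<^sub>R v) - G (x + s *\<^sub>R u))"
      using MVT2[of 0 t g "\<lambda>s. G (x + s *\<^sub>R u + t *\<^sub>R v) - G (x + s *\<^sub>R u)"] dg t by auto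
    let ?p = "s *\<^sub>R u + t *\<^sub>R v" and ?q = "s *\<^sub>R u"
    have p: "norm ?p \<le> t * L" using near[of s t] s t by simp
    have q: "norm ?q \<le> t * L" using near[of s 0] s t by simp
    have P: "\<bar>G (x + ?p) - G x - D ?p\<bar> \<le> \<epsilon>' * norm ?p" using d1(2)[of "x + ?p"] p tL by simp
    have Q: "\<bar>G (x + ?q) - G x - D ?q\<bar> \<le> \<epsilon>' * norm ?q" using d1(2)[of "x + ?q"] q tL by simp
    have Dp: "D ?p = D ?q + t * D v" using linear_add[OF lin] linear_scale[OF lin] by simp
    have "\<bar>G (x + ?p) - G (x + ?q) - t * D v\<bar> \<le> \<epsilon>' * norm ?p + \<epsilon>' * norm ?q"
      using P Q unfolding Dp by linarith
    also have "\<dots> \<le> \<epsilon>' * (t * L) + \<epsilon>' * (t * L)"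
      using p q e' by (intro add_mono mult_left_mono) auto
    also have "\<dots> = \<epsilon> * t" using L by (simp add: \<epsilon>'_def field_simps)
    finally have *: "\<bar>G (x + ?p) - G (x + ?q) - t * D v\<bar> \<le> \<epsilon> * t" .
    have "\<bar>F (x + t *\<^sub>R u + t *\<^sub>R v) - F (x + t *\<^sub>R u) - F (x + t *\<^sub>R v) + F x - t\<^sup>2 * D v\<bar>
       = \<bar>t * (G (x + ?p) - G (x + ?q) - t * D v)\<bar>"
      using s(3) unfolding g_def by (simp add: algebra_simps power2_eq_square)
    also have "\<dots> \<le> t * (\<epsilon> * t)" using * t by (simp add: abs_mult mult_left_mono)
    finally show ?thesis by (simp add: power2_eq_square algebra_simps)
  qed
  ultimately show ?thesis by blast
qed

text \<open>The second difference is symmetric in \<open>u\<close> and \<open>v\<close>. Divided by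
  \<open>t^2\<close> it tends to \<open>G' v\<close> and equally to \<open>H' u\<close>.\<close>

lemma mixed_directional_derivatives_real:
  fixes F :: "'a::real_normed_vector \<Rightarrow> real"
  assumes "open S" "x \<in> S"
    and dFu: "\<And>y. y \<in> S \<Longrightarrow> ((\<lambda>t. F (y + t *\<^sub>R u)) has_real_derivative G y) (at 0)"
    and dFv: "\<And>y. y \<in> S \<Longrightarrow> ((\<lambda>t. F (y + t *\<^sub>R v)) has_real_derivative H y) (at 0)"
    and dG: "(G has_derivative G') (at x)" and dH: "(H has_derivative H') (at x)"
  shows "G' v = H' u"
proof (rule ccontr)
  assume ne: "G' v \<noteq> H' u"
  \<comment> \<open>The two estimates together allow a gap of \<open>2 * \<epsilon>\<close>, which a
    third of the gap contradicts.\<close>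
  define \<epsilon> where "\<epsilon> = \<bar>G' v - H' u\<bar> / 3"
  have e: "0 < \<epsilon>" using ne by (simp add: \<epsilon>_def)
  obtain d1 where d1: "0 < d1" "\<And>t. 0 < t \<Longrightarrow> t < d1 \<Longrightarrow>
    \<bar>F (x + t *\<^sub>R u + t *\<^sub>R v) - F (x + t *\<^sub>R u) - F (x + t *\<^sub>R v) + F x - t\<^sup>2 * G' v\<bar> \<le> \<epsilon> * t\<^sup>2"
    using second_difference_estimate[OF assms(1,2) e dFu dG, where v=v] by blast
  obtain d2 where d2: "0 < d2" "\<And>t. 0 < t \<Longrightarrow> t < d2 \<Longrightarrow>
    \<bar>F (x + t *\<^sub>R v + t *\<^sub>R u) - F (x + t *\<^sub>R v) - F (x + t *\<^sub>R u) + F x - t\<^sup>2 * H' u\<bar> \<le> \<epsilon> * t\<^sup>2"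
    using second_difference_estimate[OF assms(1,2) e dFv dH, where v=u] by blast
  define t where "t = min d1 d2 / 2"
  have t: "0 < t" "t < d1" "t < d2" using d1(1) d2(1) by (auto simp: t_def)
  have eq: "x + t *\<^sub>R v + t *\<^sub>R u = x + t *\<^sub>R u + t *\<^sub>R v" by (simp add: algebra_simps)
  have "\<bar>t\<^sup>2 * G' v - t\<^sup>2 * H' u\<bar> \<le> 2 * (\<epsilon> * t\<^sup>2)"
    using d1(2)[OF t(1,2)] d2(2)[OF t(1,3)] unfolding eq by linarith
  moreover have "\<bar>t\<^sup>2 * G' v - t\<^sup>2 * H' u\<bar> = t\<^sup>2 * \<bar>G' v - H' u\<bar>"
    by (simp add: abs_mult flip: right_diff_distrib)
  ultimately have "t\<^sup>2 * \<bar>G' v - H' u\<bar> \<le> t\<^sup>2 * (2 * \<epsilon>)" by (simp add: algebra_simps)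
  then have "\<bar>G' v - H' u\<bar> \<le> 2 * \<epsilon>" using t by (simp add: mult_le_cancel_left)
  then show False using e by (simp add: \<epsilon>_def)
qed

text \<open>The mean value theorem concerns real values, so real and imaginary parts are treated
  separately.\<close>

lemma partial_deriv_commute:
  fixes f :: "real^'d::finite \<Rightarrow> complex"
  assumes "open S" "x \<in> S" "diff_upto 1 S f"
  shows "partial_deriv i (partial_deriv j f) x = partial_deriv j (partial_deriv i f) x"
proof -
  have df: "f differentiable (at y)" if "y \<in> S" for y
    using assms(3) that by (rule diff_upto_differentiable)
  have dd: "partial_deriv k f differentiable (at x)" for k
    using assms by (simp add: diff_upto_Suc diff_upto_0)
  have vd: "((\<lambda>t. f (y + t *\<^sub>R axis k 1)) has_vector_derivative partial_deriv k f y) (at 0)"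
    if "y \<in> S" for y k
  proof -
    have "((\<lambda>t. y + t *\<^sub>R axis k 1) has_derivative (\<lambda>t. t *\<^sub>R axis k 1)) (at (0::real))"
      by (auto intro!: derivative_eq_intros)
    from has_derivative_compose[OF this, of f] df[OF that]
    have "(\<lambda>t. f (y + t *\<^sub>R axis k 1)) differentiable (at 0)"
      unfolding differentiable_def by auto
    then show ?thesis unfolding partial_deriv_def vector_derivative_works .
  qed
  have "Re (partial_deriv i (partial_deriv j f) x) = Re (partial_deriv j (partial_deriv i f) x)"
  proof -
    have vr: "((\<lambda>t. Re (f (y + t *\<^sub>R axis k 1))) has_real_derivative Re (partial_deriv k f y)) (at 0)"
      if "y \<in> S" for y k
      using bounded_linear.has_vector_derivative[OF bounded_linear_Re vd[OF that]]
      by (simp add: has_real_derivative_iff_has_vector_derivative)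
    have dr: "((\<lambda>x. Re (partial_deriv k f x)) has_derivative
        (\<lambda>h. Re (frechet_derivative (partial_deriv k f) (at x) h))) (at x)" for k
      using bounded_linear.has_derivative[OF bounded_linear_Re has_derivative_frechet[OF dd]] .
    show ?thesis
      using mixed_directional_derivatives_real[OF assms(1,2) vr[of _ i] vr[of _ j] dr[of i] dr[of j]]
      by (simp add: has_derivative_partial_deriv[OF has_derivative_frechet[OF dd]])
  qed
  moreover have "Im (partial_deriv i (partial_deriv j f) x) = Im (partial_deriv j (partial_deriv i f) x)"
  proof -
    have vr: "((\<lambda>t. Im (f (y + t *\<^sub>R axis k 1))) has_real_derivative Im (partial_deriv k f y)) (at 0)"
      if "y \<in> S" for y k
      using bounded_linear.has_vector_derivative[OF bounded_linear_Im vd[OF that]]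
      by (simp add: has_real_derivative_iff_has_vector_derivative)
    have dr: "((\<lambda>x. Im (partial_deriv k f x)) has_derivative
        (\<lambda>h. Im (frechet_derivative (partial_deriv k f) (at x) h))) (at x)" for k
      using bounded_linear.has_derivative[OF bounded_linear_Im has_derivative_frechet[OF dd]] .
    show ?thesis
      using mixed_directional_derivatives_real[OF assms(1,2) vr[of _ i] vr[of _ j] dr[of i] dr[of j]]
      by (simp add: has_derivative_partial_deriv[OF has_derivative_frechet[OF dd]])
  qed
  ultimately show ?thesis by (rule complex_eqI)
qed

section \<open>Jets at the origin\<close>

text \<open>One neighbourhood serves all orders. It need not be the whole space, since the quotients
  to come are smooth only where their denominators do not vanish.\<close>

definition smooth_near :: "(real^'d::finite \<Rightarrow> complex) \<Rightarrow> bool" where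
  "smooth_near f \<longleftrightarrow> (\<exists>S. open S \<and> 0 \<in> S \<and> (\<forall>k. diff_upto k S f))"

abbreviation germ_eq :: "(real^'d::finite \<Rightarrow> complex) \<Rightarrow> (real^'d \<Rightarrow> complex) \<Rightarrow> bool" where
  "germ_eq f g \<equiv> eventually (\<lambda>x. f x = g x) (nhds 0)"

lemma smooth_nearE2:
  assumes "smooth_near f" "smooth_near g"
  obtains S where "open S" "0 \<in> S" "\<And>k. diff_upto k S f" "\<And>k. diff_upto k S g"
proof -
  obtain S T where "open S" "0 \<in> S" "\<And>k. diff_upto k S f" "open T" "0 \<in> T" "\<And>k. diff_upto k T g"
    using assms unfolding smooth_near_def by blast
  then show thesis
    using that[of "S \<inter> T"] by (auto simp: diff_upto_def)
qed

lemma smooth_near_const [intro!, simp]: "smooth_near (\<lambda>x. c)"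
  using diff_upto_const open_UNIV unfolding smooth_near_def by blast

lemma smooth_near_add [intro!]:
  assumes "smooth_near f" "smooth_near g" shows "smooth_near (\<lambda>x. f x + g x)"
  using smooth_nearE2[OF assms] diff_upto_add unfolding smooth_near_def by metis

lemma smooth_near_mult [intro!]:
  assumes "smooth_near f" "smooth_near g" shows "smooth_near (\<lambda>x. f x * g x)"
  using smooth_nearE2[OF assms] diff_upto_mult unfolding smooth_near_def by metis

lemma smooth_near_cnj [intro!]:
  assumes "smooth_near f" shows "smooth_near (\<lambda>x. cnj (f x))"
  using assms diff_upto_cnj unfolding smooth_near_def by metis

lemma smooth_near_uminus [intro!]:
  assumes "smooth_near f" shows "smooth_near (\<lambda>x. - f x)"
  using smooth_near_mult[OF smooth_near_const[of "-1"] assms] by simp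

lemma smooth_near_diff [intro!]:
  assumes "smooth_near f" "smooth_near g" shows "smooth_near (\<lambda>x. f x - g x)"
  using smooth_near_add[OF assms(1) smooth_near_uminus[OF assms(2)]] by simp

lemma smooth_near_sum [intro!]:
  assumes "\<And>j. j \<in> J \<Longrightarrow> smooth_near (f j)" shows "smooth_near (\<lambda>x. \<Sum>j\<in>J. f j x)"
  using assms by (induction J rule: infinite_finite_induct) auto

lemma smooth_near_partial_deriv [intro!]:
  assumes "smooth_near f" shows "smooth_near (partial_deriv i f)"
  using assms diff_upto_Suc unfolding smooth_near_def by blast

lemma germ_differentiable:
  assumes "smooth_near f" shows "eventually (\<lambda>x. f differentiable (at x)) (nhds 0)"
  using assms diff_upto_differentiable unfolding smooth_near_def eventually_nhds by blast

lemma smooth_near_differentiable: "smooth_near f \<Longrightarrow> f differentiable (at 0)"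
  using germ_differentiable eventually_nhds_x_imp_x by blast

lemma germ_nonzero:
  assumes "smooth_near f" "f 0 \<noteq> 0" shows "eventually (\<lambda>x. f x \<noteq> 0) (nhds 0)"
proof -
  have "isCont f 0"
    using smooth_near_differentiable[OF assms(1)] by (rule differentiable_imp_continuous_within)
  then have "(f \<longlongrightarrow> f 0) (nhds 0)"
    unfolding isCont_def by (simp only: tendsto_at_iff_tendsto_nhds)
  from topological_tendstoD[OF this, of "- {0}"] show ?thesis using assms(2) by (auto simp: open_Compl)
qed

lemma smooth_near_inverse [intro]:
  assumes "smooth_near f" "f 0 \<noteq> 0" shows "smooth_near (\<lambda>x. inverse (f x))"
proof -
  obtain S where S: "open S" "0 \<in> S" "\<And>k. diff_upto k S f"
    using assms unfolding smooth_near_def by blast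
  obtain T where T: "open T" "0 \<in> T" "\<And>x. x \<in> T \<Longrightarrow> f x \<noteq> 0"
    using germ_nonzero[OF assms] unfolding eventually_nhds by blast
  have "diff_upto k (S \<inter> T) (\<lambda>x. inverse (f x))" for k
    using S T by (intro diff_upto_inverse) (auto simp: diff_upto_def)
  then show ?thesis
    using S T unfolding smooth_near_def by (intro exI[of _ "S \<inter> T"]) auto
qed

lemma smooth_near_compose_matrix:
  fixes A :: "real^'d::finite^'d"
  assumes "smooth_near f" shows "smooth_near (\<lambda>x. f (A *v x))"
proof -
  obtain S where S: "open S" "0 \<in> S" "\<And>k. diff_upto k S f"
    using assms unfolding smooth_near_def by blast
  have "open ((\<lambda>x. A *v x) -` S)"
    using \<open>open S\<close> by (intro open_vimage) (auto intro: linear_continuous_on matrix_vector_mul_bounded_linear)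
  then show ?thesis
    unfolding smooth_near_def
    using diff_upto_compose_matrix[OF S(1,3), of _ A] S(2)
    by (intro exI[of _ "(\<lambda>x. A *v x) -` S"]) auto
qed

lemma smooth_near_cong:
  assumes "smooth_near f" "germ_eq f g" shows "smooth_near g"
proof -
  obtain S where S: "open S" "0 \<in> S" "\<And>k. diff_upto k S f"
    using assms unfolding smooth_near_def by blast
  obtain T where T: "open T" "0 \<in> T" "\<And>x. x \<in> T \<Longrightarrow> f x = g x"
    using assms(2) unfolding eventually_nhds by blast
  have "diff_upto k (S \<inter> T) g" for k
    by (rule diff_upto_cong[of _ f]) (use S T in \<open>auto simp: diff_upto_def\<close>)
  then show ?thesis
    using S T unfolding smooth_near_def by (intro exI[of _ "S \<inter> T"]) auto
qed

lemma germ_eq_partial_deriv: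
  assumes "germ_eq f g" shows "germ_eq (partial_deriv i f) (partial_deriv i g)"
  using assms partial_deriv_cong_open unfolding eventually_nhds by metis

lemma germ_partial_deriv_add:
  assumes "smooth_near f" "smooth_near g"
  shows "germ_eq (partial_deriv i (\<lambda>x. f x + g x)) (\<lambda>x. partial_deriv i f x + partial_deriv i g x)"
  using germ_differentiable[OF assms(1)] germ_differentiable[OF assms(2)]
  by eventually_elim (rule partial_deriv_add)

lemma germ_partial_deriv_mult:
  assumes "smooth_near f" "smooth_near g"
  shows "germ_eq (partial_deriv i (\<lambda>x. f x * g x)) (\<lambda>x. partial_deriv i f x * g x + f x * partial_deriv i g x)"
  using germ_differentiable[OF assms(1)] germ_differentiable[OF assms(2)]
  by eventually_elim (rule partial_deriv_mult)

lemma germ_partial_deriv_cnj: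
  assumes "smooth_near f"
  shows "germ_eq (partial_deriv i (\<lambda>x. cnj (f x))) (\<lambda>x. cnj (partial_deriv i f x))"
  using germ_differentiable[OF assms(1)]
  by eventually_elim (rule partial_deriv_cnj)

lemma germ_partial_deriv_sum:
  assumes "\<And>j. j \<in> J \<Longrightarrow> smooth_near (f j)"
  shows "germ_eq (partial_deriv i (\<lambda>x. \<Sum>j\<in>J. f j x)) (\<lambda>x. \<Sum>j\<in>J. partial_deriv i (f j) x)"
  using assms
proof (induction J rule: infinite_finite_induct)
  case (insert a J)
  then have "germ_eq (partial_deriv i (\<lambda>x. f a x + (\<Sum>j\<in>J. f j x)))
      (\<lambda>x. partial_deriv i (f a) x + partial_deriv i (\<lambda>x. \<Sum>j\<in>J. f j x) x)"
    by (intro germ_partial_deriv_add) auto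
  moreover have "germ_eq (partial_deriv i (\<lambda>x. \<Sum>j\<in>J. f j x)) (\<lambda>x. \<Sum>j\<in>J. partial_deriv i (f j) x)"
    using insert by auto
  ultimately show ?case
    by eventually_elim (use insert in simp)
qed (simp_all add: partial_deriv_const)

lemma germ_partial_deriv_compose_matrix:
  fixes A :: "real^'d::finite^'d"
  assumes "smooth_near f"
  shows "germ_eq (partial_deriv i (\<lambda>x. f (A *v x)))
     (\<lambda>x. \<Sum>j\<in>UNIV. of_real (A $ j $ i) * partial_deriv j f (A *v x))"
proof -
  have "((\<lambda>x. A *v x) \<longlongrightarrow> A *v 0) (nhds 0)"
    using linear_continuous_at[OF matrix_vector_mul_bounded_linear[of A], of 0]
    unfolding isCont_def by (simp only: tendsto_at_iff_tendsto_nhds)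
  then have "eventually (\<lambda>x. f differentiable (at (A *v x))) (nhds 0)"
    using germ_differentiable[OF assms] by (auto simp: filterlim_iff)
  then show ?thesis
    by eventually_elim (rule partial_deriv_compose_matrix)
qed

lemma germ_partial_deriv_commute:
  assumes "smooth_near f"
  shows "germ_eq (partial_deriv i (partial_deriv j f)) (partial_deriv j (partial_deriv i f))"
  using assms partial_deriv_commute unfolding smooth_near_def eventually_nhds by metis

lemma eq_upto_0: "eq_upto 0 f g"
  by (simp add: eq_upto_def)

lemma eq_upto_Suc:
  fixes f g :: "real^'d::finite \<Rightarrow> complex"
  shows "eq_upto (Suc N) f g \<longleftrightarrow> f 0 = g 0 \<and> (\<forall>i. eq_upto N (partial_deriv i f) (partial_deriv i g))"
    (is "?L \<longleftrightarrow> ?R")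
proof
  assume L: ?L
  have "f 0 = g 0" using L[unfolded eq_upto_def, rule_format, of "[]"] by simp
  moreover have "partial_derivs is (partial_deriv i f) 0 = partial_derivs is (partial_deriv i g) 0"
    if "length is < N" for "is" and i :: 'd
    using L[unfolded eq_upto_def, rule_format, of "is @ [i]"] that by (simp add: partial_derivs_snoc)
  ultimately show ?R by (auto simp: eq_upto_def)
next
  assume R: ?R
  show ?L
    unfolding eq_upto_def
  proof (intro allI impI)
    fix "is" :: "'d list"
    assume a: "length is < Suc N"
    show "partial_derivs is f 0 = partial_derivs is g 0"
    proof (cases "is" rule: rev_cases)
      case Nil then show ?thesis using R by simp
    next
      case (snoc js j)
      then show ?thesis using R a by (auto simp: partial_derivs_snoc eq_upto_def)
    qed
  qed
qed

lemma eq_upto_germ: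
  assumes "germ_eq f g" shows "eq_upto N f g"
  using assms partial_derivs_cong_open unfolding eq_upto_def eventually_nhds by metis

text \<open>Smoothness is part of the relation because the Leibniz and chain rules hold only where
  derivatives exist. With it built in, jet equalities can be added, multiplied and chained without
  further side conditions.\<close>

definition jeq :: "nat \<Rightarrow> (real^'d::finite \<Rightarrow> complex) \<Rightarrow> (real^'d \<Rightarrow> complex) \<Rightarrow> bool" where
  "jeq N f g \<longleftrightarrow> smooth_near f \<and> smooth_near g \<and> eq_upto N f g"

lemma jeq_Suc:
  "jeq (Suc N) f g \<longleftrightarrow>
     smooth_near f \<and> smooth_near g \<and> f 0 = g 0 \<and> (\<forall>i. jeq N (partial_deriv i f) (partial_deriv i g))"
  by (auto simp: jeq_def eq_upto_Suc)

lemma jeq_0: "jeq 0 f g \<longleftrightarrow> smooth_near f \<and> smooth_near g"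
  by (auto simp: jeq_def eq_upto_0)

lemma jeq_refl: "smooth_near f \<Longrightarrow> jeq N f f"
  by (auto simp: jeq_def eq_upto_def)

lemma jeq_const [simp, intro]: "jeq N (\<lambda>x. c) (\<lambda>x. c)"
  by (simp add: jeq_refl)

lemma jeq_sym: "jeq N f g \<Longrightarrow> jeq N g f"
  by (auto simp: jeq_def eq_upto_def)

lemma jeq_trans [trans]: "jeq N f g \<Longrightarrow> jeq N g h \<Longrightarrow> jeq N f h"
  by (auto simp: jeq_def eq_upto_def)

lemma jeq_le: "jeq N f g \<Longrightarrow> K \<le> N \<Longrightarrow> jeq K f g"
  by (auto simp: jeq_def eq_upto_def)

lemma jeq_at_0: "jeq N f g \<Longrightarrow> 0 < N \<Longrightarrow> f 0 = g 0"
  by (cases N) (auto simp: jeq_Suc)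

lemma jeq_smooth: "jeq N f g \<Longrightarrow> smooth_near f" "jeq N f g \<Longrightarrow> smooth_near g"
  by (auto simp: jeq_def)

lemma jeq_germ: "smooth_near f \<Longrightarrow> germ_eq f g \<Longrightarrow> jeq N f g"
  by (auto simp: jeq_def eq_upto_germ intro: smooth_near_cong)

text \<open>Differentiation rules are available only on a neighbourhood of the origin. This rule
  exchanges a derivative for its formula on both sides of a jet equality.\<close>

lemma jeq_germ_cong:
  assumes "jeq N f' g'" "germ_eq f f'" "germ_eq g g'" shows "jeq N f g"
proof -
  have "germ_eq f' f" "germ_eq g' g"
    using assms(2,3) by (auto elim: eventually_mono)
  then have "jeq N f' f" "jeq N g' g"
    using assms(1) by (auto intro: jeq_germ dest: jeq_smooth)
  then show ?thesis using assms(1) jeq_sym jeq_trans by metis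
qed

lemma jeq_add:
  assumes "jeq N f f'" "jeq N g g'" shows "jeq N (\<lambda>x. f x + g x) (\<lambda>x. f' x + g' x)"
  using assms
proof (induction N arbitrary: f f' g g')
  case (Suc N)
  then have "jeq N (\<lambda>x. partial_deriv i f x + partial_deriv i g x)
      (\<lambda>x. partial_deriv i f' x + partial_deriv i g' x)" for i
    by (auto simp: jeq_Suc)
  then have "jeq N (partial_deriv i (\<lambda>x. f x + g x)) (partial_deriv i (\<lambda>x. f' x + g' x))" for i
    by (rule jeq_germ_cong) (use Suc.prems in \<open>auto simp: jeq_Suc intro: germ_partial_deriv_add\<close>)
  then show ?case using Suc.prems by (auto simp: jeq_Suc)
qed (auto simp: jeq_0)

lemma jeq_mult:
  assumes "jeq N f f'" "jeq N g g'" shows "jeq N (\<lambda>x. f x * g x) (\<lambda>x. f' x * g' x)"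
  using assms
proof (induction N arbitrary: f f' g g')
  case (Suc N)
  have "jeq N f f'" "jeq N g g'" using Suc.prems by (auto elim: jeq_le)
  then have "jeq N (\<lambda>x. partial_deriv i f x * g x + f x * partial_deriv i g x)
      (\<lambda>x. partial_deriv i f' x * g' x + f' x * partial_deriv i g' x)" for i
    using Suc by (auto simp: jeq_Suc intro!: jeq_add)
  then have "jeq N (partial_deriv i (\<lambda>x. f x * g x)) (partial_deriv i (\<lambda>x. f' x * g' x))" for i
    by (rule jeq_germ_cong) (use Suc.prems in \<open>auto simp: jeq_Suc intro: germ_partial_deriv_mult\<close>)
  then show ?case using Suc.prems by (auto simp: jeq_Suc)
qed (auto simp: jeq_0)

lemma jeq_cnj:
  assumes "jeq N f f'" shows "jeq N (\<lambda>x. cnj (f x)) (\<lambda>x. cnj (f' x))"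
  using assms
proof (induction N arbitrary: f f')
  case (Suc N)
  then have "jeq N (\<lambda>x. cnj (partial_deriv i f x)) (\<lambda>x. cnj (partial_deriv i f' x))" for i
    by (auto simp: jeq_Suc)
  then have "jeq N (partial_deriv i (\<lambda>x. cnj (f x))) (partial_deriv i (\<lambda>x. cnj (f' x)))" for i
    by (rule jeq_germ_cong) (use Suc.prems in \<open>auto simp: jeq_Suc intro: germ_partial_deriv_cnj\<close>)
  then show ?case using Suc.prems by (auto simp: jeq_Suc)
qed (auto simp: jeq_0)

lemma jeq_sum:
  assumes "\<And>j. j \<in> J \<Longrightarrow> jeq N (f j) (g j)"
  shows "jeq N (\<lambda>x. \<Sum>j\<in>J. f j x) (\<lambda>x. \<Sum>j\<in>J. g j x)"
  using assms by (induction J rule: infinite_finite_induct) (auto intro: jeq_add)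

lemma jeq_cmult: "jeq N f g \<Longrightarrow> jeq N (\<lambda>x. c * f x) (\<lambda>x. c * g x)"
  by (rule jeq_mult) auto

lemma jeq_uminus: "jeq N f g \<Longrightarrow> jeq N (\<lambda>x. - f x) (\<lambda>x. - g x)"
  using jeq_cmult[of N f g "-1"] by simp

lemma jeq_diff:
  assumes "jeq N f f'" "jeq N g g'" shows "jeq N (\<lambda>x. f x - g x) (\<lambda>x. f' x - g' x)"
  using jeq_add[OF assms(1) jeq_uminus[OF assms(2)]] by simp

lemma jeq_diff_0: "jeq N f g \<Longrightarrow> jeq N (\<lambda>x. f x - g x) (\<lambda>x. 0)"
  using jeq_diff[of N f g g g] by (simp add: jeq_refl jeq_smooth)

lemma jeq_compose_matrix:
  fixes A :: "real^'d::finite^'d"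
  assumes "jeq N f f'" shows "jeq N (\<lambda>x. f (A *v x)) (\<lambda>x. f' (A *v x))"
  using assms
proof (induction N arbitrary: f f')
  case (Suc N)
  then have "jeq N (\<lambda>x. \<Sum>j\<in>UNIV. of_real (A $ j $ i) * partial_deriv j f (A *v x))
      (\<lambda>x. \<Sum>j\<in>UNIV. of_real (A $ j $ i) * partial_deriv j f' (A *v x))" for i
    by (auto simp: jeq_Suc intro!: jeq_sum jeq_cmult)
  then have "jeq N (partial_deriv i (\<lambda>x. f (A *v x))) (partial_deriv i (\<lambda>x. f' (A *v x)))" for i
    by (rule jeq_germ_cong)
      (use Suc.prems in \<open>auto simp: jeq_Suc intro: germ_partial_deriv_compose_matrix\<close>)
  then show ?case using Suc.prems by (auto simp: jeq_Suc intro: smooth_near_compose_matrix)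
qed (auto simp: jeq_0 intro: smooth_near_compose_matrix)

text \<open>\<open>f\<close> has no zero near the origin, so the product is 1 on a neighbourhood and
  the order \<open>N\<close> is arbitrary.\<close>

lemma jeq_inverse_mult:
  assumes "smooth_near f" "f 0 \<noteq> 0"
  shows "jeq N (\<lambda>x. inverse (f x) * f x) (\<lambda>x. 1)"
proof (rule jeq_germ)
  show "germ_eq (\<lambda>x. inverse (f x) * f x) (\<lambda>x. 1)"
    using germ_nonzero[OF assms] by eventually_elim simp
qed (use assms in auto)

text \<open>A factor that vanishes at the origin gains one order. In the Leibniz rule, the summand
  with the derivative of \<open>s\<close> uses the agreement of \<open>f\<close> and
  \<open>g\<close> as it stands; in the other summand, the order lost by differentiating
  \<open>f\<close> and \<open>g\<close> is regained by induction.\<close>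

lemma jeq_mult_Suc:
  assumes "smooth_near s" "s 0 = 0" "jeq N f g"
  shows "jeq (Suc N) (\<lambda>x. s x * f x) (\<lambda>x. s x * g x)"
  using assms(3)
proof (induction N arbitrary: f g)
  case 0
  then show ?case using assms by (auto simp: jeq_Suc jeq_0)
next
  case (Suc N)
  have "jeq (Suc N) (\<lambda>x. partial_deriv i s x * f x + s x * partial_deriv i f x)
      (\<lambda>x. partial_deriv i s x * g x + s x * partial_deriv i g x)" for i
    by (intro jeq_add jeq_mult Suc.IH Suc.prems)
      (use Suc.prems assms(1) in \<open>auto simp: jeq_Suc[of N f] intro: jeq_refl\<close>)
  then have "jeq (Suc N) (partial_deriv i (\<lambda>x. s x * f x)) (partial_deriv i (\<lambda>x. s x * g x))" for i
    by (rule jeq_germ_cong)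
      (use Suc.prems assms(1) in \<open>auto simp: jeq_Suc intro: germ_partial_deriv_mult\<close>)
  then show ?case using assms jeq_smooth[OF Suc.prems] by (subst jeq_Suc) auto
qed


section \<open>Trigonometric polynomials\<close>

definition character :: "int^'d::finite \<Rightarrow> real^'d \<Rightarrow> complex" where
  "character k \<xi> = exp (- \<i> * complex_of_real (real_vec k \<bullet> \<xi>))"

definition trig_poly :: "(real^'d::finite \<Rightarrow> complex) \<Rightarrow> bool" where
  "trig_poly p \<longleftrightarrow> (\<exists>u. finitely_supported u \<and> p = filter_fourier u)"

lemma filter_fourier_superset:
  assumes "finite K" "{k. u k \<noteq> 0} \<subseteq> K"
  shows "filter_fourier u \<xi> = (\<Sum>k\<in>K. u k * character k \<xi>)"
  unfolding filter_fourier_def character_def using assms by (intro sum.mono_neutral_left) auto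

lemma trig_poly_filter_fourier [intro]: "finitely_supported u \<Longrightarrow> trig_poly (filter_fourier u)"
  by (auto simp: trig_poly_def)

lemma trig_poly_add [intro!]:
  assumes "trig_poly p" "trig_poly q" shows "trig_poly (\<lambda>\<xi>. p \<xi> + q \<xi>)"
proof -
  obtain u v where u: "finitely_supported u" "p = filter_fourier u"
    and v: "finitely_supported v" "q = filter_fourier v"
    using assms by (auto simp: trig_poly_def)
  let ?K = "{k. u k \<noteq> 0} \<union> {k. v k \<noteq> 0}"
  have K: "finite ?K" using u v by (simp add: finitely_supported_def)
  have sub: "{k. u k + v k \<noteq> 0} \<subseteq> ?K" by auto
  have fs: "finitely_supported (\<lambda>k. u k + v k)"
    unfolding finitely_supported_def using sub K by (rule finite_subset)
  have "p \<xi> + q \<xi> = filter_fourier (\<lambda>k. u k + v k) \<xi>" for \<xi>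
    using filter_fourier_superset[OF K sub] filter_fourier_superset[OF K, of u]
      filter_fourier_superset[OF K, of v]
    by (simp add: u v sum.distrib[symmetric] distrib_right)
  then have "(\<lambda>\<xi>. p \<xi> + q \<xi>) = filter_fourier (\<lambda>k. u k + v k)" by blast
  then show ?thesis using fs by (auto simp: trig_poly_def)
qed

lemma trig_poly_character [intro!]: "trig_poly (\<lambda>\<xi>. c * character k \<xi>)"
proof -
  let ?u = "\<lambda>l. if l = k then c else 0"
  have "{l. ?u l \<noteq> 0} \<subseteq> {k}" by auto
  then have "finitely_supported ?u" "\<And>\<xi>. filter_fourier ?u \<xi> = c * character k \<xi>"
    using filter_fourier_superset[of "{k}" ?u] by (auto simp: finitely_supported_def intro: finite_subset)
  then show ?thesis unfolding trig_poly_def by (intro exI[of _ ?u]) auto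
qed

lemma character_0 [simp]: "character 0 \<xi> = 1"
  by (simp add: character_def real_vec_def inner_vec_def)

lemma trig_poly_const [intro, simp]: "trig_poly (\<lambda>\<xi>. c)"
  using trig_poly_character[of c 0] by simp

lemma trig_poly_sum [intro!]:
  assumes "\<And>j. j \<in> J \<Longrightarrow> trig_poly (p j)" shows "trig_poly (\<lambda>\<xi>. \<Sum>j\<in>J. p j \<xi>)"
  using assms by (induction J rule: infinite_finite_induct) auto

lemma trig_polyE:
  assumes "trig_poly p"
  obtains K c where "finite K" "p = (\<lambda>\<xi>. \<Sum>k\<in>K. c k * character k \<xi>)"
  using assms filter_fourier_superset unfolding trig_poly_def finitely_supported_def by blast

lemma character_add: "character (k + l) \<xi> = character k \<xi> * character l \<xi>"
proof -
  have "real_vec (k + l) = real_vec k + real_vec l" by (simp add: real_vec_def vec_eq_iff)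
  then show ?thesis
    by (simp add: character_def inner_add_left exp_add[symmetric] algebra_simps)
qed

lemma trig_poly_mult [intro!]:
  assumes "trig_poly p" "trig_poly q" shows "trig_poly (\<lambda>\<xi>. p \<xi> * q \<xi>)"
proof -
  obtain K c L b where p: "p = (\<lambda>\<xi>. \<Sum>k\<in>K. c k * character k \<xi>)"
    and q: "q = (\<lambda>\<xi>. \<Sum>k\<in>L. b k * character k \<xi>)"
    using assms by (elim trig_polyE)
  have "(\<lambda>\<xi>. p \<xi> * q \<xi>) = (\<lambda>\<xi>. \<Sum>k\<in>K. \<Sum>l\<in>L. (c k * b l) * character (k + l) \<xi>)"
    unfolding p q sum_product by (simp add: character_add mult_ac)
  then show ?thesis by (simp only:) (intro trig_poly_sum trig_poly_character)
qed

lemma trig_poly_uminus [intro!]: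
  assumes "trig_poly p" shows "trig_poly (\<lambda>\<xi>. - p \<xi>)"
  using trig_poly_mult[OF trig_poly_const[of "-1"] assms] by simp

lemma trig_poly_diff [intro!]:
  assumes "trig_poly p" "trig_poly q" shows "trig_poly (\<lambda>\<xi>. p \<xi> - q \<xi>)"
  using trig_poly_add[OF assms(1) trig_poly_uminus[OF assms(2)]] by simp

lemma trig_poly_translate:
  assumes "trig_poly p" shows "trig_poly (\<lambda>\<xi>. p (\<xi> + z))"
proof -
  obtain K c where p: "p = (\<lambda>\<xi>. \<Sum>k\<in>K. c k * character k \<xi>)"
    using assms by (elim trig_polyE)
  have "character k (\<xi> + z) = character k z * character k \<xi>" for k \<xi>
    by (simp add: character_def inner_add_right exp_add[symmetric] algebra_simps)
  then have "(\<lambda>\<xi>. p (\<xi> + z)) = (\<lambda>\<xi>. \<Sum>k\<in>K. (c k * character k z) * character k \<xi>)"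
    by (simp add: p mult.assoc)
  then show ?thesis by (simp only:) (intro trig_poly_sum trig_poly_character)
qed

text \<open>The transpose passes to the other side of the inner product, and \<open>M *v k\<close>
  is again an integer frequency. This is why composition with \<open>transpose_real M\<close>
  preserves trigonometric polynomials.\<close>

lemma character_transpose:
  fixes M :: "int^'d::finite^'d"
  shows "character k (transpose_real M *v \<xi>) = character (M *v k) \<xi>"
proof -
  have "real_vec k \<bullet> (transpose_real M *v \<xi>) = real_vec (M *v k) \<bullet> \<xi>"
  proof -
    have "real_vec (M *v k) = map_matrix real_of_int M *v real_vec k"
      by (simp add: real_vec_def matrix_vector_mult_def vec_eq_iff map_matrix_def)
    then show ?thesis
      by (simp add: transpose_real_def dot_lmul_matrix[symmetric] vector_transpose_matrix
          flip: transpose_matrix_vector)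
  qed
  then show ?thesis by (simp add: character_def)
qed

lemma trig_poly_compose_transpose_real:
  fixes M :: "int^'d::finite^'d"
  assumes "trig_poly p" shows "trig_poly (\<lambda>\<xi>. p (transpose_real M *v \<xi>))"
proof -
  obtain K c where p: "p = (\<lambda>\<xi>. \<Sum>k\<in>K. c k * character k \<xi>)"
    using assms by (elim trig_polyE)
  have "(\<lambda>\<xi>. p (transpose_real M *v \<xi>)) = (\<lambda>\<xi>. \<Sum>k\<in>K. c k * character (M *v k) \<xi>)"
    by (simp add: p character_transpose)
  then show ?thesis by (simp only:) (intro trig_poly_sum trig_poly_character)
qed

lemma character_periodic: "character k (\<xi> + (2 * pi) *\<^sub>R real_vec l) = character k \<xi>"
proof -
  define n where "n = - (\<Sum>i\<in>UNIV. k $ i * l $ i)"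
  have "real_vec k \<bullet> real_vec l = - of_int n"
    by (simp add: real_vec_def inner_vec_def n_def)
  then have "character k (\<xi> + (2 * pi) *\<^sub>R real_vec l)
      = character k \<xi> * exp (2 * of_int n * of_real pi * \<i>)"
    by (simp add: character_def inner_add_right exp_add[symmetric] distrib_left)
      (simp add: algebra_simps)
  also have "exp (2 * of_int n * of_real pi * \<i>) = 1"
    using exp_integer_2pi[of "of_int n"] by simp
  finally show ?thesis by simp
qed

lemma trig_poly_periodic: "trig_poly p \<Longrightarrow> p (\<xi> + (2 * pi) *\<^sub>R real_vec l) = p \<xi>"
  by (elim trig_polyE) (simp add: character_periodic)

lemma has_derivative_character:
  "(character k has_derivative (\<lambda>h. - \<i> * of_real (real_vec k \<bullet> h) * character k \<xi>)) (at \<xi>)"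
proof -
  have "((\<lambda>\<xi>. - \<i> * complex_of_real (real_vec k \<bullet> \<xi>)) has_derivative
      (\<lambda>h. - \<i> * of_real (real_vec k \<bullet> h))) (at \<xi>)"
    by (auto intro!: derivative_eq_intros)
  from has_derivative_compose[OF this, of exp "\<lambda>h. h * exp (- \<i> * complex_of_real (real_vec k \<bullet> \<xi>))"]
  show ?thesis
    by (auto simp: character_def[abs_def] has_field_derivative_def mult_commute_abs DERIV_exp
        simp flip: has_field_derivative_def)
qed

lemma partial_deriv_character: "partial_deriv i (character k) = (\<lambda>\<xi>. - \<i> * of_int (k $ i) * character k \<xi>)"
  by (simp add: fun_eq_iff has_derivative_partial_deriv[OF has_derivative_character] inner_axis real_vec_def)

lemma character_differentiable: "character k differentiable (at \<xi>)"
  using has_derivative_character differentiable_def by blast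

lemma diff_upto_character: "diff_upto n UNIV (character k)"
proof (induction n)
  case (Suc n)
  then show ?case
    unfolding diff_upto_Suc partial_deriv_character
    by (intro conjI allI ballI character_differentiable diff_upto_mult[OF open_UNIV] diff_upto_const)
qed (simp add: diff_upto_0 character_differentiable)

lemma smooth_near_character [intro!]: "smooth_near (character k)"
  using diff_upto_character open_UNIV unfolding smooth_near_def by blast

lemma smooth_near_trig_poly [intro]: "trig_poly p \<Longrightarrow> smooth_near p"
  by (elim trig_polyE) auto

text \<open>A periodic substitute for the coordinate function \<open>\<xi>$j\<close>, equal to it up to terms of order two.\<close>

definition trig_coord :: "'d \<Rightarrow> real^'d::finite \<Rightarrow> complex" where
  "trig_coord j \<xi> = \<i> * character (axis j 1) \<xi> - \<i>"

lemma trig_coord_0: "trig_coord j 0 = 0"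
  by (simp add: trig_coord_def character_def)

lemma trig_poly_trig_coord [intro!]: "trig_poly (trig_coord j)"
  unfolding trig_coord_def[abs_def] by (intro trig_poly_diff trig_poly_character trig_poly_const)

lemma smooth_near_trig_coord [intro!]: "smooth_near (trig_coord j)" by auto

text \<open>The derivative is the character itself. Written through \<open>trig_coord\<close>, it
  splits into the derivative 1 of a true coordinate and a correction that vanishes at the origin, as
  needed for Euler's identity.\<close>

lemma partial_deriv_trig_coord:
  "partial_deriv i (trig_coord j) \<xi> = (if i = j then 1 - \<i> * trig_coord j \<xi> else 0)"
proof -
  have "(trig_coord j has_derivative (\<lambda>h. \<i> * (- \<i> * of_real (real_vec (axis j 1) \<bullet> h) * character (axis j 1) \<xi>))) (at \<xi>)"
    unfolding trig_coord_def[abs_def]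
    by (rule has_derivative_eq_rhs, rule has_derivative_diff[OF has_derivative_mult_right[OF has_derivative_character] has_derivative_const]) auto
  moreover have "real_vec (axis j 1) = axis j 1" by (simp add: real_vec_def axis_def vec_eq_iff)
  ultimately show ?thesis
    by (auto simp: has_derivative_partial_deriv inner_axis_axis trig_coord_def algebra_simps)
qed

text \<open>Euler's identity for homogeneous functions, on the level of leading jets.\<close>

lemma jeq_euler:
  assumes "smooth_near h" "jeq K h (\<lambda>_. 0)"
  shows "jeq (Suc K) (\<lambda>\<xi>. \<Sum>j\<in>UNIV. trig_coord j \<xi> * partial_deriv j h \<xi>) (\<lambda>\<xi>. of_nat K * h \<xi>)"
  using assms
proof (induction K arbitrary: h)
  case 0
  then show ?case by (auto simp: jeq_Suc jeq_0 trig_coord_0)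
next
  case (Suc K)
  let ?s = "trig_coord"
  let ?E = "\<lambda>\<xi>. \<Sum>j\<in>UNIV. ?s j \<xi> * partial_deriv j h \<xi>"
  have "jeq (Suc K) (partial_deriv i ?E) (partial_deriv i (\<lambda>\<xi>. of_nat (Suc K) * h \<xi>))" for i
  proof -
    let ?g = "partial_deriv i h"
    have g0: "jeq K ?g (\<lambda>_. 0)" using Suc.prems(2) by (simp add: jeq_Suc partial_deriv_const)
    have "germ_eq (partial_deriv i ?E) (\<lambda>\<xi>. \<Sum>j\<in>UNIV. partial_deriv i (\<lambda>\<xi>. ?s j \<xi> * partial_deriv j h \<xi>) \<xi>)"
      by (rule germ_partial_deriv_sum) (use Suc.prems(1) in auto)
    moreover have "eventually (\<lambda>\<xi>. \<forall>j\<in>UNIV. partial_deriv i (\<lambda>\<xi>. ?s j \<xi> * partial_deriv j h \<xi>) \<xi>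
        = partial_deriv i (?s j) \<xi> * partial_deriv j h \<xi> + ?s j \<xi> * partial_deriv i (partial_deriv j h) \<xi>) (nhds 0)"
      by (intro eventually_ball_finite ballI germ_partial_deriv_mult) (use Suc.prems(1) in auto)
    \<comment> \<open>Commuting the derivatives turns the second summands of the Leibniz rule into
      the Euler sum of \<open>?g\<close>, to which the induction hypothesis applies.\<close>
    moreover have "eventually (\<lambda>\<xi>. \<forall>j\<in>UNIV. partial_deriv i (partial_deriv j h) \<xi> = partial_deriv j ?g \<xi>) (nhds 0)"
      by (intro eventually_ball_finite ballI germ_partial_deriv_commute Suc.prems) auto
    ultimately have germ: "germ_eq (partial_deriv i ?E)
        (\<lambda>\<xi>. (?g \<xi> - \<i> * (?s i \<xi> * ?g \<xi>)) + (\<Sum>j\<in>UNIV. ?s j \<xi> * partial_deriv j ?g \<xi>))"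
    proof eventually_elim
      case (elim \<xi>)
      have "partial_deriv i ?E \<xi> = (\<Sum>j\<in>UNIV. (if j = i then (1 - \<i> * ?s i \<xi>) * ?g \<xi> else 0)
          + ?s j \<xi> * partial_deriv j ?g \<xi>)"
        unfolding elim(1) using elim(2,3)
        by (intro sum.cong) (auto simp: partial_deriv_trig_coord)
      also have "\<dots> = (1 - \<i> * ?s i \<xi>) * ?g \<xi> + (\<Sum>j\<in>UNIV. ?s j \<xi> * partial_deriv j ?g \<xi>)"
        by (simp add: sum.distrib)
      finally show ?case by (simp add: algebra_simps)
    qed
    \<comment> \<open>Since \<open>?g\<close> vanishes to order \<open>K\<close>, the periodic
      correction \<open>?s i * ?g\<close> vanishes to order \<open>Suc K\<close>. What remains is
      \<open>?g\<close> plus \<open>K\<close> times \<open>?g\<close>, the derivative of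
      \<open>Suc K\<close> times \<open>h\<close>.\<close>
    have "jeq (Suc K) (\<lambda>\<xi>. (?g \<xi> - \<i> * (?s i \<xi> * ?g \<xi>)) + (\<Sum>j\<in>UNIV. ?s j \<xi> * partial_deriv j ?g \<xi>))
       (\<lambda>\<xi>. (?g \<xi> - \<i> * (?s i \<xi> * 0)) + of_nat K * ?g \<xi>)"
      by (intro jeq_add jeq_diff jeq_cmult jeq_mult_Suc Suc.IH jeq_refl g0 trig_coord_0) (use Suc.prems(1) in auto)
    then have *: "jeq (Suc K) (partial_deriv i ?E) (\<lambda>\<xi>. (?g \<xi> - \<i> * (?s i \<xi> * 0)) + of_nat K * ?g \<xi>)"
      by (rule jeq_germ_cong) (use germ in auto)
    have "germ_eq (partial_deriv i (\<lambda>\<xi>. of_nat (Suc K) * h \<xi>))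
       (\<lambda>\<xi>. partial_deriv i (\<lambda>_. of_nat (Suc K)) \<xi> * h \<xi> + of_nat (Suc K) * ?g \<xi>)"
      using Suc.prems(1) by (intro germ_partial_deriv_mult) auto
    then have "germ_eq (partial_deriv i (\<lambda>\<xi>. of_nat (Suc K) * h \<xi>))
       (\<lambda>\<xi>. (?g \<xi> - \<i> * (?s i \<xi> * 0)) + of_nat K * ?g \<xi>)"
      by eventually_elim (simp add: partial_deriv_const algebra_simps)
    then show ?thesis using * by (auto intro: jeq_germ_cong)
  qed
  moreover have "?E 0 = of_nat (Suc K) * h 0"
    using jeq_at_0[OF Suc.prems(2)] by (simp add: trig_coord_0)
  ultimately show ?case
    using Suc.prems(1) by (subst jeq_Suc) auto
qed

text \<open>Euler's identity recovers the leading jet of \<open>g\<close> from its first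
  derivatives. These are matched by induction, and the factors \<open>trig_coord j\<close> raise the
  order of the match by one.\<close>

lemma leading_jet_trig_poly:
  assumes "jeq N g (\<lambda>_. 0)"
  shows "\<exists>q. trig_poly q \<and> jeq (Suc N) q g"
  using assms
proof (induction N arbitrary: g)
  case 0
  then show ?case
    by (intro exI[of _ "\<lambda>_. g 0"]) (auto simp: jeq_0 jeq_Suc)
next
  case (Suc N)
  have sm: "smooth_near g" using Suc.prems by (rule jeq_smooth)
  have "\<exists>q. trig_poly q \<and> jeq (Suc N) q (partial_deriv j g)" for j
    by (rule Suc.IH) (use Suc.prems in \<open>simp add: jeq_Suc partial_deriv_const\<close>)
  then obtain q where q: "\<And>j. trig_poly (q j)" "\<And>j. jeq (Suc N) (q j) (partial_deriv j g)"
    by metis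
  \<comment> \<open>Derivatives of \<open>g\<close> of order at most \<open>N\<close> vanish, so the
    leading jet is homogeneous of degree \<open>Suc N\<close>.\<close>
  let ?c = "inverse (of_nat (Suc N))"
  let ?p = "\<lambda>\<xi>. ?c * (\<Sum>j\<in>UNIV. trig_coord j \<xi> * q j \<xi>)"
  have "jeq (Suc (Suc N)) ?p (\<lambda>\<xi>. ?c * (\<Sum>j\<in>UNIV. trig_coord j \<xi> * partial_deriv j g \<xi>))"
    by (intro jeq_cmult jeq_sum jeq_mult_Suc q trig_coord_0) auto
  also have "jeq (Suc (Suc N)) \<dots> (\<lambda>\<xi>. ?c * (of_nat (Suc N) * g \<xi>))"
    by (intro jeq_cmult jeq_euler sm Suc.prems)
  also have "(\<lambda>\<xi>. ?c * (of_nat (Suc N) * g \<xi>)) = g"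
    by (simp add: mult.assoc[symmetric] del: of_nat_Suc)
  finally have "jeq (Suc (Suc N)) ?p g" .
  moreover have "trig_poly ?p"
    by (intro trig_poly_mult trig_poly_sum q trig_poly_const trig_poly_trig_coord)
  ultimately show ?case by blast
qed

text \<open>The approximation gains one order at a time: the error \<open>f - p\<close> has a
  vanishing jet of order \<open>N\<close>, so its leading part can be added to
  \<open>p\<close>.\<close>

lemma jet_trig_poly:
  assumes "smooth_near f"
  obtains p where "trig_poly p" "jeq N p f"
proof -
  have "\<exists>p. trig_poly p \<and> jeq N p f"
  proof (induction N)
    case 0
    show ?case using assms by (intro exI[of _ "\<lambda>_. 0"]) (auto simp: jeq_0)
  next
    case (Suc N)
    then obtain p where p: "trig_poly p" "jeq N p f" by blast
    have "jeq N (\<lambda>\<xi>. f \<xi> - p \<xi>) (\<lambda>_. 0)" by (rule jeq_diff_0[OF jeq_sym[OF p(2)]])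
    then obtain q where q: "trig_poly q" "jeq (Suc N) q (\<lambda>\<xi>. f \<xi> - p \<xi>)"
      using leading_jet_trig_poly by blast
    have "jeq (Suc N) (\<lambda>\<xi>. q \<xi> + p \<xi>) (\<lambda>\<xi>. (f \<xi> - p \<xi>) + p \<xi>)"
      using p q by (intro jeq_add jeq_refl) auto
    then show ?case using p q by (intro exI[of _ "\<lambda>\<xi>. q \<xi> + p \<xi>"]) auto
  qed
  then show thesis using that by blast
qed


section \<open>Fourier transforms of compactly supported distributions are smooth\<close>

lemma smooth_fun_iff: "smooth_fun f \<longleftrightarrow> (\<forall>k. diff_upto k UNIV f)"
  by (auto simp: smooth_fun_def diff_upto_def differentiable_on_def)

lemma smooth_fun_const: "smooth_fun (\<lambda>x. c)"
  by (simp add: smooth_fun_iff diff_upto_const)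

lemma smooth_fun_add: "smooth_fun f \<Longrightarrow> smooth_fun g \<Longrightarrow> smooth_fun (\<lambda>x. f x + g x)"
  by (simp add: smooth_fun_iff diff_upto_add)

lemma smooth_fun_mult: "smooth_fun f \<Longrightarrow> smooth_fun g \<Longrightarrow> smooth_fun (\<lambda>x. f x * g x)"
  by (simp add: smooth_fun_iff diff_upto_mult)

lemma smooth_fun_sum: "(\<And>j. j \<in> J \<Longrightarrow> smooth_fun (f j)) \<Longrightarrow> smooth_fun (\<lambda>x. \<Sum>j\<in>J. f j x)"
  by (simp add: smooth_fun_iff diff_upto_sum)

lemma smooth_fun_differentiable: "smooth_fun f \<Longrightarrow> f differentiable (at x)"
  unfolding smooth_fun_iff using diff_upto_differentiable by blast

lemma smooth_fun_partial_deriv: "smooth_fun f \<Longrightarrow> smooth_fun (partial_deriv i f)"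
  unfolding smooth_fun_iff using diff_upto_Suc by blast

lemma smooth_fun_eq_partial_deriv:
  assumes "f differentiable_on UNIV" "\<And>i. smooth_fun (partial_deriv i f)"
  shows "smooth_fun f"
  unfolding smooth_fun_iff
proof
  fix k show "diff_upto k UNIV f"
    using assms by (cases k) (auto simp: diff_upto_0 diff_upto_Suc smooth_fun_iff differentiable_on_def)
qed

section \<open>Seminorm bounds for plane waves and their Taylor remainders\<close>

text \<open>This is the seminorm estimate from \<open>compactly_supported_distribution\<close>,
  isolated so that bounds can be proved by recursion on the order, in the same way as for
  \<open>diff_upto\<close>.\<close>

definition partials_bounded ::
    "nat \<Rightarrow> (real^'d::finite) set \<Rightarrow> (real^'d \<Rightarrow> complex) \<Rightarrow> real \<Rightarrow> bool" where
  "partials_bounded k K f B \<longleftrightarrow>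
     (\<forall>is. \<forall>x\<in>K. length is \<le> k \<longrightarrow> cmod (partial_derivs is f x) \<le> B)"

lemma partials_bounded_0: "partials_bounded 0 K f B \<longleftrightarrow> (\<forall>x\<in>K. cmod (f x) \<le> B)"
  by (auto simp: partials_bounded_def)

lemma partials_bounded_Suc:
  fixes f :: "real^'d::finite \<Rightarrow> complex"
  shows "partials_bounded (Suc k) K f B \<longleftrightarrow>
     (\<forall>x\<in>K. cmod (f x) \<le> B) \<and> (\<forall>i. partials_bounded k K (partial_deriv i f) B)" (is "?L \<longleftrightarrow> ?R")
proof
  assume L: ?L
  have "cmod (f x) \<le> B" if "x \<in> K" for x
    using L[unfolded partials_bounded_def, rule_format, of x "[]"] that by simp
  moreover have "cmod (partial_derivs is (partial_deriv i f) x) \<le> B"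
    if "x \<in> K" "length is \<le> k" for i x "is"
    using L[unfolded partials_bounded_def, rule_format, of x "is @ [i]"] that
    by (simp add: partial_derivs_snoc)
  ultimately show ?R by (auto simp: partials_bounded_def)
next
  assume R: ?R
  show ?L
    unfolding partials_bounded_def
  proof (intro allI impI ballI)
    fix "is" :: "'d list" and x assume a: "x \<in> K" "length is \<le> Suc k"
    show "cmod (partial_derivs is f x) \<le> B"
    proof (cases "is" rule: rev_cases)
      case Nil then show ?thesis using R a by simp
    next
      case (snoc js j)
      then show ?thesis using R a by (auto simp: partial_derivs_snoc partials_bounded_def)
    qed
  qed
qed

lemma partials_bounded_le: "partials_bounded k K f B \<Longrightarrow> B \<le> C \<Longrightarrow> partials_bounded k K f C"
  unfolding partials_bounded_def by force

lemma partials_bounded_order_le: "partials_bounded k K f B \<Longrightarrow> j \<le> k \<Longrightarrow> partials_bounded j K f B"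
  unfolding partials_bounded_def by force

lemma partial_deriv_fun_add:
  assumes "smooth_fun f" "smooth_fun g"
  shows "partial_deriv i (\<lambda>x. f x + g x) = (\<lambda>x. partial_deriv i f x + partial_deriv i g x)"
  using assms smooth_fun_differentiable by (intro ext partial_deriv_add)

lemma partial_deriv_fun_mult:
  assumes "smooth_fun f" "smooth_fun g"
  shows "partial_deriv i (\<lambda>x. f x * g x) = (\<lambda>x. partial_deriv i f x * g x + f x * partial_deriv i g x)"
  using assms smooth_fun_differentiable by (intro ext partial_deriv_mult)

lemma partials_bounded_add:
  assumes "smooth_fun f" "smooth_fun g" "partials_bounded k K f B" "partials_bounded k K g C"
  shows "partials_bounded k K (\<lambda>x. f x + g x) (B + C)"
  using assms
proof (induction k arbitrary: f g)
  case 0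
  then show ?case by (auto simp: partials_bounded_0 intro!: norm_triangle_le add_mono)
next
  case (Suc k)
  then show ?case
    by (auto simp: partials_bounded_Suc partial_deriv_fun_add smooth_fun_partial_deriv
        intro!: norm_triangle_le add_mono)
qed

text \<open>Each differentiation doubles the number of summands in the Leibniz rule, which accounts
  for \<open>2 ^ k\<close>.\<close>

lemma partials_bounded_mult:
  assumes "smooth_fun f" "smooth_fun g" "partials_bounded k K f B" "partials_bounded k K g C" "0 \<le> B" "0 \<le> C"
  shows "partials_bounded k K (\<lambda>x. f x * g x) (2 ^ k * (B * C))"
  using assms(1-4)
proof (induction k arbitrary: f g)
  case 0
  then show ?case using assms(5,6) by (auto simp: partials_bounded_0 norm_mult intro!: mult_mono)
next
  case (Suc k)
  have lower: "partials_bounded k K f B" "partials_bounded k K g C"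
    using Suc.prems(3,4) by (auto elim: partials_bounded_order_le)
  have "partials_bounded k K (partial_deriv i (\<lambda>x. f x * g x)) (2 ^ Suc k * (B * C))" for i
  proof -
    have "partials_bounded k K (\<lambda>x. partial_deriv i f x * g x + f x * partial_deriv i g x)
        (2 ^ k * (B * C) + 2 ^ k * (B * C))"
      using Suc.prems lower
      by (intro partials_bounded_add smooth_fun_mult smooth_fun_partial_deriv Suc.IH)
        (auto simp: partials_bounded_Suc)
    then show ?thesis using Suc.prems by (simp add: partial_deriv_fun_mult mult_ac)
  qed
  moreover have "cmod (f x * g x) \<le> 2 ^ Suc k * (B * C)" if "x \<in> K" for x
  proof -
    have "cmod (f x * g x) \<le> 1 * (B * C)"
      using Suc.prems(3,4) that assms(5,6) by (auto simp: partials_bounded_Suc norm_mult intro!: mult_mono)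
    also have "\<dots> \<le> 2 ^ Suc k * (B * C)"
      using assms(5,6) by (intro mult_right_mono one_le_power) auto
    finally show ?thesis .
  qed
  ultimately show ?case by (subst partials_bounded_Suc) auto
qed

lemma partials_bounded_cmult:
  assumes "smooth_fun f" "partials_bounded k K f B"
  shows "partials_bounded k K (\<lambda>x. c * f x) (cmod c * B)"
  using assms
proof (induction k arbitrary: f)
  case 0
  then show ?case by (auto simp: partials_bounded_0 norm_mult intro!: mult_left_mono)
next
  case (Suc k)
  have "partial_deriv i (\<lambda>x. c * f x) = (\<lambda>x. c * partial_deriv i f x)" for i
    using partial_deriv_fun_mult[OF smooth_fun_const Suc.prems(1)] by (simp add: partial_deriv_const)
  with Suc show ?case
    by (auto simp: partials_bounded_Suc norm_mult smooth_fun_partial_deriv intro!: mult_left_mono)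
qed

lemma smooth_fun_bounded_compact:
  assumes "smooth_fun f" "compact K"
  shows "\<exists>B\<ge>0. \<forall>x\<in>K. cmod (f x) \<le> B"
proof -
    have "continuous_on K f"
      using assms(1) smooth_fun_differentiable differentiable_imp_continuous_within
      by (metis continuous_at_imp_continuous_on)
    then have "bounded (f ` K)"
      using \<open>compact K\<close> by (intro compact_imp_bounded compact_continuous_image)
    then obtain B where "0 < B" "\<forall>x\<in>K. cmod (f x) \<le> B" by (auto simp: bounded_pos)
    then show ?thesis by (intro exI[of _ B]) auto
qed

lemma partials_bounded_compact:
  assumes "smooth_fun f" "compact K"
  shows "\<exists>B\<ge>0. partials_bounded k K f B"
  using assms(1)
proof (induction k arbitrary: f)
  case 0
  then show ?case using smooth_fun_bounded_compact \<open>compact K\<close> by (simp add: partials_bounded_0)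
next
  case (Suc k)
  obtain B where B: "0 \<le> B" "\<forall>x\<in>K. cmod (f x) \<le> B" using smooth_fun_bounded_compact[OF Suc.prems \<open>compact K\<close>] by blast
  have "\<exists>C\<ge>0. partials_bounded k K (partial_deriv i f) C" for i
    using Suc.prems by (intro Suc.IH smooth_fun_partial_deriv)
  then obtain C where C: "\<And>i. 0 \<le> C i" "\<And>i. partials_bounded k K (partial_deriv i f) (C i)"
    by metis
  have "B \<le> B + (\<Sum>i\<in>UNIV. C i)" "\<And>i. C i \<le> B + (\<Sum>i\<in>UNIV. C i)"
    using B(1) C(1) by (auto intro!: sum_nonneg add_increasing member_le_sum)
  then show ?case
    using B C by (intro exI[of _ "B + (\<Sum>i\<in>UNIV. C i)"])
      (force simp: partials_bounded_Suc intro: partials_bounded_le sum_nonneg)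
qed

text \<open>The exponential of \<open>character\<close> with the roles exchanged: the space variable
  is the argument and the real frequency a parameter. A distribution is applied to this
  function.\<close>

definition plane_wave :: "real^'d::finite \<Rightarrow> real^'d \<Rightarrow> complex" where
  "plane_wave \<xi> x = exp (- \<i> * complex_of_real (x \<bullet> \<xi>))"

lemma has_derivative_plane_wave:
  "(plane_wave \<xi> has_derivative (\<lambda>h. - \<i> * of_real (h \<bullet> \<xi>) * plane_wave \<xi> x)) (at x)"
proof -
  have "((\<lambda>x. - \<i> * complex_of_real (x \<bullet> \<xi>)) has_derivative
      (\<lambda>h. - \<i> * of_real (h \<bullet> \<xi>))) (at x)"
    by (auto intro!: derivative_eq_intros)
  from has_derivative_compose[OF this, of exp "\<lambda>h. h * exp (- \<i> * complex_of_real (x \<bullet> \<xi>))"]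
  show ?thesis
    by (auto simp: plane_wave_def[abs_def] has_field_derivative_def mult_commute_abs DERIV_exp
        simp flip: has_field_derivative_def)
qed

lemma partial_deriv_plane_wave: "partial_deriv i (plane_wave \<xi>) = (\<lambda>x. - \<i> * of_real (\<xi> $ i) * plane_wave \<xi> x)"
  by (simp add: fun_eq_iff has_derivative_partial_deriv[OF has_derivative_plane_wave]
      inner_commute[of "axis _ _"] inner_axis)

lemma smooth_fun_plane_wave: "smooth_fun (plane_wave \<xi>)"
  unfolding smooth_fun_iff
proof
  fix n
  have d: "plane_wave \<xi> differentiable (at x)" for x
    using has_derivative_plane_wave differentiable_def by blast
  show "diff_upto n UNIV (plane_wave \<xi>)"
  proof (induction n)
    case (Suc n)
    then show ?case
      unfolding diff_upto_Suc partial_deriv_plane_wave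
      by (intro conjI allI ballI d diff_upto_mult[OF open_UNIV] diff_upto_const)
  qed (simp add: diff_upto_0 d)
qed

lemma smooth_fun_inner: "smooth_fun (\<lambda>x. c * complex_of_real (x \<bullet> h))"
proof (rule smooth_fun_eq_partial_deriv)
  have D: "((\<lambda>x. c * complex_of_real (x \<bullet> h)) has_derivative (\<lambda>u. c * of_real (u \<bullet> h))) (at x)" for x
    by (auto intro!: derivative_eq_intros)
  show "(\<lambda>x. c * complex_of_real (x \<bullet> h)) differentiable_on UNIV"
    using D by (auto simp: differentiable_on_def differentiable_def)
  show "smooth_fun (partial_deriv i (\<lambda>x. c * complex_of_real (x \<bullet> h)))" for i
  proof -
    have "partial_deriv i (\<lambda>x. c * complex_of_real (x \<bullet> h)) = (\<lambda>x. c * of_real (axis i 1 \<bullet> h))"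
      by (intro ext has_derivative_partial_deriv[OF D])
    then show ?thesis by (simp add: smooth_fun_const)
  qed
qed

lemma partials_bounded_plane_wave:
  assumes "norm h \<le> 1"
  shows "partials_bounded k K (plane_wave h) 1"
proof (induction k)
  case 0
  then show ?case by (simp add: partials_bounded_0 plane_wave_def)
next
  case (Suc k)
  have "partials_bounded k K (partial_deriv i (plane_wave h)) 1" for i
  proof -
    have "partials_bounded k K (partial_deriv i (plane_wave h)) (cmod (- \<i> * of_real (h $ i)) * 1)"
      unfolding partial_deriv_plane_wave
      by (intro partials_bounded_cmult smooth_fun_plane_wave Suc.IH)
    moreover have "cmod (- \<i> * of_real (h $ i)) * 1 \<le> 1"
      using component_le_norm_cart[of h i] assms by (simp add: norm_mult)
    ultimately show ?thesis by (rule partials_bounded_le)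
  qed
  moreover have "cmod (plane_wave h x) \<le> 1" for x by (simp add: plane_wave_def)
  ultimately show ?case by (simp add: partials_bounded_Suc)
qed

lemma partials_bounded_plane_wave_minus_1:
  assumes "norm h \<le> 1" "\<And>x. x \<in> K \<Longrightarrow> norm x \<le> R" "1 \<le> R"
  shows "partials_bounded k K (\<lambda>x. plane_wave h x + (-1)) (R * norm h)"
proof -
  have base: "cmod (plane_wave h x + (-1)) \<le> R * norm h" if "x \<in> K" for x
  proof -
    have "cmod (plane_wave h x + (-1)) \<le> \<bar>x \<bullet> h\<bar>"
      using Taylor_exp[of "- \<i> * complex_of_real (x \<bullet> h)" 0]
      by (simp add: plane_wave_def norm_mult)
    also have "\<dots> \<le> norm x * norm h" by (rule Cauchy_Schwarz_ineq2)
    also have "\<dots> \<le> R * norm h" using assms(2)[OF that] by (intro mult_right_mono) auto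
    finally show ?thesis .
  qed
  show ?thesis
  proof (cases k)
    case 0
    then show ?thesis using base by (simp add: partials_bounded_0)
  next
    case (Suc l)
    have "partials_bounded l K (partial_deriv i (\<lambda>x. plane_wave h x + (-1))) (R * norm h)" for i
    proof -
      have "partials_bounded l K (partial_deriv i (plane_wave h)) (cmod (- \<i> * of_real (h $ i)) * 1)"
        unfolding partial_deriv_plane_wave
        by (intro partials_bounded_cmult smooth_fun_plane_wave partials_bounded_plane_wave assms)
      moreover have "cmod (- \<i> * of_real (h $ i)) * 1 \<le> R * norm h"
        using component_le_norm_cart[of h i] mult_right_mono[OF assms(3), of "norm h"]
        by (simp add: norm_mult)
      moreover have eq: "partial_deriv i (\<lambda>x. plane_wave h x + (-1)) = partial_deriv i (plane_wave h)"
        by (subst partial_deriv_fun_add)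
          (auto simp: partial_deriv_const smooth_fun_plane_wave smooth_fun_const)
      ultimately show ?thesis unfolding eq by (metis partials_bounded_le)
    qed
    then show ?thesis using base Suc by (simp add: partials_bounded_Suc)
  qed
qed

text \<open>Differentiating the second-order Taylor remainder gives \<open>- \<i> * h $ i\<close>
  times the first-order remainder, which is of order \<open>norm h\<close> together with all its
  derivatives. Hence every derivative of the remainder, and not only its value, is quadratic in
  \<open>norm h\<close>; \<open>1 \<le> R\<close> lets one constant serve all orders.\<close>

lemma partials_bounded_plane_wave_remainder:
  assumes "norm h \<le> 1" "\<And>x. x \<in> K \<Longrightarrow> norm x \<le> R" "1 \<le> R"
  shows "partials_bounded k K (\<lambda>x. (plane_wave h x + (-1)) + \<i> * complex_of_real (x \<bullet> h)) (R\<^sup>2 * (norm h)\<^sup>2)"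
    (is "partials_bounded k K ?f ?B")
proof -
  have base: "cmod (?f x) \<le> ?B" if "x \<in> K" for x
  proof -
    have "cmod (?f x) \<le> \<bar>x \<bullet> h\<bar>\<^sup>2"
      using Taylor_exp[of "- \<i> * complex_of_real (x \<bullet> h)" 1]
      by (simp add: plane_wave_def norm_mult numeral_2_eq_2 algebra_simps)
    also have "\<dots> \<le> (norm x * norm h)\<^sup>2" by (intro power_mono Cauchy_Schwarz_ineq2) auto
    also have "\<dots> \<le> (R * norm h)\<^sup>2"
      using assms(2)[OF that] by (intro power_mono mult_right_mono) auto
    finally show ?thesis by (simp add: power_mult_distrib)
  qed
  show ?thesis
  proof (cases k)
    case 0
    then show ?thesis using base by (simp add: partials_bounded_0)
  next
    case (Suc l)
    have "partials_bounded l K (partial_deriv i ?f) ?B" for i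
    proof -
      have D: "((\<lambda>x. \<i> * complex_of_real (x \<bullet> h)) has_derivative (\<lambda>u. \<i> * of_real (u \<bullet> h))) (at x)" for x
        by (auto intro!: derivative_eq_intros)
      have eq: "partial_deriv i ?f = (\<lambda>x. (- \<i> * of_real (h $ i)) * (plane_wave h x + (-1)))"
        by (subst partial_deriv_fun_add,
            (intro smooth_fun_add smooth_fun_plane_wave smooth_fun_const smooth_fun_inner)+,
            subst partial_deriv_fun_add,
            (intro smooth_fun_plane_wave smooth_fun_const)+)
          (auto simp: fun_eq_iff partial_deriv_const partial_deriv_plane_wave
            has_derivative_partial_deriv[OF D] inner_commute[of "axis _ _"] inner_axis algebra_simps)
      have "partials_bounded l K (\<lambda>x. (- \<i> * of_real (h $ i)) * (plane_wave h x + (-1)))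
          (cmod (- \<i> * of_real (h $ i)) * (R * norm h))"
        by (intro partials_bounded_cmult smooth_fun_add smooth_fun_plane_wave smooth_fun_const
            partials_bounded_plane_wave_minus_1 assms)
      moreover have "cmod (- \<i> * of_real (h $ i)) * (R * norm h) \<le> ?B"
      proof -
        have "\<bar>h $ i\<bar> * (R * norm h) \<le> (R * norm h) * (R * norm h)"
          using component_le_norm_cart[of h i] mult_right_mono[OF assms(3), of "norm h"] assms(3)
          by (intro mult_right_mono) auto
        then show ?thesis by (simp add: norm_mult power2_eq_square algebra_simps)
      qed
      ultimately show ?thesis unfolding eq by (rule partials_bounded_le)
    qed
    then show ?thesis using base Suc by (simp add: partials_bounded_Suc)
  qed
qed

section \<open>Differentiation of a distribution applied to plane waves\<close>

lemma distribution_sum: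
  assumes "compactly_supported_distribution T" "\<And>j. j \<in> J \<Longrightarrow> smooth_fun (f j)"
  shows "T (\<lambda>x. \<Sum>j\<in>J. f j x) = (\<Sum>j\<in>J. T (f j))"
proof -
  have zero: "T (\<lambda>x. 0) = 0"
  proof -
    have "T (\<lambda>x. 0 * 0) = 0 * T (\<lambda>x. 0)"
      using assms(1) smooth_fun_const unfolding compactly_supported_distribution_def by blast
    then show ?thesis by simp
  qed
  show ?thesis
    using assms(2)
  proof (induction J rule: infinite_finite_induct)
    case (insert j J)
    have "T (\<lambda>x. f j x + (\<Sum>j\<in>J. f j x)) = T (f j) + T (\<lambda>x. \<Sum>j\<in>J. f j x)"
      using assms(1) insert.prems smooth_fun_sum[of J f]
      unfolding compactly_supported_distribution_def by simp
    then show ?case using insert by simp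
  qed (simp_all add: zero)
qed

text \<open>The plane wave at \<open>\<xi> + h\<close> is expanded to second order in
  \<open>h\<close> under \<open>T\<close>; the seminorm estimate makes the contribution of the
  remainder quadratic in \<open>norm h\<close>. The weight \<open>p\<close> is present so that the
  derivative has the same form, with \<open>p\<close> multiplied by a coordinate function, and the
  result can be iterated.\<close>

lemma has_derivative_distribution_plane_wave:
  fixes T :: "(real^'d::finite \<Rightarrow> complex) \<Rightarrow> complex"
  assumes T: "compactly_supported_distribution T" and p: "smooth_fun p"
  shows "((\<lambda>\<xi>. T (\<lambda>x. p x * plane_wave \<xi> x)) has_derivative
     (\<lambda>h. \<Sum>j\<in>UNIV. of_real (h $ j) * T (\<lambda>x. (- \<i> * of_real (x \<bullet> axis j 1) * p x) * plane_wave \<xi> x))) (at \<xi>)"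
    (is "(?G has_derivative ?D) _")
proof -
  obtain K N C where "compact K" and C0: "\<And>f B. smooth_fun f \<Longrightarrow> 0 \<le> B \<Longrightarrow> partials_bounded N K f B \<Longrightarrow> cmod (T f) \<le> C * B"
    using T unfolding compactly_supported_distribution_def partials_bounded_def by blast
  \<comment> \<open>The constant supplied by the definition has no prescribed sign, so it is
    replaced by its modulus.\<close>
  have C: "cmod (T f) \<le> \<bar>C\<bar> * B" if "smooth_fun f" "0 \<le> B" "partials_bounded N K f B" for f B
    using C0[OF that] that(2) mult_right_mono[of C "\<bar>C\<bar>" B] by linarith
  obtain R' where "\<And>x. x \<in> K \<Longrightarrow> norm x \<le> R'"
    using compact_imp_bounded[OF \<open>compact K\<close>] by (auto simp: bounded_iff)
  then obtain R where R: "\<And>x. x \<in> K \<Longrightarrow> norm x \<le> R" "1 \<le> R"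
    using that[of "max R' 1"] by fastforce
  have sm: "smooth_fun (\<lambda>x. p x * plane_wave \<xi> x)"
    by (intro smooth_fun_mult p smooth_fun_plane_wave)
  obtain B where B: "0 \<le> B" "partials_bounded N K (\<lambda>x. p x * plane_wave \<xi> x) B"
    using partials_bounded_compact[OF sm \<open>compact K\<close>] by blast
  \<comment> \<open>The second-order remainder of \<open>plane_wave h\<close>; multiplied by the
    plane wave at \<open>\<xi>\<close> it is the error of the linear approximation at
    \<open>\<xi> + h\<close>.\<close>
  let ?r = "\<lambda>h x. (plane_wave h x + (-1)) + \<i> * complex_of_real (x \<bullet> h)"
  have smr: "smooth_fun (?r h)" for h
    by (intro smooth_fun_add smooth_fun_plane_wave smooth_fun_const smooth_fun_inner)
  have D: "?D h = T (\<lambda>x. p x * plane_wave \<xi> x * (- \<i> * of_real (x \<bullet> h)))" for h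
  proof -
    let ?q = "\<lambda>j x. (- \<i> * complex_of_real (x \<bullet> axis j 1) * p x) * plane_wave \<xi> x"
    have smq: "smooth_fun (?q j)" for j
      by (intro smooth_fun_mult p smooth_fun_plane_wave smooth_fun_inner)
    have "?D h = (\<Sum>j\<in>UNIV. T (\<lambda>x. of_real (h $ j) * ?q j x))"
    proof (intro sum.cong refl)
      fix j
      have "T (\<lambda>x. of_real (h $ j) * ?q j x) = of_real (h $ j) * T (?q j)"
        using T smq[of j] unfolding compactly_supported_distribution_def by blast
      then show "of_real (h $ j) * T (?q j) = T (\<lambda>x. of_real (h $ j) * ?q j x)" by simp
    qed
    also have "\<dots> = T (\<lambda>x. \<Sum>j\<in>UNIV. of_real (h $ j) * ?q j x)"
      by (rule distribution_sum[symmetric, OF T]) (intro smooth_fun_mult smooth_fun_const smq)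
    also have "(\<lambda>x. \<Sum>j\<in>UNIV. of_real (h $ j) * ?q j x) = (\<lambda>x. p x * plane_wave \<xi> x * (- \<i> * of_real (x \<bullet> h)))"
    proof
      fix x :: "real^'d"
      have "complex_of_real (x \<bullet> h) = (\<Sum>j\<in>UNIV. of_real (h $ j) * of_real (x \<bullet> axis j 1))"
        by (simp add: inner_axis) (simp add: inner_vec_def mult.commute)
      then show "(\<Sum>j\<in>UNIV. of_real (h $ j) * ?q j x) = p x * plane_wave \<xi> x * (- \<i> * of_real (x \<bullet> h))"
        by (simp add: sum_distrib_left sum_distrib_right sum_negf algebra_simps)
    qed
    finally show ?thesis .
  qed
  have split: "?G (\<xi> + h) - ?G \<xi> - ?D h = T (\<lambda>x. p x * plane_wave \<xi> x * ?r h x)" for h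
  proof -
    have add: "T (\<lambda>x. f x + g x) = T f + T g" if "smooth_fun f" "smooth_fun g" for f g
      using T that unfolding compactly_supported_distribution_def by simp
    let ?q = "\<lambda>x. p x * plane_wave \<xi> x"
    have "(\<lambda>x. p x * plane_wave (\<xi> + h) x)
        = (\<lambda>x. ?q x + (?q x * (- \<i> * of_real (x \<bullet> h)) + ?q x * ?r h x))"
      by (auto simp: fun_eq_iff plane_wave_def inner_add_right exp_add[symmetric] algebra_simps)
    then have "?G (\<xi> + h) = T (\<lambda>x. ?q x + (?q x * (- \<i> * of_real (x \<bullet> h)) + ?q x * ?r h x))" by simp
    also have "\<dots> = ?G \<xi> + (T (\<lambda>x. ?q x * (- \<i> * of_real (x \<bullet> h))) + T (\<lambda>x. ?q x * ?r h x))"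
    proof -
      have s2: "smooth_fun (\<lambda>x. ?q x * (- \<i> * of_real (x \<bullet> h)))"
        by (intro smooth_fun_mult p smooth_fun_plane_wave smooth_fun_inner)
      have s3: "smooth_fun (\<lambda>x. ?q x * ?r h x)" by (intro smooth_fun_mult[OF sm smr])
      show ?thesis
        by (simp only: add[OF sm smooth_fun_add[OF s2 s3]] add[OF s2 s3])
    qed
    finally show ?thesis using D by simp
  qed
  have est: "cmod (?G (\<xi> + h) - ?G \<xi> - ?D h) \<le> (\<bar>C\<bar> * (2 ^ N * (B * R\<^sup>2))) * (norm h)\<^sup>2"
    if "norm h \<le> 1" for h
  proof -
    have "partials_bounded N K (\<lambda>x. (p x * plane_wave \<xi> x) * ?r h x) (2 ^ N * (B * (R\<^sup>2 * (norm h)\<^sup>2)))"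
      by (rule partials_bounded_mult[OF sm smr B(2) partials_bounded_plane_wave_remainder[OF that R] B(1)]) auto
    from C[OF smooth_fun_mult[OF sm smr] _ this] show ?thesis
      unfolding split using B(1) by (simp add: algebra_simps)
  qed
  \<comment> \<open>The summand 1 permits division by \<open>L\<close> in the choice of
    \<open>d\<close>.\<close>
  define L where "L = \<bar>C\<bar> * (2 ^ N * (B * R\<^sup>2)) + 1"
  have L: "0 < L" using B(1) R(2) unfolding L_def by (intro add_nonneg_pos) auto
  show ?thesis
    unfolding has_derivative_at_alt
  proof (intro conjI allI impI)
    have "?D = (\<lambda>h. \<Sum>j\<in>UNIV. (h $ j) *\<^sub>R T (\<lambda>x. (- \<i> * of_real (x \<bullet> axis j 1) * p x) * plane_wave \<xi> x))"
      by (simp add: scaleR_conv_of_real)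
    moreover have "bounded_linear \<dots>"
      by (intro bounded_linear_sum bounded_linear_scaleR_left[THEN bounded_linear_compose] bounded_linear_vec_nth)
    ultimately show "bounded_linear ?D" by simp
    fix e :: real assume "0 < e"
    define d where "d = min 1 (e / L)"
    have "0 < d" using \<open>0 < e\<close> L by (simp add: d_def)
    moreover have "cmod (?G y - ?G \<xi> - ?D (y - \<xi>)) \<le> e * norm (y - \<xi>)" if "norm (y - \<xi>) < d" for y
    proof -
      have "cmod (?G (\<xi> + (y - \<xi>)) - ?G \<xi> - ?D (y - \<xi>)) \<le> L * (norm (y - \<xi>))\<^sup>2"
      proof (rule order_trans[OF est])
        show "norm (y - \<xi>) \<le> 1" using that by (simp add: d_def)
        show "\<bar>C\<bar> * (2 ^ N * (B * R\<^sup>2)) * (norm (y - \<xi>))\<^sup>2 \<le> L * (norm (y - \<xi>))\<^sup>2"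
          unfolding L_def by (intro mult_right_mono) auto
      qed
      also have "\<dots> = (L * norm (y - \<xi>)) * norm (y - \<xi>)" by (simp add: power2_eq_square)
      also have "\<dots> \<le> e * norm (y - \<xi>)"
        using that L by (intro mult_right_mono) (auto simp: d_def pos_less_divide_eq mult.commute)
      finally show ?thesis by simp
    qed
    ultimately show "\<exists>d>0. \<forall>y. norm (y - \<xi>) < d \<longrightarrow> cmod (?G y - ?G \<xi> - ?D (y - \<xi>)) \<le> e * norm (y - \<xi>)"
      by blast
  qed
qed

lemma diff_upto_distribution_plane_wave:
  fixes T :: "(real^'d::finite \<Rightarrow> complex) \<Rightarrow> complex"
  assumes T: "compactly_supported_distribution T" and "smooth_fun p"
  shows "diff_upto k UNIV (\<lambda>\<xi>. T (\<lambda>x. p x * plane_wave \<xi> x))"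
  using assms(2)
proof (induction k arbitrary: p)
  case 0
  show ?case
    using has_derivative_distribution_plane_wave[OF T 0] unfolding diff_upto_0 differentiable_def by blast
next
  case (Suc k)
  have "partial_deriv i (\<lambda>\<xi>. T (\<lambda>x. p x * plane_wave \<xi> x))
      = (\<lambda>\<xi>. T (\<lambda>x. (- \<i> * of_real (x \<bullet> axis i 1) * p x) * plane_wave \<xi> x))" for i
  proof
    fix \<xi>
    show "partial_deriv i (\<lambda>\<xi>. T (\<lambda>x. p x * plane_wave \<xi> x)) \<xi>
      = T (\<lambda>x. (- \<i> * of_real (x \<bullet> axis i 1) * p x) * plane_wave \<xi> x)"
      unfolding has_derivative_partial_deriv[OF has_derivative_distribution_plane_wave[OF T Suc.prems]]
      by (simp add: axis_def if_distrib if_distribR cong: if_cong)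
  qed
  moreover have "smooth_fun (\<lambda>x. - \<i> * of_real (x \<bullet> axis i 1) * p x)" for i :: 'd
    by (intro smooth_fun_mult smooth_fun_inner Suc.prems)
  ultimately show ?case
    unfolding diff_upto_Suc
    using has_derivative_distribution_plane_wave[OF T Suc.prems] Suc.IH
    by (auto simp only: differentiable_def)
qed

lemma smooth_near_distr_fourier:
  assumes "compactly_supported_distribution T"
  shows "smooth_near (distr_fourier T)"
proof -
  have "distr_fourier T = (\<lambda>\<xi>. T (\<lambda>x. 1 * plane_wave \<xi> x))"
    by (simp add: distr_fourier_def[abs_def] plane_wave_def)
  then show ?thesis
    using diff_upto_distribution_plane_wave[OF assms smooth_fun_const[of 1]] open_UNIV
    unfolding smooth_near_def by (metis UNIV_I)
qed


section \<open>Jets that are invariant under a dilation\<close>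

lemma linear_recurrence_tendsto_0:
  fixes x y :: "nat \<Rightarrow> complex"
  assumes "cmod c < 1" "\<And>p. x (Suc p) = c * x p + y p" "y \<longlonglongrightarrow> 0"
  shows "x \<longlonglongrightarrow> 0"
proof (rule LIMSEQ_I)
  fix e :: real assume "0 < e"
  define r where "r = cmod c"
  have r: "0 \<le> r" "r < 1" using assms(1) by (auto simp: r_def)
  \<comment> \<open>\<open>e / 2\<close> is the fixed point of multiplication by \<open>r\<close>
    followed by addition of \<open>e / 2 * (1 - r)\<close>. With this tolerance the inhomogeneities
    accumulate to at most \<open>e / 2\<close>.\<close>
  obtain P where P: "\<And>p. P \<le> p \<Longrightarrow> cmod (y p) < e / 2 * (1 - r)"
    using LIMSEQ_D[OF assms(3), of "e / 2 * (1 - r)"] \<open>0 < e\<close> r by auto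
  have bound: "cmod (x (P + k)) \<le> r ^ k * cmod (x P) + e / 2" for k
  proof (induction k)
    case 0
    then show ?case using \<open>0 < e\<close> by simp
  next
    case (Suc k)
    have "cmod (x (P + Suc k)) \<le> r * cmod (x (P + k)) + cmod (y (P + k))"
      using norm_triangle_ineq[of "c * x (P + k)" "y (P + k)"] assms(2)[of "P + k"]
      by (simp add: norm_mult r_def)
    also have "\<dots> \<le> r * (r ^ k * cmod (x P) + e / 2) + e / 2 * (1 - r)"
      using P[of "P + k"] Suc r by (intro add_mono mult_left_mono) auto
    finally show ?case by (simp add: field_simps)
  qed
  have "(\<lambda>k. r ^ k * cmod (x P)) \<longlonglongrightarrow> 0 * cmod (x P)"
    using r by (intro tendsto_mult LIMSEQ_realpow_zero tendsto_const)
  then obtain Q where Q: "\<And>k. Q \<le> k \<Longrightarrow> r ^ k * cmod (x P) < e / 2"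
    using LIMSEQ_D[of "\<lambda>k. r ^ k * cmod (x P)" 0 "e / 2"] \<open>0 < e\<close> by fastforce
  show "\<exists>N. \<forall>n\<ge>N. norm (x n - 0) < e"
  proof (intro exI allI impI)
    fix n assume "P + Q \<le> n"
    then have "n = P + (n - P)" "Q \<le> n - P" by auto
    then show "norm (x n - 0) < e" using bound[of "n - P"] Q[of "n - P"] by auto
  qed
qed

section \<open>Powers of a matrix with all eigenvalues inside the unit disc\<close>

text \<open>This is \<open>q(A) v\<close>, computed by Horner's scheme on vectors, so that no powers
  of matrices have to be formed.\<close>

definition poly_act :: "complex^'d::finite^'d \<Rightarrow> complex poly \<Rightarrow> complex^'d \<Rightarrow> complex^'d" where
  "poly_act A q v = fold_coeffs (\<lambda>a w. a *s v + A *v w) q 0"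

lemma poly_act_0 [simp]: "poly_act A 0 v = 0"
  by (simp add: poly_act_def)

lemma poly_act_pCons [simp]: "poly_act A (pCons a q) v = a *s v + A *v poly_act A q v"
  by (cases "a = 0 \<and> q = 0") (auto simp: poly_act_def fold_coeffs_pCons_not_0_0_eq)

lemma poly_act_add: "poly_act A (p + q) v = poly_act A p v + poly_act A q v"
  by (induction p q rule: poly_induct2)
    (auto simp: vec.scale_left_distrib matrix_vector_right_distrib algebra_simps)

lemma poly_act_smult: "poly_act A (smult c q) v = c *s poly_act A q v"
  by (induction q) (auto simp: vector_scalar_commute vec.scale_right_distrib)

lemma poly_act_monom: "poly_act A (monom c i) v = c *s (((\<lambda>w. A *v w) ^^ i) v)"
  by (induction i) (auto simp: monom_0 monom_Suc vector_scalar_commute)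

lemma poly_act_sum: "poly_act A (\<Sum>i\<in>I. q i) v = (\<Sum>i\<in>I. poly_act A (q i) v)"
  by (induction I rule: infinite_finite_induct) (auto simp: poly_act_add)

lemma poly_act_linear_factor:
  "poly_act A ([:- c, 1:] * q) v = A *v poly_act A q v - c *s poly_act A q v"
proof -
  have "[:- c, 1:] * q = smult (- c) q + pCons 0 q" by simp
  then show ?thesis by (simp only: poly_act_add poly_act_smult poly_act_pCons) (simp add: vec_eq_iff)
qed

text \<open>\<open>A - c\<close> commutes with every polynomial in \<open>A\<close>.\<close>

lemma poly_act_shift: "poly_act A q (A *v v - c *s v) = A *v poly_act A q v - c *s poly_act A q v"
proof (induction q)
  case (pCons a q)
  let ?X = "poly_act A q v"
  have "poly_act A (pCons a q) (A *v v - c *s v) = a *s (A *v v - c *s v) + A *v (A *v ?X - c *s ?X)"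
    using pCons.IH by simp
  also have "\<dots> = A *v (a *s v + A *v ?X) - c *s (a *s v + A *v ?X)"
    by (simp add: matrix_vector_right_distrib matrix_vector_mult_diff_distrib vector_scalar_commute
        vec.scale_right_distrib vec.scale_right_diff_distrib mult.commute)
  finally show ?case by simp
qed simp

text \<open>The vectors \<open>v\<close>, \<open>A v\<close>, ..., \<open>A^d v\<close> exceed the
  dimension in number, and the coefficients of a linear relation form the polynomial. Dependence is
  a property of the set of these vectors, so a repetition among them is treated apart, by a
  difference of two monomials.\<close>

lemma annihilating_poly:
  fixes A :: "complex^'d::finite^'d"
  shows "\<exists>q. q \<noteq> 0 \<and> poly_act A q v = 0"
proof -
  let ?F = "\<lambda>i. ((\<lambda>w. A *v w) ^^ i) v" and ?I = "{..CARD('d)}"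
  show ?thesis
  proof (cases "inj_on ?F ?I")
    case False
    then obtain i j where ij: "i \<noteq> j" "?F i = ?F j" by (auto simp: inj_on_def)
    let ?q = "monom 1 i + monom (-1) j :: complex poly"
    have "coeff ?q i = 1" using ij by simp
    then have "?q \<noteq> 0" by (metis coeff_0 zero_neq_one)
    moreover have "poly_act A ?q v = 0" using ij by (simp add: poly_act_add poly_act_monom)
    ultimately show ?thesis by blast
  next
    case True
    have "card (?F ` ?I) > CARD('d)" using True by (simp add: card_image)
    then have "vec.dependent (?F ` ?I)"
      using vec.independent_bound_general[of "?F ` ?I"] dim_subset_UNIV_cart_gen[of "?F ` ?I"]
      by auto
    then obtain u x where u: "x \<in> ?F ` ?I" "u x \<noteq> 0" "(\<Sum>w\<in>?F ` ?I. u w *s w) = 0"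
      by (auto simp: vec.dependent_finite)
    then obtain j where j: "j \<in> ?I" "x = ?F j" by blast
    let ?q = "\<Sum>i\<in>?I. monom (u (?F i)) i"
    have "coeff ?q j = u (?F j)" using j by (simp add: coeff_sum)
    then have "?q \<noteq> 0" using u j by (metis coeff_0)
    moreover have "poly_act A ?q v = 0"
      using u(3) True by (simp add: poly_act_sum poly_act_monom sum.reindex)
    ultimately show ?thesis by blast
  qed
qed

text \<open>Induction on the degree of a polynomial annihilating \<open>v\<close> replaces the
  Jordan form. A root \<open>c\<close> is split off. If its modulus is below 1, then
  \<open>A v - c v\<close> is annihilated by the cofactor, and the powers applied to
  \<open>v\<close> obey a contracting recurrence with an inhomogeneity that tends to 0. Otherwise
  the cofactor annihilates \<open>v\<close> already.\<close>

lemma matrix_powers_tendsto_0: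
  fixes A :: "complex^'d::finite^'d"
  assumes eig: "\<And>c v. v \<noteq> 0 \<Longrightarrow> A *v v = c *s v \<Longrightarrow> cmod c < 1"
  shows "(\<lambda>p. (((\<lambda>w. A *v w) ^^ p) v) $ i) \<longlonglongrightarrow> 0"
proof -
  let ?F = "\<lambda>w. A *v w"
  have "q \<noteq> 0 \<Longrightarrow> poly_act A q v = 0 \<Longrightarrow> (\<lambda>p. ((?F ^^ p) v) $ i) \<longlonglongrightarrow> 0" for q v
  proof (induction "degree q" arbitrary: q v)
    case 0
    then obtain a where "q = [:a:]" "a \<noteq> 0" by (metis degree_eq_zeroE pCons_0_0)
    then have "v = 0" using 0 by simp
    then have "(?F ^^ p) v = 0" for p by (induction p) auto
    then show ?case by simp
  next
    case (Suc n)
    then have "\<not> constant (poly q)" by (simp add: constant_degree)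
    then obtain c where "poly q c = 0" using fundamental_theorem_of_algebra by blast
    then obtain q' where q': "q = [:- c, 1:] * q'" by (auto simp: poly_eq_0_iff_dvd dvd_def)
    then have "q' \<noteq> 0" using Suc.prems by auto
    then have deg: "n = degree q'" using Suc.hyps(2) unfolding q' by (subst (asm) degree_mult_eq) auto
    show ?case
    proof (cases "cmod c < 1")
      case True
      let ?w = "A *v v - c *s v"
      have "poly_act A q' ?w = 0"
        using Suc.prems(2) unfolding q' poly_act_linear_factor poly_act_shift .
      then have lim: "(\<lambda>p. ((?F ^^ p) ?w) $ i) \<longlonglongrightarrow> 0" using Suc.hyps(1)[OF deg \<open>q' \<noteq> 0\<close>] by blast
      have "(?F ^^ Suc p) v = c *s ((?F ^^ p) v) + (?F ^^ p) ?w" for p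
      proof (induction p)
        case (Suc p)
        then show ?case by (simp add: matrix_vector_right_distrib vector_scalar_commute)
      qed simp
      then have "((?F ^^ Suc p) v) $ i = c * ((?F ^^ p) v) $ i + ((?F ^^ p) ?w) $ i" for p
        by (metis vector_add_component vector_smult_component)
      then show ?thesis by (rule linear_recurrence_tendsto_0[OF True _ lim])
    next
      case False
      \<comment> \<open>Unless the cofactor annihilates \<open>v\<close>, this exhibits an
        eigenvector for an eigenvalue that \<open>eig\<close> excludes.\<close>
      have "A *v poly_act A q' v = c *s poly_act A q' v"
        using Suc.prems(2) unfolding q' poly_act_linear_factor by simp
      then have "poly_act A q' v = 0" using eig False by blast
      then show ?thesis using Suc.hyps(1)[OF deg \<open>q' \<noteq> 0\<close>] by blast
    qed
  qed
  then show ?thesis using annihilating_poly by blast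
qed

definition mat_power :: "real^'d::finite^'d \<Rightarrow> nat \<Rightarrow> real^'d^'d" where
  "mat_power B p = ((\<lambda>C. B ** C) ^^ p) (mat 1)"

lemma mat_power_0 [simp]: "mat_power B 0 = mat 1"
  and mat_power_Suc: "mat_power B (Suc p) = B ** mat_power B p"
  by (simp_all add: mat_power_def)

lemma mat_power_Suc2: "mat_power B (Suc p) = mat_power B p ** B"
  by (induction p) (simp_all add: mat_power_Suc matrix_mul_assoc)

lemma transpose_mat_power: "transpose (mat_power B p) = mat_power (transpose B) p"
proof (induction p)
  case (Suc p)
  have "transpose (mat_power B (Suc p)) = transpose (mat_power B p) ** transpose B"
    by (simp add: mat_power_Suc matrix_transpose_mul)
  then show ?case by (simp add: Suc mat_power_Suc2)
qed simp

lemma invertible_if_inj: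
  fixes A :: "'a::field^'d::finite^'d"
  assumes "\<And>v. A *v v = 0 \<Longrightarrow> v = 0" shows "invertible A"
  unfolding invertible_left_inverse matrix_left_invertible_ker using assms by simp

lemma matrix_inv_cancel:
  fixes A :: "'a::field^'d::finite^'d"
  assumes "invertible A" shows "A ** matrix_inv A = mat 1" "matrix_inv A ** A = mat 1"
  using someI_ex[OF assms[unfolded invertible_def]] unfolding matrix_inv_def by auto

text \<open>A nonzero real kernel vector, read as a complex vector, would be an eigenvector for the
  eigenvalue 0.\<close>

lemma invertible_dilation_matrix:
  assumes "dilation_matrix M" shows "invertible (map_matrix real_of_int M)"
proof (rule invertible_if_inj)
  fix v :: "real^'a" assume v: "map_matrix real_of_int M *v v = 0"
  let ?w = "(\<chi> i. complex_of_real (v $ i))"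
  have "(map_matrix complex_of_int M *v ?w) $ i = of_real ((map_matrix real_of_int M *v v) $ i)" for i
    by (simp add: matrix_vector_mult_def map_matrix_def)
  then have "map_matrix complex_of_int M *v ?w = 0 *s ?w" using v by (simp add: vec_eq_iff)
  then have "?w = 0" using assms unfolding dilation_matrix_def by (metis norm_zero not_one_less_zero)
  then show "v = 0" by (simp add: vec_eq_iff)
qed

text \<open>Eigenvalues of the inverse are reciprocals of those of \<open>M\<close>, hence inside
  the unit disc. Since they may be complex, the argument passes to the complexified inverse
  \<open>Rc\<close>, and column \<open>j\<close> of a power is obtained by applying it to
  \<open>axis j 1\<close>.\<close>

lemma inverse_dilation_powers:
  assumes M: "dilation_matrix M"
  shows "(\<lambda>p. mat_power (matrix_inv (map_matrix real_of_int M)) p $ i $ j) \<longlonglongrightarrow> 0"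
proof -
  let ?M = "map_matrix real_of_int M" and ?Mc = "map_matrix complex_of_int M"
  define R where "R = matrix_inv ?M"
  define Rc where "Rc = map_matrix complex_of_real R"
  have MR: "?M ** R = mat 1"
    using matrix_inv_cancel[OF invertible_dilation_matrix[OF M]] by (simp add: R_def)
  have "?Mc ** Rc = map_matrix complex_of_real (?M ** R)"
    by (simp add: Rc_def matrix_matrix_mult_def map_matrix_def vec_eq_iff)
  also have "\<dots> = mat 1" unfolding MR by (simp add: mat_def map_matrix_def vec_eq_iff)
  finally have MRc: "?Mc ** Rc = mat 1" .
  have eig: "cmod c < 1" if "v \<noteq> 0" "Rc *v v = c *s v" for c v
  proof -
    have v: "v = c *s (?Mc *v v)"
      using arg_cong[OF that(2), of "\<lambda>w. ?Mc *v w"] MRc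
      by (simp add: matrix_vector_mul_assoc vector_scalar_commute)
    then have "c \<noteq> 0" using that(1) by auto
    then have "?Mc *v v = inverse c *s v"
      by (metis v left_inverse vector_smult_assoc vector_smult_lid)
    then have "1 < cmod (inverse c)" using M that(1) unfolding dilation_matrix_def by blast
    then show ?thesis using \<open>c \<noteq> 0\<close> by (simp add: norm_inverse one_less_inverse_iff)
  qed
  have pow: "((\<lambda>w. Rc *v w) ^^ p) (axis j 1) = (\<chi> i. complex_of_real (mat_power R p $ i $ j))" for p
  proof (induction p)
    case (Suc p)
    then show ?case
      by (simp add: mat_power_Suc Rc_def matrix_vector_mult_def matrix_matrix_mult_def map_matrix_def vec_eq_iff)
  qed (simp add: axis_def mat_def vec_eq_iff)
  have "(\<lambda>p. complex_of_real (mat_power R p $ i $ j)) \<longlonglongrightarrow> 0"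
    using matrix_powers_tendsto_0[of Rc "axis j 1" i] eig by (simp add: pow)
  then show ?thesis using tendsto_of_real_iff[of _ 0] unfolding R_def by (metis of_real_0)
qed

section \<open>Jets under composition with a small matrix\<close>

text \<open>Smoothness of the iterated derivatives is carried along in the induction, because the
  next differentiation of the sum relies on it.\<close>

lemma germ_partial_derivs_linear_combination:
  assumes "\<And>j. j \<in> J \<Longrightarrow> smooth_near (f j)"
  shows "germ_eq (partial_derivs is (\<lambda>x. \<Sum>j\<in>J. c j * f j x)) (\<lambda>x. \<Sum>j\<in>J. c j * partial_derivs is (f j) x)
    \<and> (\<forall>j\<in>J. smooth_near (partial_derivs is (f j)))"
proof (induction "is")
  case (Cons i "is")
  have "germ_eq (partial_deriv i (\<lambda>x. c j * partial_derivs is (f j) x))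
      (\<lambda>x. c j * partial_derivs (i # is) (f j) x)" if "j \<in> J" for j
  proof -
    have "germ_eq (partial_deriv i (\<lambda>x. c j * partial_derivs is (f j) x))
      (\<lambda>x. partial_deriv i (\<lambda>_. c j) x * partial_derivs is (f j) x + c j * partial_derivs (i # is) (f j) x)"
      unfolding partial_derivs.simps using Cons that by (intro germ_partial_deriv_mult) auto
    then show ?thesis by eventually_elim (simp add: partial_deriv_const)
  qed
  then have A: "eventually (\<lambda>x. \<forall>j\<in>J. partial_deriv i (\<lambda>x. c j * partial_derivs is (f j) x) x
      = c j * partial_derivs (i # is) (f j) x) (nhds 0)" if "finite J"
    using that by (intro eventually_ball_finite) auto
  have B: "germ_eq (partial_deriv i (\<lambda>x. \<Sum>j\<in>J. c j * partial_derivs is (f j) x))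
      (\<lambda>x. \<Sum>j\<in>J. partial_deriv i (\<lambda>x. c j * partial_derivs is (f j) x) x)"
    using Cons by (intro germ_partial_deriv_sum) auto
  have C: "germ_eq (partial_derivs (i # is) (\<lambda>x. \<Sum>j\<in>J. c j * f j x))
     (partial_deriv i (\<lambda>x. \<Sum>j\<in>J. c j * partial_derivs is (f j) x))"
    unfolding partial_derivs.simps using Cons by (intro germ_eq_partial_deriv) auto
  show ?case
  proof (cases "finite J")
    case True
    have "germ_eq (partial_derivs (i # is) (\<lambda>x. \<Sum>j\<in>J. c j * f j x))
        (\<lambda>x. \<Sum>j\<in>J. c j * partial_derivs (i # is) (f j) x)"
      using A[OF True] B C by eventually_elim (simp del: partial_derivs.simps)
    then show ?thesis using Cons by auto
  next
    case False
    then show ?thesis using C Cons by (auto simp: partial_deriv_const)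
  qed
qed (use assms in auto)

text \<open>By the chain rule, each differentiation yields a sum of \<open>CARD('d)\<close>
  derivatives of \<open>g\<close> of the same order, weighted by entries of \<open>L\<close>, and so
  contributes one factor \<open>CARD('d) * \<epsilon>\<close>. The bound \<open>C\<close> must cover
  all lists of the given length, since the directions get mixed.\<close>

lemma partial_derivs_compose_matrix_bound:
  fixes L :: "real^'d::finite^'d"
  assumes "smooth_near g" "\<And>i j. \<bar>L $ i $ j\<bar> \<le> \<epsilon>"
    and "\<And>js. length js = length is \<Longrightarrow> cmod (partial_derivs js g 0) \<le> C"
  shows "cmod (partial_derivs is (\<lambda>x. g (L *v x)) 0) \<le> (of_nat CARD('d) * \<epsilon>) ^ length is * C"
  using assms(1,3)
proof (induction "is" arbitrary: g rule: rev_induct)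
  case Nil
  then show ?case using Nil(2)[of "[]"] by simp
next
  case (snoc i "is")
  let ?B = "(of_nat CARD('d) * \<epsilon>) ^ length is * C"
  have each: "cmod (partial_derivs is (\<lambda>x. partial_deriv j g (L *v x)) 0) \<le> ?B" for j
  proof (rule snoc.IH)
    show "smooth_near (partial_deriv j g)" using snoc.prems(1) by auto
    fix js :: "'d list" assume "length js = length is"
    then show "cmod (partial_derivs js (partial_deriv j g) 0) \<le> C"
      using snoc.prems(2)[of "js @ [j]"] by (simp add: partial_derivs_snoc)
  qed
  have "partial_derivs (is @ [i]) (\<lambda>x. g (L *v x)) 0
      = partial_derivs is (\<lambda>x. \<Sum>j\<in>UNIV. of_real (L $ j $ i) * partial_deriv j g (L *v x)) 0"
    unfolding partial_derivs_snoc
    using eq_upto_germ[OF germ_partial_deriv_compose_matrix[OF snoc.prems(1), of i L]]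
    unfolding eq_upto_def by blast
  also have "\<dots> = (\<Sum>j\<in>UNIV. of_real (L $ j $ i) * partial_derivs is (\<lambda>x. partial_deriv j g (L *v x)) 0)"
    using germ_partial_derivs_linear_combination[of UNIV "\<lambda>j x. partial_deriv j g (L *v x)" "is"
        "\<lambda>j. of_real (L $ j $ i)"] snoc.prems(1)
    by (auto intro!: smooth_near_compose_matrix dest!: eventually_nhds_x_imp_x)
  finally have "cmod (partial_derivs (is @ [i]) (\<lambda>x. g (L *v x)) 0)
      \<le> (\<Sum>j\<in>UNIV. \<bar>L $ j $ i\<bar> * cmod (partial_derivs is (\<lambda>x. partial_deriv j g (L *v x)) 0))"
    by (simp add: norm_mult sum_norm_le)
  also have "\<dots> \<le> (\<Sum>j\<in>(UNIV :: 'd set). \<epsilon> * ?B)"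
    using assms(2) each by (intro sum_mono mult_mono) (auto intro: order_trans[OF abs_ge_zero])
  also have "\<dots> = (of_nat CARD('d) * \<epsilon>) ^ length (is @ [i]) * C" by simp
  finally show ?case .
qed

lemma partial_derivs_const: "partial_derivs is (\<lambda>x. c) = (\<lambda>x. if is = [] then c else 0)"
proof (induction "is")
  case (Cons i "is")
  then show ?case by (simp only: partial_derivs.simps) (simp add: partial_deriv_const)
qed simp

text \<open>A derivative of \<open>g\<close> at the origin of order \<open>k \<ge> 1\<close> equals
  the corresponding derivative of \<open>g\<close> composed with any power of \<open>B\<close>,
  which is bounded by a constant times the \<open>k\<close>-th power of a sequence tending to 0. So
  only the value of \<open>g\<close> survives in the jet.\<close>

lemma dilation_invariant_jet:
  fixes M :: "int^'d::finite^'d"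
  assumes M: "dilation_matrix M" and inv: "jeq m (\<lambda>\<xi>. g (transpose_real M *v \<xi>)) g"
  shows "jeq m g (\<lambda>\<xi>. g 0)"
proof -
  let ?M = "map_matrix real_of_int M"
  define R where "R = matrix_inv ?M"
  define B where "B = transpose R"
  have sm: "smooth_near g" using inv by (rule jeq_smooth)
  have "R ** ?M = mat 1"
    using matrix_inv_cancel[OF invertible_dilation_matrix[OF M]] by (simp add: R_def)
  then have TB: "transpose_real M ** B = mat 1"
    unfolding B_def transpose_real_def by (metis matrix_transpose_mul transpose_mat)
  have inv1: "jeq m (\<lambda>\<xi>. g (B *v \<xi>)) g"
  proof (rule jeq_sym)
    show "jeq m g (\<lambda>\<xi>. g (B *v \<xi>))"
      using jeq_compose_matrix[OF inv, of B] by (simp add: matrix_vector_mul_assoc TB)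
  qed
  have invp: "jeq m (\<lambda>\<xi>. g (mat_power B p *v \<xi>)) g" for p
  proof (induction p)
    case 0
    then show ?case using sm by (simp add: jeq_refl)
  next
    case (Suc p)
    have "jeq m (\<lambda>\<xi>. g (mat_power B (Suc p) *v \<xi>)) (\<lambda>\<xi>. g (B *v \<xi>))"
      using jeq_compose_matrix[OF Suc.IH, of B] by (simp add: matrix_vector_mul_assoc mat_power_Suc2)
    then show ?case using inv1 by (rule jeq_trans)
  qed
  have lim: "(\<lambda>p. mat_power B p $ i $ j) \<longlonglongrightarrow> 0" for i j
  proof -
    have "mat_power B p $ i $ j = mat_power R p $ j $ i" for p
    proof -
      have "mat_power B p = transpose (mat_power R p)" by (simp add: B_def transpose_mat_power)
      then show ?thesis by (simp add: transpose_def)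
    qed
    then show ?thesis using inverse_dilation_powers[OF M, of j i] unfolding R_def by simp
  qed
  define \<epsilon> where "\<epsilon> p = (\<Sum>i\<in>UNIV. \<Sum>j\<in>UNIV. \<bar>mat_power B p $ i $ j\<bar>)" for p
  have le: "\<bar>mat_power B p $ i $ j\<bar> \<le> \<epsilon> p" for p i j
  proof -
    have "\<bar>mat_power B p $ i $ j\<bar> \<le> (\<Sum>j\<in>UNIV. \<bar>mat_power B p $ i $ j\<bar>)"
      by (rule member_le_sum) auto
    also have "\<dots> \<le> \<epsilon> p" unfolding \<epsilon>_def
      by (rule member_le_sum[where f="\<lambda>i. \<Sum>j\<in>UNIV. \<bar>mat_power B p $ i $ j\<bar>"]) (auto intro: sum_nonneg)
    finally show ?thesis .
  qed
  have "\<epsilon> \<longlonglongrightarrow> (\<Sum>i\<in>(UNIV :: 'd set). \<Sum>j\<in>(UNIV :: 'd set). \<bar>0\<bar>)"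
    unfolding \<epsilon>_def[abs_def] by (intro tendsto_sum tendsto_rabs lim)
  then have e0: "\<epsilon> \<longlonglongrightarrow> 0" by simp
  have zero: "partial_derivs is g 0 = 0" if "is \<noteq> []" "length is < m" for "is"
  proof -
    \<comment> \<open>There are finitely many lists of this length. The constant does not depend on
      the power \<open>p\<close>, so the limit can be taken.\<close>
    define C where "C = Max ((\<lambda>js. cmod (partial_derivs js g 0)) ` {js. length js = length is})"
    have fin: "finite {js :: 'd list. length js = length is}"
      using finite_lists_length_eq[of "UNIV :: 'd set" "length is"] by simp
    have C: "cmod (partial_derivs js g 0) \<le> C" if "length js = length is" for js
      unfolding C_def using fin that by (intro Max_ge) auto
    have "cmod (partial_derivs is g 0) \<le> (of_nat CARD('d) * \<epsilon> p) ^ length is * C" for p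
    proof -
      have "partial_derivs is (\<lambda>\<xi>. g (mat_power B p *v \<xi>)) 0 = partial_derivs is g 0"
        using invp[of p] that unfolding jeq_def eq_upto_def by blast
      then show ?thesis using partial_derivs_compose_matrix_bound[OF sm le C, of "is" p] by simp
    qed
    moreover have "(\<lambda>p. (of_nat CARD('d) * \<epsilon> p) ^ length is * C) \<longlonglongrightarrow> (of_nat CARD('d) * 0) ^ length is * C"
      by (intro tendsto_mult tendsto_power tendsto_const e0)
    ultimately have "cmod (partial_derivs is g 0) \<le> (of_nat CARD('d) * 0) ^ length is * C"
      by (intro LIMSEQ_le_const) auto
    then show ?thesis using that by (simp add: power_0_left)
  qed
  show ?thesis
    unfolding jeq_def eq_upto_def using sm zero
    by (auto simp: partial_derivs_const)
qed


section \<open>Strongly invertible matrices with prescribed jets\<close>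

text \<open>The inverse is carried along explicitly, so that it stays visible as a product when
  matrices are multiplied; \<open>inverse_pair_matrix_inv\<close> identifies it with
  \<open>matrix_inv\<close>.\<close>

definition inverse_pair ::
    "(real^'d::finite \<Rightarrow> complex^'r::finite^'r) \<Rightarrow> (real^'d \<Rightarrow> complex^'r^'r) \<Rightarrow> bool" where
  "inverse_pair U V \<longleftrightarrow> (\<forall>i j. trig_poly (\<lambda>\<xi>. U \<xi> $ i $ j)) \<and> (\<forall>i j. trig_poly (\<lambda>\<xi>. V \<xi> $ i $ j)) \<and>
     (\<forall>\<xi>. U \<xi> ** V \<xi> = mat 1 \<and> V \<xi> ** U \<xi> = mat 1)"

lemma trig_poly_matrix_iff: "trig_poly_matrix F \<longleftrightarrow> (\<forall>i j. trig_poly (\<lambda>\<xi>. F \<xi> $ i $ j))"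
proof
  assume "trig_poly_matrix F"
  then obtain u where u: "finitely_supported u" "F = matrix_filter_fourier u"
    by (auto simp: trig_poly_matrix_def)
  have "finitely_supported (\<lambda>k. u k $ i $ j)" for i j
    using u(1) unfolding finitely_supported_def by (rule rev_finite_subset) auto
  then show "\<forall>i j. trig_poly (\<lambda>\<xi>. F \<xi> $ i $ j)"
    by (auto simp: u(2) matrix_filter_fourier_def)
next
  assume "\<forall>i j. trig_poly (\<lambda>\<xi>. F \<xi> $ i $ j)"
  then have "\<exists>u. finitely_supported u \<and> (\<lambda>\<xi>. F \<xi> $ i $ j) = filter_fourier u" for i j
    by (auto simp: trig_poly_def)
  then obtain u where u: "\<And>i j. finitely_supported (u i j)" "\<And>i j. (\<lambda>\<xi>. F \<xi> $ i $ j) = filter_fourier (u i j)"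
    by metis
  let ?u = "\<lambda>k. \<chi> i j. u i j k"
  have "{k. ?u k \<noteq> 0} \<subseteq> (\<Union>i. \<Union>j. {k. u i j k \<noteq> 0})" by (auto simp: vec_eq_iff)
  then have "finitely_supported ?u"
    using u(1) unfolding finitely_supported_def by (elim finite_subset) auto
  moreover have "F \<xi> = matrix_filter_fourier ?u \<xi>" for \<xi>
    using fun_cong[OF u(2)] by (simp add: matrix_filter_fourier_def vec_eq_iff)
  ultimately show "trig_poly_matrix F" unfolding trig_poly_matrix_def by blast
qed

lemma matrix_inv_unique:
  fixes A :: "'a::field^'r::finite^'r"
  assumes "A ** B = mat 1" "B ** A = mat 1" shows "matrix_inv A = B"
proof -
  have "invertible A" using assms unfolding invertible_def by blast
  then have "matrix_inv A ** A = mat 1" by (rule matrix_inv_cancel)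
  then show ?thesis using assms(1) by (metis matrix_mul_assoc matrix_mul_lid matrix_mul_rid)
qed

lemma inverse_pair_matrix_inv: "inverse_pair U V \<Longrightarrow> matrix_inv (U \<xi>) = V \<xi>"
  unfolding inverse_pair_def using matrix_inv_unique by blast

lemma strongly_invertible_iff: "strongly_invertible U \<longleftrightarrow> inverse_pair U (\<lambda>\<xi>. matrix_inv (U \<xi>))"
proof -
  have "invertible (U \<xi>) \<longleftrightarrow> U \<xi> ** matrix_inv (U \<xi>) = mat 1 \<and> matrix_inv (U \<xi>) ** U \<xi> = mat 1" for \<xi>
    using matrix_inv_cancel[of "U \<xi>"] by (auto simp: invertible_def)
  then show ?thesis
    unfolding strongly_invertible_def inverse_pair_def trig_poly_matrix_iff by auto
qed

lemma trig_poly_matrix_mult: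
  assumes "\<And>i j. trig_poly (\<lambda>\<xi>. A \<xi> $ i $ j)" "\<And>i j. trig_poly (\<lambda>\<xi>. B \<xi> $ i $ j)"
  shows "trig_poly (\<lambda>\<xi>. (A \<xi> ** B \<xi>) $ i $ j)"
  using assms by (auto simp: matrix_matrix_mult_def)

lemma inverse_pair_strongly_invertible:
  assumes "inverse_pair U V" shows "strongly_invertible U"
  using assms by (simp add: strongly_invertible_iff inverse_pair_matrix_inv[OF assms])

lemma inverse_pair_mult:
  assumes "inverse_pair U V" "inverse_pair U' V'"
  shows "inverse_pair (\<lambda>\<xi>. U' \<xi> ** U \<xi>) (\<lambda>\<xi>. V \<xi> ** V' \<xi>)"
proof -
  have "(U' \<xi> ** U \<xi>) ** (V \<xi> ** V' \<xi>) = U' \<xi> ** (U \<xi> ** V \<xi>) ** V' \<xi>"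
    "(V \<xi> ** V' \<xi>) ** (U' \<xi> ** U \<xi>) = V \<xi> ** (V' \<xi> ** U' \<xi>) ** U \<xi>" for \<xi>
    by (simp_all add: matrix_mul_assoc)
  then show ?thesis
    using assms unfolding inverse_pair_def by (auto intro!: trig_poly_matrix_mult)
qed

section \<open>Transvections acting on a column and a row\<close>

definition transvection ::
    "('r::finite \<Rightarrow> real^'d::finite \<Rightarrow> complex) \<Rightarrow> ('r \<Rightarrow> real^'d \<Rightarrow> complex) \<Rightarrow> real^'d \<Rightarrow> complex^'r^'r" where
  "transvection c w \<xi> = (\<chi> i j. of_bool (i = j) + c i \<xi> * w j \<xi>)"

lemma sum_of_bool_eq_mult [simp]:
  fixes f :: "'r::finite \<Rightarrow> complex"
  shows "(\<Sum>k\<in>UNIV. of_bool (k = j) * f k) = f j" "(\<Sum>k\<in>UNIV. of_bool (j = k) * f k) = f j"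
    "(\<Sum>k\<in>UNIV. f k * of_bool (k = j)) = f j" "(\<Sum>k\<in>UNIV. f k * of_bool (j = k)) = f j"
  by (simp_all add: of_bool_def if_distrib if_distribR cong: if_cong)

text \<open>\<open>(I + c w^T) (I - c w^T) = I - c (w^T c) w^T\<close>, and the inner factor
  vanishes. The condition is unaffected by a sign change of \<open>c\<close>, which gives the
  product in the other order.\<close>

lemma inverse_pair_transvection:
  fixes c w :: "'r::finite \<Rightarrow> real^'d::finite \<Rightarrow> complex"
  assumes "\<And>i. trig_poly (c i)" "\<And>i. trig_poly (w i)" "\<And>\<xi>. (\<Sum>k\<in>UNIV. w k \<xi> * c k \<xi>) = 0"
  shows "inverse_pair (transvection c w) (transvection (\<lambda>i \<xi>. - c i \<xi>) w)"
proof -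
  have mult: "transvection c w \<xi> ** transvection (\<lambda>i \<xi>. - c i \<xi>) w \<xi> = mat 1"
    if "\<And>\<xi>. (\<Sum>k\<in>UNIV. w k \<xi> * c k \<xi>) = 0" for c w :: "'r \<Rightarrow> real^'d \<Rightarrow> complex" and \<xi>
  proof -
    have "(\<Sum>k\<in>UNIV. (of_bool (i = k) + c i \<xi> * w k \<xi>) * (of_bool (k = j) + - c k \<xi> * w j \<xi>))
        = (\<Sum>k\<in>UNIV. of_bool (i = k) * (of_bool (k = j) + - c k \<xi> * w j \<xi>)
            + (c i \<xi> * w k \<xi>) * of_bool (k = j) - (c i \<xi> * w j \<xi>) * (w k \<xi> * c k \<xi>))" for i j
      by (simp add: algebra_simps)
    also have "\<dots> i j = of_bool (i = j) - (c i \<xi> * w j \<xi>) * (\<Sum>k\<in>UNIV. w k \<xi> * c k \<xi>)" for i j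
      by (simp add: sum.distrib sum_subtractf sum_distrib_left)
    finally show ?thesis
      using that by (simp add: transvection_def matrix_matrix_mult_def mat_def vec_eq_iff)
  qed
  have "transvection (\<lambda>i \<xi>. - c i \<xi>) w \<xi> ** transvection c w \<xi> = mat 1" for \<xi>
    using mult[of w "\<lambda>i \<xi>. - c i \<xi>" \<xi>] assms(3) by (simp add: sum_negf)
  then show ?thesis
    using mult[OF assms(3)] assms(1,2) unfolding inverse_pair_def
    by (auto simp: transvection_def)
qed

text \<open>\<open>U\<close> acts on the column \<open>x\<close> from the left and its inverse
  \<open>V\<close> on the row \<open>y\<close> from the right. The results matter only as jets of
  order \<open>N\<close>, so between steps they can be replaced by simpler representatives,
  constants for instance.\<close>

definition moves :: "nat \<Rightarrow> (real^'d::finite \<Rightarrow> complex^'r::finite^'r) \<Rightarrow> (real^'d \<Rightarrow> complex^'r^'r) \<Rightarrow>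
    ('r \<Rightarrow> real^'d \<Rightarrow> complex) \<Rightarrow> ('r \<Rightarrow> real^'d \<Rightarrow> complex) \<Rightarrow>
    ('r \<Rightarrow> real^'d \<Rightarrow> complex) \<Rightarrow> ('r \<Rightarrow> real^'d \<Rightarrow> complex) \<Rightarrow> bool" where
  "moves N U V x y x' y' \<longleftrightarrow> inverse_pair U V \<and>
     (\<forall>i. smooth_near (x i)) \<and> (\<forall>i. smooth_near (y i)) \<and>
     (\<forall>i. jeq N (\<lambda>\<xi>. \<Sum>k\<in>UNIV. U \<xi> $ i $ k * x k \<xi>) (x' i)) \<and>
     (\<forall>j. jeq N (\<lambda>\<xi>. \<Sum>k\<in>UNIV. y k \<xi> * V \<xi> $ k $ j) (y' j))"

lemma inverse_pair_smooth:
  assumes "inverse_pair U V"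
  shows "smooth_near (\<lambda>\<xi>. U \<xi> $ i $ j)" "smooth_near (\<lambda>\<xi>. V \<xi> $ i $ j)"
  using assms unfolding inverse_pair_def by (auto intro: smooth_near_trig_poly)

lemma moves_trans:
  assumes "moves N U V x y x' y'" "moves N U' V' x' y' x'' y''"
  shows "moves N (\<lambda>\<xi>. U' \<xi> ** U \<xi>) (\<lambda>\<xi>. V \<xi> ** V' \<xi>) x y x'' y''"
proof -
  have ip: "inverse_pair U V" "inverse_pair U' V'" using assms unfolding moves_def by auto
  have "jeq N (\<lambda>\<xi>. \<Sum>k\<in>UNIV. (U' \<xi> ** U \<xi>) $ i $ k * x k \<xi>) (x'' i)" for i
  proof -
    have "(\<Sum>k\<in>UNIV. (U' \<xi> ** U \<xi>) $ i $ k * x k \<xi>)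
        = (\<Sum>l\<in>UNIV. U' \<xi> $ i $ l * (\<Sum>k\<in>UNIV. U \<xi> $ l $ k * x k \<xi>))" for \<xi>
      unfolding matrix_matrix_mult_def
      by (simp add: sum_distrib_left sum_distrib_right mult.assoc) (rule sum.swap)
    moreover have "jeq N (\<lambda>\<xi>. \<Sum>l\<in>UNIV. U' \<xi> $ i $ l * (\<Sum>k\<in>UNIV. U \<xi> $ l $ k * x k \<xi>))
        (\<lambda>\<xi>. \<Sum>l\<in>UNIV. U' \<xi> $ i $ l * x' l \<xi>)"
      using assms(1) by (intro jeq_sum jeq_mult jeq_refl inverse_pair_smooth[OF ip(2)]) (auto simp: moves_def)
    moreover have "jeq N (\<lambda>\<xi>. \<Sum>l\<in>UNIV. U' \<xi> $ i $ l * x' l \<xi>) (x'' i)"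
      using assms(2) by (auto simp: moves_def)
    ultimately show ?thesis by (simp add: jeq_trans)
  qed
  moreover have "jeq N (\<lambda>\<xi>. \<Sum>k\<in>UNIV. y k \<xi> * (V \<xi> ** V' \<xi>) $ k $ j) (y'' j)" for j
  proof -
    have "(\<Sum>k\<in>UNIV. y k \<xi> * (V \<xi> ** V' \<xi>) $ k $ j)
        = (\<Sum>l\<in>UNIV. (\<Sum>k\<in>UNIV. y k \<xi> * V \<xi> $ k $ l) * V' \<xi> $ l $ j)" for \<xi>
      unfolding matrix_matrix_mult_def
      by (simp add: sum_distrib_left sum_distrib_right mult.assoc) (rule sum.swap)
    moreover have "jeq N (\<lambda>\<xi>. \<Sum>l\<in>UNIV. (\<Sum>k\<in>UNIV. y k \<xi> * V \<xi> $ k $ l) * V' \<xi> $ l $ j)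
        (\<lambda>\<xi>. \<Sum>l\<in>UNIV. y' l \<xi> * V' \<xi> $ l $ j)"
      using assms(1) by (intro jeq_sum jeq_mult jeq_refl inverse_pair_smooth[OF ip(2)]) (auto simp: moves_def)
    moreover have "jeq N (\<lambda>\<xi>. \<Sum>l\<in>UNIV. y' l \<xi> * V' \<xi> $ l $ j) (y'' j)"
      using assms(2) by (auto simp: moves_def)
    ultimately show ?thesis by (simp add: jeq_trans)
  qed
  ultimately show ?thesis
    using assms inverse_pair_mult[OF ip] unfolding moves_def by auto
qed

lemma moves_transvection:
  assumes "\<And>i. smooth_near (x i)" "\<And>i. smooth_near (y i)"
    and "\<And>i. trig_poly (c i)" "\<And>i. trig_poly (w i)" "\<And>\<xi>. (\<Sum>k\<in>UNIV. w k \<xi> * c k \<xi>) = 0"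
    and "\<And>i. jeq N (\<lambda>\<xi>. x i \<xi> + c i \<xi> * (\<Sum>k\<in>UNIV. w k \<xi> * x k \<xi>)) (x' i)"
    and "\<And>j. jeq N (\<lambda>\<xi>. y j \<xi> - (\<Sum>k\<in>UNIV. y k \<xi> * c k \<xi>) * w j \<xi>) (y' j)"
  shows "moves N (transvection c w) (transvection (\<lambda>i \<xi>. - c i \<xi>) w) x y x' y'"
proof -
  have "(\<Sum>k\<in>UNIV. transvection c w \<xi> $ i $ k * x k \<xi>) = x i \<xi> + c i \<xi> * (\<Sum>k\<in>UNIV. w k \<xi> * x k \<xi>)" for i \<xi>
    by (simp add: transvection_def distrib_right sum.distrib sum_distrib_left mult.assoc)
  moreover have "(\<Sum>k\<in>UNIV. y k \<xi> * transvection (\<lambda>i \<xi>. - c i \<xi>) w \<xi> $ k $ j)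
      = y j \<xi> - (\<Sum>k\<in>UNIV. y k \<xi> * c k \<xi>) * w j \<xi>" for j \<xi>
    by (simp add: transvection_def distrib_left right_diff_distrib sum.distrib sum_subtractf sum_distrib_right mult.assoc)
  ultimately show ?thesis
    using assms inverse_pair_transvection[OF assms(3-5)] unfolding moves_def by simp
qed

text \<open>\<open>V\<close> and \<open>U\<close> cancel inside the pairing. Once the column has
  become a unit column, this determines the corresponding entry of the row.\<close>

lemma moves_pairing:
  assumes "moves N U V x y x' y'"
  shows "jeq N (\<lambda>\<xi>. \<Sum>k\<in>UNIV. y' k \<xi> * x' k \<xi>) (\<lambda>\<xi>. \<Sum>k\<in>UNIV. y k \<xi> * x k \<xi>)"
proof -
  have ip: "inverse_pair U V" using assms unfolding moves_def by auto
  have "(\<Sum>l\<in>UNIV. (\<Sum>k\<in>UNIV. y k \<xi> * V \<xi> $ k $ l) * (\<Sum>k\<in>UNIV. U \<xi> $ l $ k * x k \<xi>))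
      = (\<Sum>k\<in>UNIV. y k \<xi> * x k \<xi>)" for \<xi>
  proof -
    define yv xv where "yv = (\<chi> k. y k \<xi>)" and "xv = (\<chi> k. x k \<xi>)"
    have "(yv v* V \<xi>) v* U \<xi> = yv"
      using ip by (simp add: inverse_pair_def vector_matrix_mul_assoc)
    have "(\<Sum>l\<in>UNIV. (\<Sum>k\<in>UNIV. y k \<xi> * V \<xi> $ k $ l) * (\<Sum>k\<in>UNIV. U \<xi> $ l $ k * x k \<xi>))
      = (\<Sum>l\<in>UNIV. (yv v* V \<xi>) $ l * (\<Sum>k\<in>UNIV. U \<xi> $ l $ k * x k \<xi>))"
      by (simp add: vector_matrix_mult_def yv_def mult.commute)
    also have "\<dots> = (\<Sum>k\<in>UNIV. ((yv v* V \<xi>) v* U \<xi>) $ k * x k \<xi>)"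
      by (simp add: vector_matrix_mult_def[of "yv v* V \<xi>"] sum_distrib_left sum_distrib_right mult_ac)
        (rule sum.swap)
    also have "\<dots> = (\<Sum>k\<in>UNIV. y k \<xi> * x k \<xi>)"
      using \<open>(yv v* V \<xi>) v* U \<xi> = yv\<close> by (simp add: yv_def)
    finally show ?thesis .
  qed
  moreover have "jeq N (\<lambda>\<xi>. \<Sum>l\<in>UNIV. (\<Sum>k\<in>UNIV. y k \<xi> * V \<xi> $ k $ l) * (\<Sum>k\<in>UNIV. U \<xi> $ l $ k * x k \<xi>))
      (\<lambda>\<xi>. \<Sum>k\<in>UNIV. y' k \<xi> * x' k \<xi>)"
    using assms unfolding moves_def by (intro jeq_sum jeq_mult) auto
  ultimately show ?thesis by (simp add: jeq_sym)
qed

lemma moves_smooth: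
  assumes "moves N U V x y x' y'" shows "smooth_near (x' i)" "smooth_near (y' i)"
  using assms jeq_smooth(2) unfolding moves_def by blast+

abbreviation unit_col :: "'r \<Rightarrow> 'r \<Rightarrow> real^'d::finite \<Rightarrow> complex" where
  "unit_col e \<equiv> \<lambda>i _. of_bool (i = e)"

text \<open>The entry \<open>e\<close> of the column cannot be scaled to 1, but a multiple of
  another entry that does not vanish at the origin can be added to it. An entry equal to 1 then
  clears the rest of the column. The pairing makes the entry \<open>e\<close> of the row equal to 1
  as well, and clearing the rest of the row leaves the unit column fixed.\<close>

lemma moves_to_unit:
  fixes x y :: "'r::finite \<Rightarrow> real^'d::finite \<Rightarrow> complex" and e :: 'r
  assumes r: "2 \<le> CARD('r)" and sm: "\<And>i. smooth_near (x i)" "\<And>i. smooth_near (y i)"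
    and yx: "jeq N (\<lambda>\<xi>. \<Sum>k\<in>UNIV. y k \<xi> * x k \<xi>) (\<lambda>_. 1)" and N: "1 \<le> N"
  obtains U V where "moves N U V x y (unit_col e) (unit_col e)"
proof -
  have "\<exists>U V x' y' j. moves N U V x y x' y' \<and> j \<noteq> e \<and> x' j 0 \<noteq> 0"
  proof (cases "\<exists>j. j \<noteq> e \<and> x j 0 \<noteq> 0")
    case True
    \<comment> \<open>The identity matrix, in the form of a transvection.\<close>
    have "moves N (transvection (\<lambda>_ _. 0) (\<lambda>_ _. 0)) (transvection (\<lambda>_ _. - 0) (\<lambda>_ _. 0)) x y x y"
      using sm by (intro moves_transvection) (auto simp: jeq_refl)
    then show ?thesis using True by blast
  next
    case False
    have "(\<Sum>k\<in>UNIV. y k 0 * x k 0) = 1" using jeq_at_0[OF yx] N by simp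
    then have "(\<Sum>k\<in>UNIV. y k 0 * x k 0) \<noteq> 0" by simp
    then obtain k where "y k 0 * x k 0 \<noteq> 0" by (rule sum.not_neutral_contains_not_neutral)
    then have "x k 0 \<noteq> 0" by simp
    then have xe: "x e 0 \<noteq> 0" using False by auto
    have "card (UNIV - {e}) \<noteq> 0" using r by (simp add: card_Diff_singleton)
    then have "UNIV - {e} \<noteq> {}" by (metis card.empty)
    then obtain j where j: "j \<noteq> e" by blast
    \<comment> \<open>The pairing is nonzero at the origin, so the only entry left to be nonzero
      there is the entry \<open>e\<close>; it is added to the entry \<open>j\<close>.\<close>
    let ?x = "\<lambda>i \<xi>. x i \<xi> + unit_col j i \<xi> * (\<Sum>k\<in>UNIV. unit_col e k \<xi> * x k \<xi>)"
    let ?y = "\<lambda>i \<xi>. y i \<xi> - (\<Sum>k\<in>UNIV. y k \<xi> * unit_col j k \<xi>) * unit_col e i \<xi>"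
    have "moves N (transvection (unit_col j) (unit_col e)) (transvection (\<lambda>i \<xi>. - unit_col j i \<xi>) (unit_col e)) x y ?x ?y"
      using sm j by (intro moves_transvection) (auto intro!: jeq_refl smooth_near_sum smooth_near_diff smooth_near_add)
    moreover have "x j 0 = 0" using False j by blast
    then have "?x j 0 \<noteq> 0" using xe by simp
    ultimately show ?thesis using j by blast
  qed
  then obtain U1 V1 x1 y1 j where 1: "moves N U1 V1 x y x1 y1" "j \<noteq> e" "x1 j 0 \<noteq> 0" by blast
  note sm1 = moves_smooth[OF 1(1)]
  \<comment> \<open>The multiple of entry \<open>j\<close> that raises entry \<open>e\<close> to 1.
    It is not a trigonometric polynomial, but a polynomial with the same jet serves.\<close>
  let ?f = "\<lambda>\<xi>. (1 - x1 e \<xi>) * inverse (x1 j \<xi>)"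
  have "smooth_near ?f" using sm1 1(3) by (intro smooth_near_mult smooth_near_diff smooth_near_inverse) auto
  then obtain p where p: "trig_poly p" "jeq N p ?f" by (rule jet_trig_poly)
  define c where "c i \<xi> = (if i = e then p \<xi> else 0)" for i \<xi>
  have c: "trig_poly (c i)" for i using p by (cases "i = e") (auto simp: c_def[abs_def])
  define x2 where "x2 i = (if i = e then (\<lambda>_. 1) else x1 i)" for i
  define y2 where "y2 i \<xi> = y1 i \<xi> - (\<Sum>k\<in>UNIV. y1 k \<xi> * c k \<xi>) * unit_col j i \<xi>" for i \<xi>
  have 2: "moves N (transvection c (unit_col j)) (transvection (\<lambda>i \<xi>. - c i \<xi>) (unit_col j)) x1 y1 x2 y2"
  proof (rule moves_transvection[OF sm1 c])
    show "jeq N (\<lambda>\<xi>. y1 i \<xi> - (\<Sum>k\<in>UNIV. y1 k \<xi> * c k \<xi>) * unit_col j i \<xi>) (y2 i)" for i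
      unfolding y2_def[abs_def] using sm1 c
      by (intro jeq_refl smooth_near_diff smooth_near_mult smooth_near_sum) auto
    show "jeq N (\<lambda>\<xi>. x1 i \<xi> + c i \<xi> * (\<Sum>k\<in>UNIV. unit_col j k \<xi> * x1 k \<xi>)) (x2 i)" for i
    proof (cases "i = e")
      case True
      have "jeq N (\<lambda>\<xi>. x1 e \<xi> + p \<xi> * x1 j \<xi>) (\<lambda>\<xi>. x1 e \<xi> + ?f \<xi> * x1 j \<xi>)"
        using sm1 p by (intro jeq_add jeq_mult jeq_refl)
      also have "(\<lambda>\<xi>. x1 e \<xi> + ?f \<xi> * x1 j \<xi>) = (\<lambda>\<xi>. x1 e \<xi> + (1 - x1 e \<xi>) * (inverse (x1 j \<xi>) * x1 j \<xi>))"
        by (simp add: mult.assoc)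
      also have "jeq N \<dots> (\<lambda>\<xi>. x1 e \<xi> + (1 - x1 e \<xi>) * 1)"
        using sm1 1(3) by (intro jeq_add jeq_mult jeq_refl jeq_inverse_mult) auto
      finally show ?thesis using True by (simp add: c_def x2_def)
    next
      case False
      then show ?thesis using sm1 by (simp add: jeq_refl c_def x2_def)
    qed
  qed (use 1(2) in \<open>auto simp: c_def\<close>)
  note sm2 = moves_smooth[OF 2]
  have "\<exists>q. trig_poly q \<and> jeq N q (\<lambda>\<xi>. - x2 i \<xi>)" for i
    using jet_trig_poly[OF smooth_near_uminus[OF sm2(1)[of i]]] by metis
  then obtain q where q: "\<And>i. trig_poly (q i)" "\<And>i. jeq N (q i) (\<lambda>\<xi>. - x2 i \<xi>)" by metis
  define d where "d i \<xi> = (if i = e then 0 else q i \<xi>)" for i \<xi>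
  have d: "trig_poly (d i)" for i using q by (cases "i = e") (auto simp: d_def[abs_def])
  define y3 where "y3 i \<xi> = y2 i \<xi> - (\<Sum>k\<in>UNIV. y2 k \<xi> * d k \<xi>) * unit_col e i \<xi>" for i \<xi>
  have 3: "moves N (transvection d (unit_col e)) (transvection (\<lambda>i \<xi>. - d i \<xi>) (unit_col e)) x2 y2 (unit_col e) y3"
  proof (rule moves_transvection[OF sm2 d])
    show "jeq N (\<lambda>\<xi>. y2 i \<xi> - (\<Sum>k\<in>UNIV. y2 k \<xi> * d k \<xi>) * unit_col e i \<xi>) (y3 i)" for i
      unfolding y3_def[abs_def] using sm2 d
      by (intro jeq_refl smooth_near_diff smooth_near_mult smooth_near_sum) auto
    show "jeq N (\<lambda>\<xi>. x2 i \<xi> + d i \<xi> * (\<Sum>k\<in>UNIV. unit_col e k \<xi> * x2 k \<xi>)) (unit_col e i)" for i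
    proof (cases "i = e")
      case True
      then show ?thesis by (simp add: d_def x2_def)
    next
      case False
      have "jeq N (\<lambda>\<xi>. x2 i \<xi> + q i \<xi>) (\<lambda>\<xi>. x2 i \<xi> + (- x2 i \<xi>))"
        using sm2 q(2)[of i] by (intro jeq_add jeq_refl)
      then show ?thesis using False by (simp add: d_def x2_def)
    qed
  qed (auto simp: d_def)
  note sm3 = moves_smooth[OF 3]
  note m3 = moves_trans[OF moves_trans[OF 1(1) 2] 3]
  \<comment> \<open>Invariance of the pairing under all three moves so far, combined with
    \<open>yx\<close>.\<close>
  have "jeq N (\<lambda>\<xi>. \<Sum>k\<in>UNIV. y3 k \<xi> * unit_col e k \<xi>) (\<lambda>_. 1)"
    using jeq_trans[OF moves_pairing[OF m3] yx] .
  then have y3e: "jeq N (y3 e) (\<lambda>_. 1)" by simp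
  have "\<exists>q. trig_poly q \<and> jeq N q (y3 i)" for i
    using jet_trig_poly[OF sm3(2)[of i]] by metis
  then obtain t where t: "\<And>i. trig_poly (t i)" "\<And>i. jeq N (t i) (y3 i)" by metis
  \<comment> \<open>The zero at \<open>e\<close> makes \<open>?w\<close> orthogonal to the unit
    column. This gives a transvection and at the same time leaves the column as it is.\<close>
  let ?w = "\<lambda>i \<xi>. if i = e then 0 else t i \<xi>"
  have smw: "trig_poly (?w i)" for i using t by (cases "i = e") auto
  have 4: "moves N (transvection (unit_col e) ?w) (transvection (\<lambda>i \<xi>. - unit_col e i \<xi>) ?w)
      (unit_col e) y3 (unit_col e) (unit_col e)"
  proof (rule moves_transvection[OF sm3 _ smw])
    show "jeq N (\<lambda>\<xi>. unit_col e i \<xi> + unit_col e i \<xi> * (\<Sum>k\<in>UNIV. ?w k \<xi> * unit_col e k \<xi>)) (unit_col e i)" for i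
      by simp
    show "jeq N (\<lambda>\<xi>. y3 i \<xi> - (\<Sum>k\<in>UNIV. y3 k \<xi> * unit_col e k \<xi>) * ?w i \<xi>) (unit_col e i)" for i
    proof (cases "i = e")
      case True
      then show ?thesis using y3e by simp
    next
      case False
      have "jeq N (\<lambda>\<xi>. y3 i \<xi> - y3 e \<xi> * t i \<xi>) (\<lambda>\<xi>. y3 i \<xi> - 1 * y3 i \<xi>)"
        using y3e sm3(2) t(2) by (intro jeq_diff jeq_mult jeq_refl)
      then show ?thesis using False by simp
    qed
  qed auto
  show thesis using that[OF moves_trans[OF m3 4]] .
qed

section \<open>Gram matrix and orthogonalization of columns\<close>

text \<open>An entry of the conjugate transpose of \<open>V\<close> times \<open>V\<close>. For
  \<open>V\<close> the inverse of \<open>U\<close> this is the matrix on the left of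
  \<open>(\<ast>\<ast>)\<close>.\<close>

definition gram :: "(real^'d::finite \<Rightarrow> complex^'r::finite^'r) \<Rightarrow> 'r \<Rightarrow> 'r \<Rightarrow> real^'d \<Rightarrow> complex" where
  "gram V i j \<xi> = (\<Sum>k\<in>UNIV. cnj (V \<xi> $ k $ i) * V \<xi> $ k $ j)"

lemma cnj_gram: "cnj (gram V i j \<xi>) = gram V j i \<xi>"
  by (simp add: gram_def mult.commute)

lemma smooth_near_gram:
  assumes "inverse_pair U V" shows "smooth_near (gram V i j)"
  unfolding gram_def[abs_def] using inverse_pair_smooth[OF assms] by auto

text \<open>The diagonal entry is the squared norm of a column of an invertible matrix. The
  quotients in the Gram-Schmidt coefficients are therefore smooth.\<close>

lemma gram_diagonal_nonzero:
  assumes "inverse_pair U V" shows "gram V i i \<xi> \<noteq> 0"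
proof
  assume 0: "gram V i i \<xi> = 0"
  have "gram V i i \<xi> = of_real (\<Sum>k\<in>UNIV. (cmod (V \<xi> $ k $ i))\<^sup>2)"
    unfolding gram_def of_real_sum complex_norm_square by (intro sum.cong refl mult.commute)
  with 0 have "(\<Sum>k\<in>UNIV. (cmod (V \<xi> $ k $ i))\<^sup>2) = 0" by (simp only: of_real_eq_0_iff)
  then have "V \<xi> $ k $ i = 0" for k by (simp add: sum_nonneg_eq_0_iff)
  then have "(U \<xi> ** V \<xi>) $ i $ i = 0" by (simp add: matrix_matrix_mult_def)
  then show False using assms by (simp add: inverse_pair_def mat_def)
qed

text \<open>\<open>A\<close> is the set of columns of \<open>V\<close> already made orthogonal;
  column \<open>j\<close> is corrected by multiples of the columns in \<open>A\<close>. Since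
  neither \<open>j\<close> nor the columns in \<open>A\<close> are the column \<open>e\<close>, both
  unit vectors stay in place during the process.\<close>

lemma moves_to_unit_orthogonal:
  fixes x y :: "'r::finite \<Rightarrow> real^'d::finite \<Rightarrow> complex" and e :: 'r
  assumes start: "moves N U0 V0 x y (unit_col e) (unit_col e)" and "e \<notin> A"
  shows "\<exists>U V. moves N U V x y (unit_col e) (unit_col e) \<and>
    (\<forall>i\<in>A. \<forall>j\<in>A. i \<noteq> j \<longrightarrow> jeq N (gram V i j) (\<lambda>_. 0))"
proof -
  have "finite A" by simp
  then show ?thesis using \<open>e \<notin> A\<close>
  proof induction
    case empty
    then show ?case using start by blast
  next
    case (insert j A)
    then obtain U V where UV: "moves N U V x y (unit_col e) (unit_col e)"
      and orth: "\<And>i l. i \<in> A \<Longrightarrow> l \<in> A \<Longrightarrow> i \<noteq> l \<Longrightarrow> jeq N (gram V i l) (\<lambda>_. 0)"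
      by auto
    have ip: "inverse_pair U V" using UV by (simp add: moves_def)
    have je: "j \<noteq> e" "e \<notin> A" using insert.prems by auto
    have "\<exists>p. trig_poly p \<and> jeq N p (\<lambda>\<xi>. gram V i j \<xi> * inverse (gram V i i \<xi>))" for i
    proof -
      have "smooth_near (\<lambda>\<xi>. gram V i j \<xi> * inverse (gram V i i \<xi>))"
        using smooth_near_gram[OF ip] gram_diagonal_nonzero[OF ip] by auto
      then show ?thesis by (metis jet_trig_poly)
    qed
    then obtain p where p: "\<And>i. trig_poly (p i)"
      "\<And>i. jeq N (p i) (\<lambda>\<xi>. gram V i j \<xi> * inverse (gram V i i \<xi>))" by metis
    define c where "c i \<xi> = (if i \<in> A then p i \<xi> else 0)" for i \<xi>
    have c: "trig_poly (c i)" for i using p by (cases "i \<in> A") (auto simp: c_def[abs_def])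
    \<comment> \<open>The zero at \<open>j\<close> makes the matrix a transvection, and the zero at
      \<open>e\<close> preserves the unit row; the unit column is preserved because
      \<open>j \<noteq> e\<close>.\<close>
    have c0: "c j \<xi> = 0" "c e \<xi> = 0" for \<xi> using insert.hyps je by (auto simp: c_def)
    define V' where "V' \<xi> = V \<xi> ** transvection (\<lambda>i \<xi>. - c i \<xi>) (unit_col j) \<xi>" for \<xi>
    have "moves N (transvection c (unit_col j)) (transvection (\<lambda>i \<xi>. - c i \<xi>) (unit_col j))
        (unit_col e) (unit_col e) (unit_col e) (unit_col e)"
      by (rule moves_transvection) (use c c0 je in auto)
    from moves_trans[OF UV this]
    have moved: "moves N (\<lambda>\<xi>. transvection c (unit_col j) \<xi> ** U \<xi>) V' x y (unit_col e) (unit_col e)"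
      unfolding V'_def[abs_def] .
    have V': "V' \<xi> $ k $ l = V \<xi> $ k $ l - of_bool (l = j) * (\<Sum>i\<in>UNIV. c i \<xi> * V \<xi> $ k $ i)" for \<xi> k l
      by (simp add: V'_def matrix_matrix_mult_def transvection_def right_diff_distrib sum_subtractf
          sum_distrib_left mult_ac)
    have old: "gram V' i l = gram V i l" if "i \<in> A" "l \<in> A" for i l
    proof -
      have "i \<noteq> j" "l \<noteq> j" using that insert.hyps by auto
      then show ?thesis by (simp add: gram_def[abs_def] V')
    qed
    have new: "jeq N (gram V' i j) (\<lambda>_. 0)" if i: "i \<in> A" for i
    proof -
      have ij: "i \<noteq> j" using i insert.hyps by auto
      have eq: "gram V' i j = (\<lambda>\<xi>. gram V i j \<xi> - (\<Sum>l\<in>A. p l \<xi> * gram V i l \<xi>))"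
      proof
        fix \<xi>
        have "gram V' i j \<xi> = gram V i j \<xi> - (\<Sum>k\<in>UNIV. \<Sum>l\<in>UNIV. cnj (V \<xi> $ k $ i) * (c l \<xi> * V \<xi> $ k $ l))"
          using ij by (simp add: gram_def V' right_diff_distrib sum_subtractf sum_distrib_left)
        also have "(\<Sum>k\<in>UNIV. \<Sum>l\<in>UNIV. cnj (V \<xi> $ k $ i) * (c l \<xi> * V \<xi> $ k $ l))
            = (\<Sum>l\<in>UNIV. c l \<xi> * gram V i l \<xi>)"
          by (subst sum.swap) (simp add: gram_def sum_distrib_left mult_ac)
        also have "\<dots> = (\<Sum>l\<in>A. p l \<xi> * gram V i l \<xi>)"
          unfolding c_def by (intro sum.mono_neutral_cong_right) auto
        finally show "gram V' i j \<xi> = gram V i j \<xi> - (\<Sum>l\<in>A. p l \<xi> * gram V i l \<xi>)" .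
      qed
      \<comment> \<open>The columns in \<open>A\<close> are mutually orthogonal to order
        \<open>N\<close>, so only the summand with \<open>l = i\<close> survives, and its
        coefficient is chosen to cancel \<open>gram V i j\<close>.\<close>
      have "jeq N (\<lambda>\<xi>. gram V i j \<xi> - (\<Sum>l\<in>A. p l \<xi> * gram V i l \<xi>))
          (\<lambda>\<xi>. gram V i j \<xi> - (\<Sum>l\<in>A. if l = i then gram V i j \<xi> else 0))"
      proof (intro jeq_diff jeq_sum jeq_refl smooth_near_gram[OF ip])
        fix l assume "l \<in> A"
        show "jeq N (\<lambda>\<xi>. p l \<xi> * gram V i l \<xi>) (\<lambda>\<xi>. if l = i then gram V i j \<xi> else 0)"
        proof (cases "l = i")
          case True
          have "jeq N (\<lambda>\<xi>. p i \<xi> * gram V i i \<xi>) (\<lambda>\<xi>. (gram V i j \<xi> * inverse (gram V i i \<xi>)) * gram V i i \<xi>)"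
            by (intro jeq_mult p jeq_refl smooth_near_gram[OF ip])
          also have "(\<lambda>\<xi>. (gram V i j \<xi> * inverse (gram V i i \<xi>)) * gram V i i \<xi>) = gram V i j"
            using gram_diagonal_nonzero[OF ip] by (simp add: fun_eq_iff)
          finally show ?thesis using True by simp
        next
          case False
          have "jeq N (\<lambda>\<xi>. p l \<xi> * gram V i l \<xi>) (\<lambda>\<xi>. p l \<xi> * 0)"
            using p orth[OF i \<open>l \<in> A\<close>] False by (intro jeq_mult jeq_refl) auto
          then show ?thesis using False by simp
        qed
      qed
      then show ?thesis unfolding eq using i insert.hyps by simp
    qed
    have new': "jeq N (gram V' j i) (\<lambda>_. 0)" if "i \<in> A" for i
      using jeq_cnj[OF new[OF that]] by (simp add: cnj_gram)
    have "\<forall>i\<in>insert j A. \<forall>l\<in>insert j A. i \<noteq> l \<longrightarrow> jeq N (gram V' i l) (\<lambda>_. 0)"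
      using new new' old orth by auto
    then show ?case using moved by blast
  qed
qed


section \<open>The normal form\<close>

lemma inverse_pair_cancel:
  assumes "inverse_pair U V"
  shows "(\<Sum>j\<in>UNIV. (\<Sum>k\<in>UNIV. z k * V \<xi> $ k $ j) * U \<xi> $ j $ i) = z i" (is ?row)
    and "(\<Sum>i\<in>UNIV. V \<xi> $ k $ i * (\<Sum>l\<in>UNIV. U \<xi> $ i $ l * z l)) = z k" (is ?col)
proof -
  have VU: "(\<Sum>j\<in>UNIV. V \<xi> $ k $ j * U \<xi> $ j $ i) = of_bool (k = i)" for k i
  proof -
    have "(V \<xi> ** U \<xi>) $ k $ i = mat 1 $ k $ i" using assms by (simp add: inverse_pair_def)
    then show ?thesis by (simp add: matrix_matrix_mult_def mat_def)
  qed
  have "(\<Sum>j\<in>UNIV. (\<Sum>k\<in>UNIV. z k * V \<xi> $ k $ j) * U \<xi> $ j $ i)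
      = (\<Sum>k\<in>UNIV. z k * (\<Sum>j\<in>UNIV. V \<xi> $ k $ j * U \<xi> $ j $ i))"
    by (simp add: sum_distrib_left sum_distrib_right mult.assoc) (rule sum.swap)
  then show ?row by (simp add: VU)
  have "(\<Sum>i\<in>UNIV. V \<xi> $ k $ i * (\<Sum>l\<in>UNIV. U \<xi> $ i $ l * z l))
      = (\<Sum>l\<in>UNIV. (\<Sum>i\<in>UNIV. V \<xi> $ k $ i * U \<xi> $ i $ l) * z l)"
    by (simp add: sum_distrib_left sum_distrib_right mult.assoc) (rule sum.swap)
  then show ?col by (simp add: VU)
qed

text \<open>Applying \<open>V\<close> to \<open>U x\<close>, which is the unit column to order
  \<open>N\<close>, returns \<open>x\<close>. Hence column \<open>e\<close> of the inverse carries
  the jet of \<open>\<phi>h\<close>, the origin of the squared norm of \<open>\<phi>h\<close> in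
  \<open>(\<ast>\<ast>)\<close>.\<close>

lemma first_column_jet:
  assumes "inverse_pair U V" "\<And>i. jeq N (\<lambda>\<xi>. \<Sum>l\<in>UNIV. U \<xi> $ i $ l * x l \<xi>) (unit_col e i)"
  shows "jeq N (\<lambda>\<xi>. V \<xi> $ k $ e) (x k)"
proof -
  have "jeq N (\<lambda>\<xi>. \<Sum>i\<in>UNIV. V \<xi> $ k $ i * (\<Sum>l\<in>UNIV. U \<xi> $ i $ l * x l \<xi>))
      (\<lambda>\<xi>. \<Sum>i\<in>UNIV. V \<xi> $ k $ i * unit_col e i \<xi>)"
    by (intro jeq_sum jeq_mult jeq_refl inverse_pair_smooth[OF assms(1)] assms(2))
  then show ?thesis by (simp add: inverse_pair_cancel(2)[OF assms(1)] jeq_sym)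
qed

lemma trig_poly_row_filter:
  assumes "\<And>j. trig_poly (\<lambda>\<xi>. F \<xi> $ j)"
  obtains u where "finitely_supported u" "F = row_filter_fourier u"
proof -
  have "\<exists>u. finitely_supported u \<and> (\<lambda>\<xi>. F \<xi> $ j) = filter_fourier u" for j
    using assms by (auto simp: trig_poly_def)
  then obtain u where u: "\<And>j. finitely_supported (u j)" "\<And>j. (\<lambda>\<xi>. F \<xi> $ j) = filter_fourier (u j)"
    by metis
  let ?u = "\<lambda>k. \<chi> j. u j k"
  have "{k. ?u k \<noteq> 0} \<subseteq> (\<Union>j. {k. u j k \<noteq> 0})" by (auto simp: vec_eq_iff)
  then have "finitely_supported ?u"
    using u(1) unfolding finitely_supported_def by (elim finite_subset) auto
  moreover have "F \<xi> = row_filter_fourier ?u \<xi>" for \<xi>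
    using fun_cong[OF u(2)] by (simp add: row_filter_fourier_def vec_eq_iff)
  ultimately show thesis using that[of ?u] by blast
qed

lemma trig_poly_row_filter_fourier:
  assumes "finitely_supported u" shows "trig_poly (\<lambda>\<xi>. row_filter_fourier u \<xi> $ j)"
proof -
  have "finitely_supported (\<lambda>k. u k $ j)"
    using assms unfolding finitely_supported_def by (rule rev_finite_subset) auto
  then show ?thesis by (simp add: row_filter_fourier_def trig_poly_filter_fourier)
qed

lemma trig_poly_matrix_filter_fourier:
  assumes "finitely_supported a" shows "trig_poly (\<lambda>\<xi>. matrix_filter_fourier a \<xi> $ i $ j)"
  using assms trig_poly_matrix_iff trig_poly_matrix_def by blast

lemma real_vec_0: "real_vec 0 = 0"
  by (simp add: real_vec_def vec_eq_iff)

lemma zero_in_Omega: "0 \<in> Omega M"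
proof -
  have "0 = matrix_inv (transpose_real M) *v real_vec 0" by (simp add: real_vec_0)
  then show ?thesis unfolding Omega_def by auto
qed

lemma invertible_transpose_real:
  assumes "dilation_matrix M" shows "invertible (transpose_real M)"
  unfolding transpose_real_def invertible_def
  using matrix_inv_cancel[OF invertible_dilation_matrix[OF assms]]
  by (metis matrix_transpose_mul transpose_mat)

text \<open>\<open>M^T \<omega>\<close> is an integer vector, so after multiplication by
  \<open>M^T\<close> the shift by \<open>2 \<pi> \<omega>\<close> is a period.\<close>

lemma trig_poly_Omega_periodic:
  assumes "dilation_matrix M" "\<omega> \<in> Omega M" "trig_poly p"
  shows "p (transpose_real M *v (\<xi> + (2 * pi) *\<^sub>R \<omega>)) = p (transpose_real M *v \<xi>)"
proof -
  obtain k where k: "\<omega> = matrix_inv (transpose_real M) *v real_vec k"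
    using assms(2) by (auto simp: Omega_def)
  have "transpose_real M *v \<omega> = real_vec k"
    using matrix_inv_cancel[OF invertible_transpose_real[OF assms(1)]]
    by (simp add: k matrix_vector_mul_assoc)
  then have "transpose_real M *v (\<xi> + (2 * pi) *\<^sub>R \<omega>) = transpose_real M *v \<xi> + (2 * pi) *\<^sub>R real_vec k"
    by (simp add: matrix_vector_right_distrib matrix_vector_mult_scaleR)
  then show ?thesis using trig_poly_periodic[OF assms(3)] by simp
qed

lemma matching_filter_pairing:
  fixes M :: "int^'d::finite^'d" and a :: "int^'d \<Rightarrow> complex^'r::finite^'r"
  assumes M: "dilation_matrix M" and a: "finitely_supported a" and \<upsilon>: "finitely_supported \<upsilon>"
    and sm: "\<And>j. smooth_near (\<lambda>\<xi>. \<phi>h \<xi> $ j)"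
    and ref: "\<And>\<xi>. \<phi>h (transpose_real M *v \<xi>) = matrix_filter_fourier a \<xi> *v \<phi>h \<xi>"
    and sr: "sum_rules m M a \<upsilon>"
    and one: "(\<Sum>j\<in>UNIV. row_filter_fourier \<upsilon> 0 $ j * \<phi>h 0 $ j) = 1"
  shows "jeq m (\<lambda>\<xi>. \<Sum>j\<in>UNIV. row_filter_fourier \<upsilon> \<xi> $ j * \<phi>h \<xi> $ j) (\<lambda>_. 1)"
proof -
  let ?v = "row_filter_fourier \<upsilon>" and ?a = "matrix_filter_fourier a" and ?T = "\<lambda>\<xi>. transpose_real M *v \<xi>"
  let ?h = "\<lambda>\<xi>. \<Sum>j\<in>UNIV. ?v \<xi> $ j * \<phi>h \<xi> $ j"
  have tp: "trig_poly (\<lambda>\<xi>. (?v (?T \<xi>) v* ?a \<xi>) $ k)" for k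
    using trig_poly_compose_transpose_real[OF trig_poly_row_filter_fourier[OF \<upsilon>]] trig_poly_matrix_filter_fourier[OF a]
    by (auto simp: vector_matrix_mult_def)
  have "?h (?T \<xi>) = (\<Sum>k\<in>UNIV. (?v (?T \<xi>) v* ?a \<xi>) $ k * \<phi>h \<xi> $ k)" for \<xi>
    unfolding ref by (simp add: vector_matrix_mult_def matrix_vector_mult_def sum_distrib_left
        sum_distrib_right mult_ac) (rule sum.swap)
  moreover have "jeq m (\<lambda>\<xi>. (?v (?T \<xi>) v* ?a \<xi>) $ k) (\<lambda>\<xi>. ?v \<xi> $ k)" for k
    using sr zero_in_Omega[of M] smooth_near_trig_poly[OF tp]
      smooth_near_trig_poly[OF trig_poly_row_filter_fourier[OF \<upsilon>]]
    unfolding sum_rules_def jeq_def by fastforce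
  then have "jeq m (\<lambda>\<xi>. \<Sum>k\<in>UNIV. (?v (?T \<xi>) v* ?a \<xi>) $ k * \<phi>h \<xi> $ k) ?h"
    using sm by (intro jeq_sum jeq_mult jeq_refl)
  ultimately have "jeq m (\<lambda>\<xi>. ?h (?T \<xi>)) ?h" by simp
  from dilation_invariant_jet[OF M this] show ?thesis using one by simp
qed

lemma mult_vec_component: "(A *v x) $ i = (\<Sum>k\<in>UNIV. A $ i $ k * x $ k)"
  by (simp add: matrix_vector_mult_def)

lemma vec_mult_component:
  fixes A :: "complex^'s^'r::finite"
  shows "(x v* A) $ j = (\<Sum>k\<in>UNIV. x $ k * A $ k $ j)"
  by (simp add: vector_matrix_mult_def mult.commute)

lemma normalized_pair_iff:
  assumes ip: "inverse_pair U V" and sm: "\<And>j. smooth_near (\<lambda>\<xi>. \<phi>h \<xi> $ j)" and \<upsilon>: "finitely_supported \<upsilon>"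
  shows "normalized_pair m n e \<phi>h \<upsilon> U \<longleftrightarrow>
    (\<forall>i. jeq n (\<lambda>\<xi>. \<Sum>k\<in>UNIV. U \<xi> $ i $ k * \<phi>h \<xi> $ k) (unit_col e i)) \<and>
    (\<forall>j. jeq m (\<lambda>\<xi>. \<Sum>k\<in>UNIV. row_filter_fourier \<upsilon> \<xi> $ k * V \<xi> $ k $ j) (unit_col e j))"
proof -
  have s1: "smooth_near (\<lambda>\<xi>. \<Sum>k\<in>UNIV. U \<xi> $ i $ k * \<phi>h \<xi> $ k)" for i
    using inverse_pair_smooth[OF ip] sm by auto
  have s2: "smooth_near (\<lambda>\<xi>. \<Sum>k\<in>UNIV. row_filter_fourier \<upsilon> \<xi> $ k * V \<xi> $ k $ j)" for j
    using inverse_pair_smooth[OF ip] smooth_near_trig_poly[OF trig_poly_row_filter_fourier[OF \<upsilon>]] by auto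
  show ?thesis
    unfolding normalized_pair_def inverse_pair_matrix_inv[OF ip] mult_vec_component vec_mult_component jeq_def
    using s1 s2 by (auto simp: of_bool_def)
qed

text \<open>Item (2) is a consequence of item (1): the refinement equation governs column
  \<open>e\<close> of the new filter and the sum rules govern its row \<open>e\<close>, because
  column and row are unit vectors up to the respective orders.\<close>

lemma normalized_filterI:
  fixes M :: "int^'d::finite^'d" and a :: "int^'d \<Rightarrow> complex^'r::finite^'r"
  assumes M: "dilation_matrix M" and a: "finitely_supported a" and \<upsilon>: "finitely_supported \<upsilon>"
    and sm: "\<And>j. smooth_near (\<lambda>\<xi>. \<phi>h \<xi> $ j)"
    and ref: "\<And>\<xi>. \<phi>h (transpose_real M *v \<xi>) = matrix_filter_fourier a \<xi> *v \<phi>h \<xi>"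
    and sr: "sum_rules m M a \<upsilon>"
    and ip: "inverse_pair U V" and np: "normalized_pair m n e \<phi>h \<upsilon> U"
  shows "normalized_filter m n M e \<phi>h a \<upsilon> U"
proof -
  let ?v = "row_filter_fourier \<upsilon>" and ?a = "matrix_filter_fourier a" and ?T = "\<lambda>\<xi>. transpose_real M *v \<xi>"
  have tU: "trig_poly (\<lambda>\<xi>. U \<xi> $ i $ j)" and tV: "trig_poly (\<lambda>\<xi>. V \<xi> $ i $ j)" for i j
    using ip by (auto simp: inverse_pair_def)
  have UV: "U \<xi> ** V \<xi> = mat 1" "V \<xi> ** U \<xi> = mat 1" for \<xi>
    using ip by (auto simp: inverse_pair_def)
  note tv = trig_poly_row_filter_fourier[OF \<upsilon>] and ta = trig_poly_matrix_filter_fourier[OF a]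
  define A where "A \<xi> = U (?T \<xi>) ** ?a \<xi> ** V \<xi>" for \<xi>
  define w where "w \<xi> = ?v \<xi> v* V \<xi>" for \<xi>
  have tA: "trig_poly (\<lambda>\<xi>. A \<xi> $ i $ j)" for i j
    unfolding A_def by (intro trig_poly_matrix_mult trig_poly_compose_transpose_real[OF tU] ta tV)
  have tw: "trig_poly (\<lambda>\<xi>. w \<xi> $ j)" for j
    unfolding w_def vec_mult_component by (intro trig_poly_sum trig_poly_mult tv tV)
  obtain a' where a': "finitely_supported a'" "A = matrix_filter_fourier a'"
    using tA trig_poly_matrix_iff[of A] unfolding trig_poly_matrix_def by blast
  obtain \<upsilon>' where \<upsilon>': "finitely_supported \<upsilon>'" "w = row_filter_fourier \<upsilon>'"
    using tw by (rule trig_poly_row_filter)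
  have refA: "U (?T \<xi>) *v \<phi>h (?T \<xi>) = A \<xi> *v (U \<xi> *v \<phi>h \<xi>)" for \<xi>
  proof -
    have "A \<xi> *v (U \<xi> *v \<phi>h \<xi>) = (U (?T \<xi>) ** ?a \<xi> ** (V \<xi> ** U \<xi>)) *v \<phi>h \<xi>"
      by (simp add: A_def matrix_vector_mul_assoc matrix_mul_assoc)
    then show ?thesis by (simp add: UV ref matrix_vector_mul_assoc)
  qed
  have col: "jeq n (\<lambda>\<xi>. (U \<xi> *v \<phi>h \<xi>) $ i) (unit_col e i)"
    and row: "jeq m (\<lambda>\<xi>. w \<xi> $ j) (unit_col e j)" for i j
    using np unfolding normalized_pair_iff[OF ip sm \<upsilon>] mult_vec_component w_def vec_mult_component
    by auto
  \<comment> \<open>Column \<open>e\<close> of \<open>A\<close> is to order \<open>n\<close> the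
    product of \<open>A\<close> with \<open>U \<phi>h\<close>. By the refinement equation this is
    \<open>U \<phi>h\<close> at \<open>M^T \<xi>\<close>, again the unit column to order
    \<open>n\<close>.\<close>
  have Acol: "jeq n (\<lambda>\<xi>. A \<xi> $ i $ e) (unit_col e i)" for i
  proof -
    have "jeq n (\<lambda>\<xi>. \<Sum>k\<in>UNIV. A \<xi> $ i $ k * (U \<xi> *v \<phi>h \<xi>) $ k) (\<lambda>\<xi>. \<Sum>k\<in>UNIV. A \<xi> $ i $ k * unit_col e k \<xi>)"
      by (intro jeq_sum jeq_mult jeq_refl col smooth_near_trig_poly tA)
    then have "jeq n (\<lambda>\<xi>. A \<xi> $ i $ e) (\<lambda>\<xi>. (A \<xi> *v (U \<xi> *v \<phi>h \<xi>)) $ i)"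
      by (simp add: mult_vec_component[of "A _"] jeq_sym)
    also have "(\<lambda>\<xi>. (A \<xi> *v (U \<xi> *v \<phi>h \<xi>)) $ i) = (\<lambda>\<xi>. (U (?T \<xi>) *v \<phi>h (?T \<xi>)) $ i)"
      by (simp add: refA)
    also have "jeq n \<dots> (unit_col e i)"
      by (rule jeq_compose_matrix[OF col])
    finally show ?thesis .
  qed
  have tw2: "smooth_near (\<lambda>\<xi>. w (?T \<xi>) $ i)" and tA2: "smooth_near (\<lambda>\<xi>. A (\<xi> + z) $ i $ j)" for i j z
    using trig_poly_compose_transpose_real[OF tw] trig_poly_translate[OF tA] by (auto intro: smooth_near_trig_poly)
  have sum_rule: "jeq m (\<lambda>\<xi>. (w (?T \<xi>) v* A (\<xi> + (2 * pi) *\<^sub>R \<omega>)) $ j)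
      (\<lambda>\<xi>. (if \<omega> = 0 then 1 else 0) * w \<xi> $ j)" if \<omega>: "\<omega> \<in> Omega M" for \<omega> j
  proof -
    let ?z = "(2 * pi) *\<^sub>R \<omega>"
    have "w (?T \<xi>) v* A (\<xi> + ?z) = (?v (?T \<xi>) v* ?a (\<xi> + ?z)) v* V (\<xi> + ?z)" for \<xi>
    proof -
      \<comment> \<open>The sum rule evaluates the row at \<open>M^T \<xi>\<close>, without the
        shift. Periodicity makes the factors \<open>V\<close> and \<open>U\<close> between row and
        filter cancel nevertheless.\<close>
      have "U (?T (\<xi> + ?z)) = U (?T \<xi>)"
        using trig_poly_Omega_periodic[OF M \<omega> tU] by (simp add: vec_eq_iff)
      then have "w (?T \<xi>) v* A (\<xi> + ?z)
          = ?v (?T \<xi>) v* ((V (?T \<xi>) ** U (?T \<xi>)) ** ?a (\<xi> + ?z) ** V (\<xi> + ?z))"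
        by (simp only: w_def A_def vector_matrix_mul_assoc matrix_mul_assoc)
      then show ?thesis by (simp add: UV vector_matrix_mul_assoc)
    qed
    then have eq: "(\<lambda>\<xi>. (w (?T \<xi>) v* A (\<xi> + ?z)) $ j)
        = (\<lambda>\<xi>. \<Sum>k\<in>UNIV. (?v (?T \<xi>) v* ?a (\<xi> + ?z)) $ k * V (\<xi> + ?z) $ k $ j)"
      by (simp add: vec_mult_component[of _ "V _"])
    have "jeq m (\<lambda>\<xi>. \<Sum>k\<in>UNIV. (?v (?T \<xi>) v* ?a (\<xi> + ?z)) $ k * V (\<xi> + ?z) $ k $ j)
        (\<lambda>\<xi>. \<Sum>k\<in>UNIV. ((if \<omega> = 0 then 1 else 0) * ?v \<xi> $ k) * V (\<xi> + ?z) $ k $ j)"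
    proof (intro jeq_sum jeq_mult jeq_refl)
      fix k
      have "trig_poly (\<lambda>\<xi>. (?v (?T \<xi>) v* ?a (\<xi> + ?z)) $ k)"
        unfolding vec_mult_component
        by (intro trig_poly_sum trig_poly_mult trig_poly_compose_transpose_real[OF tv] trig_poly_translate[OF ta])
      then show "jeq m (\<lambda>\<xi>. (?v (?T \<xi>) v* ?a (\<xi> + ?z)) $ k) (\<lambda>\<xi>. (if \<omega> = 0 then 1 else 0) * ?v \<xi> $ k)"
        using sr \<omega> smooth_near_trig_poly[OF tv[of k]] unfolding sum_rules_def jeq_def
        by (auto intro: smooth_near_trig_poly)
      show "smooth_near (\<lambda>\<xi>. V (\<xi> + ?z) $ k $ j)"
        by (intro smooth_near_trig_poly trig_poly_translate[OF tV])
    qed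
    also have "(\<lambda>\<xi>. \<Sum>k\<in>UNIV. ((if \<omega> = 0 then 1 else 0) * ?v \<xi> $ k) * V (\<xi> + ?z) $ k $ j)
        = (\<lambda>\<xi>. (if \<omega> = 0 then 1 else 0) * w \<xi> $ j)"
      by (cases "\<omega> = 0") (simp_all add: w_def vec_mult_component)
    finally show ?thesis unfolding eq .
  qed
  \<comment> \<open>Row \<open>e\<close> is obtained from \<open>A\<close> by multiplication with
    the unit row, which has the jet of \<open>w\<close> at \<open>M^T \<xi>\<close>; so the new sum
    rule applies.\<close>
  have Arow: "jeq m (\<lambda>\<xi>. A (\<xi> + (2 * pi) *\<^sub>R \<omega>) $ e $ j) (\<lambda>\<xi>. (if \<omega> = 0 then 1 else 0) * unit_col e j \<xi>)"
    if \<omega>: "\<omega> \<in> Omega M" for \<omega> j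
  proof -
    let ?z = "(2 * pi) *\<^sub>R \<omega>"
    have "jeq m (\<lambda>\<xi>. \<Sum>k\<in>UNIV. w (?T \<xi>) $ k * A (\<xi> + ?z) $ k $ j) (\<lambda>\<xi>. \<Sum>k\<in>UNIV. of_bool (k = e) * A (\<xi> + ?z) $ k $ j)"
      by (intro jeq_sum jeq_mult jeq_refl tA2 jeq_compose_matrix[OF row])
    then have "jeq m (\<lambda>\<xi>. A (\<xi> + ?z) $ e $ j) (\<lambda>\<xi>. (w (?T \<xi>) v* A (\<xi> + ?z)) $ j)"
      by (simp add: vec_mult_component jeq_sym)
    also have "jeq m \<dots> (\<lambda>\<xi>. (if \<omega> = 0 then 1 else 0) * w \<xi> $ j)" by (rule sum_rule[OF \<omega>])
    also have "jeq m \<dots> (\<lambda>\<xi>. (if \<omega> = 0 then 1 else 0) * unit_col e j \<xi>)"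
      by (intro jeq_cmult row)
    finally show ?thesis .
  qed
  have "normal_form m n M e a'"
    unfolding normal_form_def a'(2)[symmetric]
  proof (intro conjI ballI allI impI)
    show "eq_upto n (\<lambda>\<xi>. A \<xi> $ e $ e) (\<lambda>\<xi>. 1)" using Acol[of e] by (simp add: jeq_def)
    show "eq_upto m (\<lambda>\<xi>. A (\<xi> + (2 * pi) *\<^sub>R \<omega>) $ e $ e) (\<lambda>\<xi>. 0)" if "\<omega> \<in> Omega M - {0}" for \<omega>
      using Arow[of \<omega> e] that by (simp add: jeq_def)
    show "eq_upto m (\<lambda>\<xi>. A (\<xi> + (2 * pi) *\<^sub>R \<omega>) $ e $ j) (\<lambda>\<xi>. 0)" if "\<omega> \<in> Omega M" "j \<noteq> e" for \<omega> j
      using Arow[of \<omega> j] that by (simp add: jeq_def)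
    show "eq_upto n (\<lambda>\<xi>. A \<xi> $ i $ e) (\<lambda>\<xi>. 0)" if "i \<noteq> e" for i
      using Acol[of i] that by (simp add: jeq_def)
  qed
  moreover have "sum_rules m M a' \<upsilon>'"
    unfolding sum_rules_def a'(2)[symmetric] \<upsilon>'(2)[symmetric]
  proof (intro conjI ballI allI)
    \<comment> \<open>The new row cannot vanish at the origin, as the old one is recovered from
      it.\<close>
    have "w 0 v* U 0 = ?v 0" by (simp add: w_def vector_matrix_mul_assoc UV)
    then show "w 0 \<noteq> 0" using sr unfolding sum_rules_def by auto
  qed (use sum_rule in \<open>simp add: jeq_def\<close>)
  ultimately show ?thesis
    unfolding normalized_filter_def inverse_pair_matrix_inv[OF ip]
    using a' \<upsilon>' refA A_def w_def by metis
qed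

lemma norm_square_complex_vec:
  fixes z :: "complex^'r::finite"
  shows "complex_of_real ((norm z)\<^sup>2) = (\<Sum>k\<in>UNIV. cnj (z $ k) * z $ k)"
proof -
  have "(norm z)\<^sup>2 = (\<Sum>k\<in>UNIV. (cmod (z $ k))\<^sup>2)"
    by (simp add: norm_vec_def L2_set_def sum_nonneg)
  also have "complex_of_real \<dots> = (\<Sum>k\<in>UNIV. cnj (z $ k) * z $ k)"
    unfolding of_real_sum complex_norm_square by (intro sum.cong refl mult.commute)
  finally show ?thesis .
qed

text \<open>The inverse of the conjugate of \<open>U\<close> is the conjugate of \<open>V\<close>,
  so the matrix is the Gram matrix of the columns of \<open>V\<close>. Diagonal entries other than
  \<open>e\<close> are compared with themselves, which leaves the off-diagonal entries and the entry
  \<open>e\<close>.\<close>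

lemma almost_orthogonal_iff:
  assumes ip: "inverse_pair U V" and sm: "\<And>j. smooth_near (\<lambda>\<xi>. \<phi>h \<xi> $ j)"
  shows "almost_orthogonal N e \<phi>h U \<longleftrightarrow>
    (\<forall>i j. i \<noteq> j \<longrightarrow> jeq N (gram V i j) (\<lambda>_. 0)) \<and>
    jeq N (gram V e e) (\<lambda>\<xi>. \<Sum>k\<in>UNIV. cnj (\<phi>h \<xi> $ k) * \<phi>h \<xi> $ k)"
proof -
  have entry: "(transpose (matrix_inv (map_matrix cnj (U \<xi>))) ** V \<xi>) $ i $ j = gram V i j \<xi>" for \<xi> i j
  proof -
    have conj_mult: "map_matrix cnj A ** map_matrix cnj B = map_matrix cnj (A ** B)" for A B :: "complex^'b^'b"
      by (simp add: matrix_matrix_mult_def map_matrix_def vec_eq_iff)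
    have "map_matrix cnj (mat 1 :: complex^'b^'b) = mat 1"
      by (simp add: map_matrix_def mat_def vec_eq_iff)
    then have "matrix_inv (map_matrix cnj (U \<xi>)) = map_matrix cnj (V \<xi>)"
      using ip by (intro matrix_inv_unique) (simp_all add: conj_mult inverse_pair_def)
    then show ?thesis
      by (simp add: inverse_pair_matrix_inv[OF ip] matrix_matrix_mult_def transpose_def map_matrix_def gram_def)
  qed
  have diag: "complex_of_real ((norm (column i (V \<xi>)))\<^sup>2) = gram V i i \<xi>" for i \<xi>
    by (simp only: norm_square_complex_vec gram_def column_def vec_lambda_beta)
  have cases: "eq_upto N (gram V i j) (\<lambda>\<xi>. if i \<noteq> j then 0 else if i = e then
        complex_of_real ((norm (\<phi>h \<xi>))\<^sup>2) else gram V i i \<xi>)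
      \<longleftrightarrow> (if i \<noteq> j then eq_upto N (gram V i j) (\<lambda>_. 0) else if i = e then
        eq_upto N (gram V e e) (\<lambda>\<xi>. complex_of_real ((norm (\<phi>h \<xi>))\<^sup>2)) else True)" for i j
    by (simp add: eq_upto_def)
  have smn: "smooth_near (\<lambda>\<xi>. \<Sum>k\<in>UNIV. cnj (\<phi>h \<xi> $ k) * \<phi>h \<xi> $ k)" using sm by auto
  show ?thesis
    unfolding almost_orthogonal_def inverse_pair_matrix_inv[OF ip] entry diag cases
    unfolding norm_square_complex_vec jeq_def
    using smooth_near_gram[OF ip] smn by (auto split: if_splits)
qed


section \<open>Existence of the normalizing matrix and the converse\<close>

theorem theorem1p2:
  fixes M :: "int^'d::finite^'d"
    and \<phi> :: "'r::finite \<Rightarrow> (real^'d \<Rightarrow> complex) \<Rightarrow> complex"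
    and a :: "int^'d \<Rightarrow> complex^'r^'r"
    and \<upsilon> :: "int^'d \<Rightarrow> complex^'r"
    and e :: 'r
    and m n :: nat
  assumes "1 \<le> m" and "1 \<le> n" and "2 \<le> CARD('r)"
    and "dilation_matrix M"
    and "\<And>j. compactly_supported_distribution (\<phi> j)"
    and "finitely_supported a"
    and "\<And>\<xi>. distr_vec_fourier \<phi> (transpose_real M *v \<xi>) =
               matrix_filter_fourier a \<xi> *v distr_vec_fourier \<phi> \<xi>"
    and "distr_vec_fourier \<phi> 0 \<noteq> 0"
    and "finitely_supported \<upsilon>"
    and "sum_rules m M a \<upsilon>"
    and "(\<Sum>j\<in>UNIV. row_filter_fourier \<upsilon> 0 $ j * distr_vec_fourier \<phi> 0 $ j) = 1"
  shows
    "(\<exists>U. strongly_invertible U \<and>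
          normalized_pair m n e (distr_vec_fourier \<phi>) \<upsilon> U \<and>
          normalized_filter m n M e (distr_vec_fourier \<phi>) a \<upsilon> U) \<and>
     (row_condition m (distr_vec_fourier \<phi>) \<upsilon> \<longrightarrow>
       (\<exists>U. strongly_invertible U \<and>
            normalized_pair m n e (distr_vec_fourier \<phi>) \<upsilon> U \<and>
            normalized_filter m n M e (distr_vec_fourier \<phi>) a \<upsilon> U \<and>
            almost_orthogonal (max m n) e (distr_vec_fourier \<phi>) U)) \<and>
     (m \<le> n \<longrightarrow>
       (\<exists>U. strongly_invertible U \<and>
            normalized_pair m n e (distr_vec_fourier \<phi>) \<upsilon> U \<and>
            normalized_filter m n M e (distr_vec_fourier \<phi>) a \<upsilon> U \<and>
            almost_orthogonal (max m n) e (distr_vec_fourier \<phi>) U) \<longrightarrow>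
       row_condition m (distr_vec_fourier \<phi>) \<upsilon>)"
proof -
  let ?p = "distr_vec_fourier \<phi>" and ?v = "row_filter_fourier \<upsilon>"
  let ?P = "\<lambda>U. strongly_invertible U \<and> normalized_pair m n e ?p \<upsilon> U \<and> normalized_filter m n M e ?p a \<upsilon> U"
  define x where "x j \<xi> = ?p \<xi> $ j" for j \<xi>
  define v where "v j \<xi> = ?v \<xi> $ j" for j \<xi>
  define q where "q \<xi> = (\<Sum>k\<in>UNIV. cnj (x k \<xi>) * x k \<xi>)" for \<xi>
  let ?N = "max m n"
  have N: "1 \<le> ?N" using assms(1) by simp
  have smx: "smooth_near (x j)" for j
    using smooth_near_distr_fourier[OF assms(5)[of j]] by (simp add: x_def[abs_def] distr_vec_fourier_def)
  then have sm: "smooth_near (\<lambda>\<xi>. ?p \<xi> $ j)" for j by (simp add: x_def[abs_def])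
  have smv: "smooth_near (v j)" for j
    unfolding v_def[abs_def] by (intro smooth_near_trig_poly trig_poly_row_filter_fourier assms(9))
  have smq: "smooth_near q" unfolding q_def[abs_def] using smx by auto
  have norm_p: "complex_of_real ((norm (?p \<xi>))\<^sup>2) = q \<xi>" for \<xi>
    by (simp only: norm_square_complex_vec q_def x_def)
  have q0: "q 0 \<noteq> 0" using assms(8) unfolding norm_p[symmetric] by simp
  have pairing: "jeq m (\<lambda>\<xi>. \<Sum>j\<in>UNIV. v j \<xi> * x j \<xi>) (\<lambda>_. 1)"
    unfolding x_def v_def by (rule matching_filter_pairing[OF assms(4,6,9) sm assms(7,10,11)])
  \<comment> \<open>\<open>U\<close> is built for a substitute row \<open>y\<close> to the full
    order \<open>?N\<close>. The true row \<open>v\<close> shares only the jet of order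
    \<open>m\<close>, which is all that item (1) asks of it.\<close>
  have normalized: "?P U" if ip: "inverse_pair U V" and y: "moves ?N U V x y (unit_col e) (unit_col e)"
    and vy: "\<And>j. jeq m (v j) (y j)" for U V y
  proof -
    have "jeq n (\<lambda>\<xi>. \<Sum>k\<in>UNIV. U \<xi> $ i $ k * x k \<xi>) (unit_col e i)" for i
      by (rule jeq_le[of ?N]) (use y in \<open>simp_all add: moves_def\<close>)
    moreover have "jeq m (\<lambda>\<xi>. \<Sum>k\<in>UNIV. v k \<xi> * V \<xi> $ k $ j) (unit_col e j)" for j
    proof -
      have "jeq m (\<lambda>\<xi>. \<Sum>k\<in>UNIV. v k \<xi> * V \<xi> $ k $ j) (\<lambda>\<xi>. \<Sum>k\<in>UNIV. y k \<xi> * V \<xi> $ k $ j)"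
        by (intro jeq_sum jeq_mult jeq_refl vy inverse_pair_smooth[OF ip])
      also have "jeq m \<dots> (unit_col e j)"
        by (rule jeq_le[of ?N]) (use y in \<open>simp_all add: moves_def\<close>)
      finally show ?thesis .
    qed
    ultimately have np: "normalized_pair m n e ?p \<upsilon> U"
      unfolding normalized_pair_iff[OF ip sm assms(9)] x_def v_def by blast
    show ?thesis
      using inverse_pair_strongly_invertible[OF ip] np
        normalized_filterI[OF assms(4,6,9) sm assms(7,10) ip np] by blast
  qed
  have part1: "\<exists>U. ?P U"
  proof -
    define h where "h \<xi> = (\<Sum>j\<in>UNIV. v j \<xi> * x j \<xi>)" for \<xi>
    have smh: "smooth_near h" unfolding h_def[abs_def] using smv smx by auto
    have h0: "h 0 \<noteq> 0" using assms(11) by (simp add: h_def v_def x_def)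
    \<comment> \<open>Dividing by the pairing makes it 1 near the origin. As \<open>h\<close> is 1
      to order \<open>m\<close>, the jet of order \<open>m\<close> is not altered.\<close>
    define y where "y j \<xi> = inverse (h \<xi>) * v j \<xi>" for j \<xi>
    have smy: "smooth_near (y j)" for j
      unfolding y_def[abs_def] using smh h0 smv by auto
    have "(\<lambda>\<xi>. \<Sum>k\<in>UNIV. y k \<xi> * x k \<xi>) = (\<lambda>\<xi>. inverse (h \<xi>) * h \<xi>)"
      by (simp add: y_def h_def sum_distrib_left mult.assoc)
    then have "jeq ?N (\<lambda>\<xi>. \<Sum>k\<in>UNIV. y k \<xi> * x k \<xi>) (\<lambda>_. 1)"
      using jeq_inverse_mult[OF smh h0] by simp
    then obtain U V where UV: "moves ?N U V x y (unit_col e) (unit_col e)"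
      by (rule moves_to_unit[OF assms(3) smx smy _ N])
    have "jeq m (\<lambda>\<xi>. inverse (h \<xi>) * 1) (\<lambda>\<xi>. inverse (h \<xi>) * h \<xi>)"
      using smh h0 pairing unfolding h_def[abs_def, symmetric]
      by (intro jeq_mult jeq_refl) (auto intro: jeq_sym)
    also have "jeq m \<dots> (\<lambda>_. 1)" by (rule jeq_inverse_mult[OF smh h0])
    finally have "jeq m (y j) (\<lambda>\<xi>. 1 * v j \<xi>)" for j
      unfolding y_def[abs_def] by (intro jeq_mult jeq_refl smv) simp
    then show ?thesis
      using normalized[OF _ UV] UV by (auto simp: moves_def jeq_sym)
  qed
  define y where "y j \<xi> = inverse (q \<xi>) * cnj (x j \<xi>)" for j \<xi>
  have smy: "smooth_near (y j)" for j
    unfolding y_def[abs_def] using smq q0 smx by auto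
  have row_condition_iff: "row_condition m ?p \<upsilon> \<longleftrightarrow> (\<forall>j. jeq m (v j) (y j))"
    unfolding row_condition_def jeq_def norm_p using smv smy
    by (simp add: v_def[abs_def] y_def[abs_def] x_def[abs_def])
  have qy: "jeq K (\<lambda>\<xi>. q \<xi> * y j \<xi>) (\<lambda>\<xi>. cnj (x j \<xi>))" for K j
  proof -
    have "jeq K (\<lambda>\<xi>. (inverse (q \<xi>) * q \<xi>) * cnj (x j \<xi>)) (\<lambda>\<xi>. 1 * cnj (x j \<xi>))"
      by (intro jeq_mult jeq_inverse_mult smq q0 jeq_refl smooth_near_cnj smx)
    then show ?thesis by (simp add: y_def mult_ac)
  qed
  \<comment> \<open>Column \<open>e\<close> of \<open>V\<close> has the jet of \<open>x\<close>, so
    row \<open>e\<close> of the Gram matrix is the conjugate row of \<open>x\<close> times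
    \<open>V\<close>. Both directions of item (3) rest on this.\<close>
  have gram_row: "jeq K (gram V e j) (\<lambda>\<xi>. \<Sum>k\<in>UNIV. cnj (x k \<xi>) * V \<xi> $ k $ j)"
    if ip: "inverse_pair U V" and ux: "\<And>i. jeq K (\<lambda>\<xi>. \<Sum>l\<in>UNIV. U \<xi> $ i $ l * x l \<xi>) (unit_col e i)"
    for K j U V
    unfolding gram_def[abs_def]
    by (intro jeq_sum jeq_mult jeq_cnj first_column_jet[OF ip ux] jeq_refl inverse_pair_smooth[OF ip])
  have part2: "\<exists>U. strongly_invertible U \<and> normalized_pair m n e ?p \<upsilon> U \<and>
      normalized_filter m n M e ?p a \<upsilon> U \<and> almost_orthogonal ?N e ?p U"
    if "row_condition m ?p \<upsilon>"
  proof -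
    have "(\<lambda>\<xi>. \<Sum>k\<in>UNIV. y k \<xi> * x k \<xi>) = (\<lambda>\<xi>. inverse (q \<xi>) * q \<xi>)"
      by (simp add: y_def q_def sum_distrib_left mult.assoc)
    then have "jeq ?N (\<lambda>\<xi>. \<Sum>k\<in>UNIV. y k \<xi> * x k \<xi>) (\<lambda>_. 1)"
      using jeq_inverse_mult[OF smq q0] by simp
    then obtain U0 V0 where "moves ?N U0 V0 x y (unit_col e) (unit_col e)"
      by (rule moves_to_unit[OF assms(3) smx smy _ N])
    from moves_to_unit_orthogonal[OF this, of "UNIV - {e}"]
    obtain U V where UV: "moves ?N U V x y (unit_col e) (unit_col e)"
      and orth: "\<And>i j. i \<noteq> e \<Longrightarrow> j \<noteq> e \<Longrightarrow> i \<noteq> j \<Longrightarrow> jeq ?N (gram V i j) (\<lambda>_. 0)" by auto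
    have ip: "inverse_pair U V" using UV by (simp add: moves_def)
    have "?P U" using that normalized[OF ip UV] unfolding row_condition_iff by blast
    \<comment> \<open>The conjugate of \<open>x\<close> is \<open>q\<close> times \<open>y\<close>,
      and \<open>y V\<close> is the unit row. Orthogonality to column \<open>e\<close> thus comes
      without any change of that column, with \<open>q\<close> as its squared norm.\<close>
    moreover have row: "jeq ?N (gram V e j) (\<lambda>\<xi>. q \<xi> * unit_col e j \<xi>)" for j
    proof -
      have "jeq ?N (gram V e j) (\<lambda>\<xi>. \<Sum>k\<in>UNIV. cnj (x k \<xi>) * V \<xi> $ k $ j)"
        using UV by (intro gram_row[OF ip]) (auto simp: moves_def)
      also have "jeq ?N \<dots> (\<lambda>\<xi>. \<Sum>k\<in>UNIV. (q \<xi> * y k \<xi>) * V \<xi> $ k $ j)"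
        by (intro jeq_sum jeq_mult jeq_sym[OF qy] jeq_refl inverse_pair_smooth[OF ip])
      also have "(\<lambda>\<xi>. \<Sum>k\<in>UNIV. (q \<xi> * y k \<xi>) * V \<xi> $ k $ j) = (\<lambda>\<xi>. q \<xi> * (\<Sum>k\<in>UNIV. y k \<xi> * V \<xi> $ k $ j))"
        by (simp add: sum_distrib_left mult.assoc)
      also have "jeq ?N \<dots> (\<lambda>\<xi>. q \<xi> * unit_col e j \<xi>)"
        using UV by (intro jeq_mult jeq_refl smq) (auto simp: moves_def)
      finally show ?thesis .
    qed
    have "almost_orthogonal ?N e ?p U"
      unfolding almost_orthogonal_iff[OF ip sm]
    proof (intro conjI allI impI)
      show "jeq ?N (gram V e e) (\<lambda>\<xi>. \<Sum>k\<in>UNIV. cnj (?p \<xi> $ k) * ?p \<xi> $ k)"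
        using row[of e] by (simp add: q_def[abs_def] x_def[abs_def])
      have row0: "jeq ?N (gram V e j) (\<lambda>_. 0)" if "j \<noteq> e" for j using row[of j] that by simp
      show "jeq ?N (gram V i j) (\<lambda>_. 0)" if "i \<noteq> j" for i j
      proof (cases "i = e \<or> j = e")
        case False
        then show ?thesis using orth that by blast
      next
        case True
        then show ?thesis
          using row0[of j] jeq_cnj[OF row0[of i]] that by (auto simp: cnj_gram)
      qed
    qed
    ultimately show ?thesis by blast
  qed
  have part3: "row_condition m ?p \<upsilon>"
    if "m \<le> n" and si: "strongly_invertible U" and np: "normalized_pair m n e ?p \<upsilon> U"
      and ao: "almost_orthogonal ?N e ?p U" for U
  proof -
    define V where "V \<xi> = matrix_inv (U \<xi>)" for \<xi>
    have ip: "inverse_pair U V" using si unfolding strongly_invertible_iff V_def[abs_def] .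
    \<comment> \<open>The condition on the column holds to order \<open>n\<close>, and
      \<open>m \<le> n\<close> brings it down to order \<open>m\<close>.\<close>
    have ux: "jeq m (\<lambda>\<xi>. \<Sum>l\<in>UNIV. U \<xi> $ i $ l * x l \<xi>) (unit_col e i)"
      and vV: "jeq m (\<lambda>\<xi>. \<Sum>k\<in>UNIV. v k \<xi> * V \<xi> $ k $ j) (unit_col e j)" for i j
      using np \<open>m \<le> n\<close> unfolding normalized_pair_iff[OF ip sm assms(9)] x_def v_def
      by (blast intro: jeq_le)+
    have row: "jeq m (gram V e j) (\<lambda>\<xi>. q \<xi> * unit_col e j \<xi>)" for j
      using ao unfolding almost_orthogonal_iff[OF ip sm]
      by (cases "j = e") (auto simp: q_def[abs_def] x_def intro: jeq_le[of ?N])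
    \<comment> \<open>After multiplication by \<open>V\<close> both rows have the jet of row
      \<open>e\<close> of the Gram matrix. Multiplying by \<open>U\<close> removes \<open>V\<close>
      again.\<close>
    have "jeq m (\<lambda>\<xi>. cnj (x i \<xi>)) (\<lambda>\<xi>. q \<xi> * v i \<xi>)" for i
    proof -
      have "jeq m (\<lambda>\<xi>. \<Sum>k\<in>UNIV. cnj (x k \<xi>) * V \<xi> $ k $ j) (\<lambda>\<xi>. q \<xi> * (\<Sum>k\<in>UNIV. v k \<xi> * V \<xi> $ k $ j))" for j
        using jeq_trans[OF jeq_sym[OF gram_row[OF ip ux]] jeq_trans[OF row
            jeq_mult[OF jeq_refl[OF smq] jeq_sym[OF vV]]]] .
      then have "jeq m (\<lambda>\<xi>. \<Sum>j\<in>UNIV. (\<Sum>k\<in>UNIV. cnj (x k \<xi>) * V \<xi> $ k $ j) * U \<xi> $ j $ i)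
          (\<lambda>\<xi>. \<Sum>j\<in>UNIV. (q \<xi> * (\<Sum>k\<in>UNIV. v k \<xi> * V \<xi> $ k $ j)) * U \<xi> $ j $ i)"
        by (intro jeq_sum jeq_mult jeq_refl inverse_pair_smooth[OF ip])
      then show ?thesis
        by (simp only: inverse_pair_cancel(1)[OF ip] mult.assoc sum_distrib_left[symmetric])
    qed
    then have "jeq m (y i) (\<lambda>\<xi>. inverse (q \<xi>) * (q \<xi> * v i \<xi>))" for i
      unfolding y_def[abs_def] using smq q0 by (intro jeq_mult jeq_refl smooth_near_inverse)
    moreover have "jeq m (\<lambda>\<xi>. (inverse (q \<xi>) * q \<xi>) * v i \<xi>) (\<lambda>\<xi>. 1 * v i \<xi>)" for i
      by (intro jeq_mult jeq_inverse_mult smq q0 jeq_refl smv)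
    ultimately have "jeq m (v i) (y i)" for i
      by (simp add: mult.assoc) (metis jeq_sym jeq_trans)
    then show ?thesis unfolding row_condition_iff by blast
  qed
  show ?thesis using part1 part2 part3 by blast
qed

end
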